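(* Let $p>3$ be a prime and $t\in\mathbb{F}_p^\times$ with $t\neq 1$. Let $f_t(y)=27y^3-27y^2+\frac4t$ and $g_t(y)=27y^3-27y^2+\frac{4}{1-t}$ be polynomials over $\mathbb{F}_p$. If $f_t(y)\equiv 0\pmod p$ has $r_1$ incongruent solutions and $g_t(y)\equiv0\pmod p$ has $r_2$ incongruent solutions modulo $p$, then $$ {_2G_2}(p,t)={_2G_2}(p,1-t)+{_2\widetilde{G}_2}(p,1-t)+(r_1-r_2)+(1-r_2)\varphi(3(1-t)).$$
   Context: $\varphi$ is the quadratic character of $\mathbb{F}_p$. $\omega$ denotes the Teichmüller character of $\mathbb{F}_p$ (values in $\mathbb{Z}_p$, $\omega(a)\equiv a\pmod p$, $\omega(0)=0$), $\overline{\omega}$ its inverse; $\Gamma_p$ is Morita's $p$-adic gamma function; $\lfloor x\rfloor$ is the floor and $\langle x\rangle=x-\lfloor x\rfloor$. McCarthy's function: for $t\in\mathbb{F}_p$, $m\ge 1$, $a_k,b_k\in\mathbb{Q}\cap\mathbb{Z}_p$, $$ {_m\mathbb{G}_m}\left[\begin{array}{ccc} a_1,&\ldots,&a_m\\ b_1,&\ldots,&b_m\end{array}\Big| t\right]_p:=\frac{-1}{p-1}\sum_{j=0}^{p-2}(-1)^{jm}\,\overline{\omega}^j(t)\prod_{k=1}^m(-p)^{-\lfloor\langle a_k\rangle-\frac{j}{p-1}\rfloor-\lfloor\langle -b_k\rangle+\frac{j}{p-1}\rfloor}\frac{\Gamma_p(\langle a_k-\frac{j}{p-1}\rangle)}{\Gamma_p(\langle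 a_k\rangle)}\frac{\Gamma_p(\langle -b_k+\frac{j}{p-1}\rangle)}{\Gamma_p(\langle -b_k\rangle)}.$$ ${_2G_2}(p,t)$ denotes this function with $m=2$, upper parameters $\frac13,\frac23$, lower parameters $0,\frac12$; ${_2\widetilde{G}_2}(p,t)$ denotes it with $m=2$, upper parameters $\frac16,\frac56$, lower parameters $0,\frac12$. *)

theory Defs
  imports
    "HOL-Analysis.Analysis"
    "HOL-Computational_Algebra.Polynomial"
    "HOL-Computational_Algebra.Fraction_Field"
    "HOL-Number_Theory.Residues"
    "Berlekamp_Zassenhaus.Finite_Field"
begin

section \<open>The ring of p-adic integers\<close>

text \<open>The prime \<open>p = CARD('p)\<close> is carried by the type, as in the field \<open>'p mod_ring\<close> with \<open>p\<close>
  elements.  An element is a compatible sequence of residues: its \<open>n\<close>-th entry is the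
  representative in \<open>{0..<p^n}\<close> of its class modulo \<open>p^n\<close>.\<close>

typedef (overloaded) 'p padic_int =
  "{x :: nat \<Rightarrow> int. \<forall>m n. m \<le> n \<longrightarrow> x m = x n mod int CARD('p::prime_card) ^ m}"
  by (rule exI[of _ "\<lambda>_. 0"]) simp

setup_lifting type_definition_padic_int

lemma padic_mod_mod:
  fixes p a :: int
  assumes "m \<le> n"
  shows "a mod p ^ n mod p ^ m = a mod p ^ m"
  using assms by (simp add: le_imp_power_dvd mod_mod_cancel)

instantiation padic_int :: (prime_card) comm_ring_1
begin

lift_definition zero_padic_int :: "'a padic_int" is "\<lambda>_. 0" by simp

lift_definition one_padic_int :: "'a padic_int" is "\<lambda>n. 1 mod int CARD('a) ^ n"
  by (simp add: padic_mod_mod)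

lift_definition plus_padic_int :: "'a padic_int \<Rightarrow> 'a padic_int \<Rightarrow> 'a padic_int"
  is "\<lambda>x y n. (x n + y n) mod int CARD('a) ^ n"
  by (simp add: padic_mod_mod) (metis mod_add_eq)

lift_definition uminus_padic_int :: "'a padic_int \<Rightarrow> 'a padic_int"
  is "\<lambda>x n. (- x n) mod int CARD('a) ^ n"
  by (simp add: padic_mod_mod) (metis mod_minus_eq)

lift_definition minus_padic_int :: "'a padic_int \<Rightarrow> 'a padic_int \<Rightarrow> 'a padic_int"
  is "\<lambda>x y n. (x n - y n) mod int CARD('a) ^ n"
  by (simp add: padic_mod_mod) (metis mod_diff_eq)

lift_definition times_padic_int :: "'a padic_int \<Rightarrow> 'a padic_int \<Rightarrow> 'a padic_int"
  is "\<lambda>x y n. (x n * y n) mod int CARD('a) ^ n"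
  by (simp add: padic_mod_mod) (metis mod_mult_eq)

instance
proof
  have one: "1 < int CARD('a)"
    using prime_card_int[where 'a='a] prime_gt_1_int by blast
  show "(0::'a padic_int) \<noteq> 1"
    using one by transfer (auto simp: fun_eq_iff intro!: exI[of _ "1::nat"])
  fix a b c :: "'a padic_int"
  show "a * b * c = a * (b * c)" by transfer (simp add: fun_eq_iff mod_simps algebra_simps)
  show "a * b = b * a" by transfer (simp add: mult.commute)
  show "1 * a = a" by transfer (simp add: fun_eq_iff mod_simps, metis order_refl)
  show "a + b + c = a + (b + c)" by transfer (simp add: fun_eq_iff mod_simps algebra_simps)
  show "a + b = b + a" by transfer (simp add: add.commute)
  show "0 + a = a" by transfer (simp add: fun_eq_iff, metis order_refl)
  show "- a + a = 0" by transfer (simp add: fun_eq_iff mod_simps)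
  show "a - b = a + - b" by transfer (simp add: fun_eq_iff mod_simps)
  show "(a + b) * c = a * c + b * c"
    by transfer (simp add: fun_eq_iff mod_simps algebra_simps)
qed

end

instance padic_int :: (prime_card) idom
proof
  fix a b :: "'a padic_int"
  assume "a \<noteq> 0" "b \<noteq> 0"
  then show "a * b \<noteq> 0"
  proof (transfer, goal_cases)
    case (1 a b)
    let ?P = "int CARD('a)"
    have a: "\<And>m n. m \<le> n \<Longrightarrow> a m = a n mod ?P ^ m"
      and b: "\<And>m n. m \<le> n \<Longrightarrow> b m = b n mod ?P ^ m" using 1 by auto
    obtain i j where nz: "a i \<noteq> 0" "b j \<noteq> 0" using 1 by (auto simp: fun_eq_iff)
    let ?x = "a (i + j)" and ?y = "b (i + j)"
    have x: "\<not> ?P ^ i dvd ?x"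
      using a[of i "i + j"] nz(1) by (simp add: dvd_eq_mod_eq_0)
    have y: "\<not> ?P ^ j dvd ?y"
      using b[of j "i + j"] nz(2) by (simp add: dvd_eq_mod_eq_0)
    have nz': "?x \<noteq> 0" "?y \<noteq> 0" using x y dvd_0_right by metis+
    have p: "prime_elem ?P" by (rule prime_imp_prime_elem[OF prime_card_int])
    have u: "\<not> is_unit ?P" by (rule prime_elem_not_unit[OF p])
    have lt: "multiplicity ?P ?x < i" "multiplicity ?P ?y < j"
      using x y power_dvd_iff_le_multiplicity[OF nz'(1) u] power_dvd_iff_le_multiplicity[OF nz'(2) u]
      by simp_all
    have "?x * ?y \<noteq> 0" using nz' by simp
    then have "?P ^ (i + j) dvd ?x * ?y \<longleftrightarrow> i + j \<le> multiplicity ?P (?x * ?y)"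
      by (rule power_dvd_iff_le_multiplicity[OF _ u])
    moreover have "multiplicity ?P (?x * ?y) = multiplicity ?P ?x + multiplicity ?P ?y"
      by (rule prime_elem_multiplicity_mult_distrib[OF p nz'])
    ultimately have "\<not> ?P ^ (i + j) dvd ?x * ?y" using lt by linarith
    then have "(?x * ?y) mod ?P ^ (i + j) \<noteq> 0" by (simp only: dvd_eq_mod_eq_0 not_False_eq_True)
    then show ?case by (metis (no_types))
  qed
qed


text \<open>The p-adic metric: \<open>dist x y = p powi (- v)\<close> with \<open>v\<close> the p-adic valuation of \<open>x - y\<close>,
  that is, the largest \<open>n\<close> such that \<open>x\<close> and \<open>y\<close> agree modulo \<open>p^n\<close>.\<close>

lemma Rep_padic_int_mod:
  "m \<le> n \<Longrightarrow> Rep_padic_int (x :: 'p::prime_card padic_int) m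
     = Rep_padic_int x n mod int CARD('p) ^ m"
  using Rep_padic_int[of x] by blast

lemma Rep_padic_int_agree:
  fixes x y :: "'p::prime_card padic_int"
  assumes "m \<le> n" "Rep_padic_int x n = Rep_padic_int y n"
  shows "Rep_padic_int x m = Rep_padic_int y m"
  using assms Rep_padic_int_mod by metis

lemma Rep_padic_int_0: "Rep_padic_int (x :: 'p::prime_card padic_int) 0 = 0"
  using Rep_padic_int_mod[of 0 0 x] by simp

instantiation padic_int :: (prime_card) metric_space
begin

definition dist_padic_int :: "'a padic_int \<Rightarrow> 'a padic_int \<Rightarrow> real" where
  "dist_padic_int x y = (if x = y then 0
     else 1 / real CARD('a) ^ (GREATEST n. Rep_padic_int x n = Rep_padic_int y n))"

definition uniformity_padic_int :: "('a padic_int \<times> 'a padic_int) filter" where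
  "uniformity_padic_int = (INF e\<in>{0<..}. principal {(x, y). dist x y < e})"

definition open_padic_int :: "'a padic_int set \<Rightarrow> bool" where
  "open_padic_int U \<longleftrightarrow> (\<forall>x\<in>U. \<forall>\<^sub>F (x', y) in uniformity. x' = x \<longrightarrow> y \<in> U)"

instance
proof
  fix x y z :: "'a padic_int"
  let ?v = "\<lambda>x y :: 'a padic_int. GREATEST n. Rep_padic_int x n = Rep_padic_int y n"
  have p1: "1 < real CARD('a)"
    using nontriv[where 'a='a] by simp
  show "dist x y = 0 \<longleftrightarrow> x = y" by (simp add: dist_padic_int_def)
  have bound: "\<exists>N. \<forall>n. Rep_padic_int x n = Rep_padic_int y n \<longrightarrow> n \<le> N"
    if "x \<noteq> y" for x y :: "'a padic_int"
  proof -
    from that obtain N where "Rep_padic_int x N \<noteq> Rep_padic_int y N"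
      by (metis Rep_padic_int_inject ext)
    then have "\<forall>n. Rep_padic_int x n = Rep_padic_int y n \<longrightarrow> n \<le> N"
      by (metis Rep_padic_int_agree nat_le_linear)
    then show ?thesis ..
  qed
  have agree: "Rep_padic_int x (?v x y) = Rep_padic_int y (?v x y)"
    if "x \<noteq> y" for x y :: "'a padic_int"
    using bound[OF that] GreatestI_nat[of "\<lambda>n. Rep_padic_int x n = Rep_padic_int y n" 0]
    by (auto simp: Rep_padic_int_0)
  have upper: "n \<le> ?v x y" if "x \<noteq> y" "Rep_padic_int x n = Rep_padic_int y n"
    for x y :: "'a padic_int" and n
    using bound[OF that(1)] that(2)
      Greatest_le_nat[of "\<lambda>n. Rep_padic_int x n = Rep_padic_int y n" n]
    by auto
  have nonneg: "0 \<le> dist x y" for x y :: "'a padic_int" by (simp add: dist_padic_int_def)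
  show "dist x y \<le> dist x z + dist y z"
  proof (cases "x = y \<or> x = z \<or> y = z")
    case True
    have sym: "dist a b = dist b a" for a b :: "'a padic_int"
      by (simp add: dist_padic_int_def eq_commute)
    have refl: "dist a a = 0" for a :: "'a padic_int" by (simp add: dist_padic_int_def)
    from True show ?thesis
    proof (elim disjE)
      assume "x = y"
      then show ?thesis using nonneg[of x z] nonneg[of y z] refl[of x] by simp
    next
      assume "x = z"
      then show ?thesis using sym[of y z] refl[of z] by simp
    next
      assume "y = z"
      then show ?thesis using refl[of z] by simp
    qed
  next
    case False
    let ?m = "min (?v x z) (?v y z)"
    have "Rep_padic_int x ?m = Rep_padic_int z ?m"
      using False agree[of x z] Rep_padic_int_agree[of ?m "?v x z" x z] by simp
    moreover have "Rep_padic_int y ?m = Rep_padic_int z ?m"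
      using False agree[of y z] Rep_padic_int_agree[of ?m "?v y z" y z] by simp
    ultimately have le: "?m \<le> ?v x y" using False upper[of x y] by simp
    have "dist x y = 1 / real CARD('a) ^ ?v x y" using False by (simp add: dist_padic_int_def)
    also have "\<dots> \<le> 1 / real CARD('a) ^ ?m"
      using le p1 by (intro divide_left_mono power_increasing) auto
    also have "\<dots> \<le> 1 / real CARD('a) ^ ?v x z + 1 / real CARD('a) ^ ?v y z"
      by (auto simp: min_def)
    also have "\<dots> = dist x z + dist y z" using False by (simp add: dist_padic_int_def)
    finally show ?thesis .
  qed
qed (simp_all add: uniformity_padic_int_def open_padic_int_def)

end


section \<open>The field of p-adic numbers\<close>

type_synonym 'p padic = "'p padic_int fract"

abbreviation to_padic :: "'p::prime_card padic_int \<Rightarrow> 'p padic" where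
  "to_padic x \<equiv> Fract x 1"

text \<open>The inclusion of \<open>\<rat> \<inter> \<int>\<^sub>p\<close> into \<open>\<int>\<^sub>p\<close>; only meaningful for rationals whose denominator is
  prime to \<open>p\<close>.\<close>

definition padic_int_of_rat :: "rat \<Rightarrow> 'p::prime_card padic_int" where
  "padic_int_of_rat r =
     (THE x. of_int (snd (quotient_of r)) * x = of_int (fst (quotient_of r)))"


section \<open>Characters and Morita's gamma function\<close>

definition quad_char :: "'p::prime_card mod_ring \<Rightarrow> int" where
  "quad_char a = Legendre (to_int_mod_ring a) (int CARD('p))"

definition teichmuller :: "'p::prime_card mod_ring \<Rightarrow> 'p padic_int" where
  "teichmuller = (THE \<psi>. \<psi> 0 = 0 \<and> \<psi> 1 = 1 \<and> (\<forall>a b. \<psi> (a * b) = \<psi> a * \<psi> b) \<and>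
     (\<forall>a. of_nat CARD('p) dvd \<psi> a - of_int (to_int_mod_ring a)))"

text \<open>The \<open>j\<close>-th power of the inverse of the Teichmueller character.  Every character of the
  multiplicative group, including the trivial one (\<open>j = 0\<close>), is extended by the value 0 at 0.\<close>

definition inv_teichmuller_power :: "nat \<Rightarrow> 'p::prime_card mod_ring \<Rightarrow> 'p padic" where
  "inv_teichmuller_power j a = (if a = 0 then 0 else inverse (to_padic (teichmuller a)) ^ j)"

definition morita_Gamma_nat :: "nat \<Rightarrow> 'p::prime_card padic_int" where
  "morita_Gamma_nat n = (- 1) ^ n * (\<Prod>i | 0 < i \<and> i < n \<and> \<not> CARD('p) dvd i. of_nat i)"

text \<open>The continuous extension from the positive integers; the normalisation
  \<open>\<Gamma>\<^sub>p 0 = 1\<close> is a consequence.\<close>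

definition morita_Gamma :: "'p::prime_card padic_int \<Rightarrow> 'p padic_int" where
  "morita_Gamma x = (THE y. \<forall>s :: nat \<Rightarrow> nat.
     (\<forall>k. 0 < s k) \<longrightarrow> (\<lambda>k. of_nat (s k)) \<longlonglongrightarrow> x \<longrightarrow> (\<lambda>k. morita_Gamma_nat (s k)) \<longlonglongrightarrow> y)"

definition Gamma_rat :: "rat \<Rightarrow> 'p::prime_card padic" where
  "Gamma_rat r = to_padic (morita_Gamma (padic_int_of_rat r))"


section \<open>McCarthy's function\<close>

text \<open>The lists \<open>as\<close> and \<open>bs\<close> of upper and lower parameters are meant to have the same length
  \<open>m \<ge> 1\<close> and entries in \<open>\<rat> \<inter> \<int>\<^sub>p\<close>.\<close>

definition mccarthy_G :: "rat list \<Rightarrow> rat list \<Rightarrow> 'p::prime_card mod_ring \<Rightarrow> 'p padic" where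
  "mccarthy_G as bs t =
    (let p = CARD('p); m = length as in
      (- 1) / of_nat (p - 1) *
      (\<Sum>j = 0..p - 2. (- 1) ^ (j * m) * inv_teichmuller_power j t *
        (\<Prod>k<m. let a = as ! k; b = bs ! k; x = of_nat j / (of_nat p - 1) in
          (- of_nat p) powi (- \<lfloor>frac a - x\<rfloor> - \<lfloor>frac (- b) + x\<rfloor>) *
          (Gamma_rat (frac (a - x)) / Gamma_rat (frac a)) *
          (Gamma_rat (frac (- b + x)) / Gamma_rat (frac (- b))))))"

definition G2 :: "'p::prime_card mod_ring \<Rightarrow> 'p padic" where
  "G2 t = mccarthy_G [1/3, 2/3] [0, 1/2] t"

definition G2_tilde :: "'p::prime_card mod_ring \<Rightarrow> 'p padic" where
  "G2_tilde t = mccarthy_G [1/6, 5/6] [0, 1/2] t"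

end

theory Submission
  imports Defs "HOL-Real_Asymp.Real_Asymp" "HOL-Number_Theory.Euler_Criterion"
begin

text \<open>
  Both \<open>G2\<close> values are root counts and \<open>G2_tilde\<close> is a quadratic twist of \<open>G2\<close>:
  if \<open>r(t)\<close> is the number of roots of \<open>27 y\<^sup>3 - 27 y\<^sup>2 + 4 / t\<close>, then \<open>G2 t = r(t) - 1\<close> and
  \<open>G2_tilde t = \<phi>(3 t) G2 t\<close>, and the claim becomes an identity in \<open>r\<^sub>1\<close>, \<open>r\<^sub>2\<close> and \<open>\<phi>\<close>.

  The roots are the solutions of \<open>y\<^sup>2 (1 - y) = 4 / (27 t)\<close>, so Fourier analysis on the
  multiplicative group expresses \<open>r(t)\<close> through the Jacobi sums \<open>J(\<omega>\<^sup>-\<^sup>2\<^sup>j, \<omega>\<^sup>-\<^sup>j)\<close>.  These are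
  products of gamma values by the Gross-Koblitz formula, and the multiplication formula of
  \<open>\<Gamma>\<^sub>p\<close> for 2 and 3 turns the products into the coefficients of \<open>G2\<close>.  The twist corresponds
  to shifting \<open>j\<close> by \<open>(p - 1) / 2\<close>.

  The Gross-Koblitz formula over the prime field is proved with Dwork's exponential
  \<open>exp (X + X\<^sup>p / p) = \<Sum> c\<^sub>n X\<^sup>n\<close>.  The numbers \<open>p\<^sup>m m! c\<^sub>a\<^sub>+\<^sub>p\<^sub>m\<close> are Mahler coefficients of
  \<open>x \<mapsto> \<Gamma>\<^sub>p (p x - a)\<close>; evaluating at the fixed point \<open>x = a / (p - 1)\<close> and telescoping gives
  \<open>\<Gamma>\<^sub>p (a / (p - 1)) = (1 - p) \<Sum> (- p)\<^sup>j c\<^sub>a\<^sub>+\<^sub>(\<^sub>p\<^sub>-\<^sub>1\<^sub>)\<^sub>j\<close>, whose right-hand side is a Gauss sum divided by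
  a power of a root \<open>\<pi>\<close> of \<open>\<pi>\<^sup>p\<^sup>-\<^sup>1 = - p\<close>.  Only Jacobi sums occur in the end, so \<open>\<pi>\<close> itself is never
  adjoined.
\<close>

section \<open>Dwork's exponential\<close>

text \<open>The ambient field is the fraction field of the p-adic integers; it has no root
  \<open>pi\<close> and carries no topology, and both shape the proof. Evaluation of a series at
  \<open>pi\<close> is replaced by collecting the coefficients whose exponents lie in one class
  modulo \<open>p - 1\<close>, weighted by powers of \<open>- p\<close>; the equation of
  \<open>pi\<close> becomes a congruence of power series modulo \<open>p X + X^p\<close> with an
  explicit quotient. Infinite sums are truncated, and a limit reads: for each bound \<open>r\<close>
  the difference eventually has valuation at least \<open>r\<close>. Every exact identity thus needs
  an error estimate. The estimates rest on one fact: the valuation of \<open>c_n pi^n\<close> grows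
  at least linearly in \<open>n\<close>. Bounding the terms of \<open>c_n\<close> one by one gives
  only a constant lower bound; the linear gain comes from the divisibility of the Mahler
  coefficients, which in turn rests on Wilson's theorem for blocks of \<open>p\<close> consecutive
  integers.\<close>

definition exp_pow :: "nat \<Rightarrow> 'a::field_char_0 \<Rightarrow> 'a \<Rightarrow> 'a fps" where
  "exp_pow p s t = fps_exp s * (fps_exp t oo fps_X ^ p)"

text \<open>\<open>exp_pow p s t\<close> is exp(s X + t X^p). The two parameters are kept
  independent because the Dwork series of \<open>u\<close> has parameters \<open>(u, u / p)\<close>,
  whereas the defect in its additivity has parameters \<open>(p z, z)\<close>.\<close>

lemma exp_pow_add:
  assumes "p > 0"
  shows "exp_pow p (s + s') (t + t') = exp_pow p s t * exp_pow p s' t'"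
  using assms by (simp add: exp_pow_def fps_exp_add_mult fps_compose_mult_distrib algebra_simps)

lemma fps_deriv_exp_compose:
  fixes z :: "'a::field_char_0"
  assumes "fps_nth g 0 = 0"
  shows "fps_deriv (fps_exp z oo g) = fps_const z * fps_deriv g * (fps_exp z oo g)"
proof -
  have "fps_deriv (fps_exp z oo g) = ((fps_const z * fps_exp z) oo g) * fps_deriv g"
    using fps_compose_deriv[OF assms, of "fps_exp z"] by simp
  also have "(fps_const z * fps_exp z) oo g = fps_const z * (fps_exp z oo g)"
    by (rule fps_const_mult_apply_left[symmetric])
  finally show ?thesis by (simp only: mult_ac)
qed

text \<open>The equation f' = D f gives \<open>n\<close> times the coefficient of index
  \<open>n\<close> in terms of earlier ones, and characteristic 0 permits the division.\<close>

lemma fps_eqI_deriv: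
  fixes f g D :: "'a::field_char_0 fps"
  assumes "fps_deriv f = D * f" "fps_deriv g = D * g" "fps_nth f 0 = fps_nth g 0"
  shows "f = g"
proof -
  have "fps_nth f n = fps_nth g n" for n
  proof (induction n rule: less_induct)
    case (less n)
    show ?case
    proof (cases n)
      case (Suc m)
      have *: "of_nat n * fps_nth h n = (\<Sum>i=0..m. fps_nth D i * fps_nth h (m - i))"
        if "fps_deriv h = D * h" for h :: "'a fps"
        using arg_cong[OF that, of "\<lambda>f. fps_nth f m"] by (simp add: fps_mult_nth Suc)
      have "of_nat n * fps_nth f n = of_nat n * fps_nth g n"
        unfolding *[OF assms(1)] *[OF assms(2)] using less.IH Suc by (intro sum.cong) auto
      then show ?thesis by (simp add: Suc del: of_nat_Suc)
    qed (use assms(3) in simp)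
  qed
  then show ?thesis by (simp add: fps_eq_iff)
qed

lemma exp_pow_deriv:
  assumes "p > 0"
  shows "fps_deriv (exp_pow p s t)
    = (fps_const s + fps_const t * (of_nat p * fps_X ^ (p - 1))) * exp_pow p s t"
proof -
  have "fps_nth (fps_X ^ p :: 'a fps) 0 = 0" using assms by simp
  note d = fps_deriv_exp_compose[OF this, of t]
  have "fps_deriv (fps_X ^ p :: 'a fps) = of_nat p * fps_X ^ (p - 1)"
    by (simp add: fps_deriv_power fps_of_nat)
  then show ?thesis by (simp add: exp_pow_def d algebra_simps)
qed

text \<open>Used with \<open>s = p\<close>, \<open>t = 1\<close>, where it exhibits the error factor
  as a series in \<open>p X + X^p\<close>. Both sides solve the same linear equation of first order,
  so no composition with a binomial is expanded.\<close>

lemma exp_pow_eq_compose: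
  fixes z :: "'a::field_char_0"
  assumes "p > 0"
  shows "exp_pow p (z * s) (z * t) = fps_exp z oo (fps_const s * fps_X + fps_const t * fps_X ^ p)"
    (is "?l = fps_exp z oo ?L")
proof (rule fps_eqI_deriv[OF exp_pow_deriv[OF assms]])
  have dX: "fps_deriv (fps_X ^ p :: 'a fps) = of_nat p * fps_X ^ (p - 1)"
    by (simp add: fps_deriv_power fps_of_nat)
  have "fps_nth ?L 0 = 0" using assms by simp
  note d = fps_deriv_exp_compose[OF this, of z]
  have "fps_deriv ?L = fps_const s + fps_const t * (of_nat p * fps_X ^ (p - 1))"
    by (simp add: dX)
  then show "fps_deriv (fps_exp z oo ?L)
    = (fps_const (z * s) + fps_const (z * t) * (of_nat p * fps_X ^ (p - 1))) * (fps_exp z oo ?L)"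
    unfolding d by (simp add: distrib_left mult.assoc flip: fps_const_mult)
  show "fps_nth ?l 0 = fps_nth (fps_exp z oo ?L) 0"
    using assms by (simp add: exp_pow_def fps_compose_nth)
qed

lemma exp_pow_nth:
  assumes "p > 0"
  shows "fps_nth (exp_pow p s t) n
     = (\<Sum>j | p * j \<le> n. s ^ (n - p * j) / fact (n - p * j) * (t ^ j / fact j))"
proof -
  have e:
    "fps_nth (fps_exp t oo fps_X ^ p) i = (if p dvd i then t ^ (i div p) / fact (i div p) else 0)"
    for i
  proof -
    have "fps_nth (fps_exp t oo fps_X ^ p) i
        = (\<Sum>k = 0..i. t ^ k / fact k * (if i = k * p then 1 else 0))"
      by (simp add: fps_compose_nth flip: power_mult add: mult.commute)
    also have "\<dots> = (\<Sum>k = 0..i. if i div p = k \<and> p dvd i then t ^ k / fact k else 0)"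
      using assms by (intro sum.cong) auto
    also have "\<dots> = (if p dvd i then t ^ (i div p) / fact (i div p) else 0)"
      by simp
    finally show ?thesis .
  qed
  have "fps_nth (exp_pow p s t) n
      = (\<Sum>i = 0..n. fps_nth (fps_exp s) (n - i) * fps_nth (fps_exp t oo fps_X ^ p) i)"
    unfolding exp_pow_def mult.commute[of "fps_exp s"]
    by (simp only: fps_mult_nth) (simp add: mult.commute)
  also have "\<dots> = (\<Sum>i | i \<le> n \<and> p dvd i. s ^ (n - i) / fact (n - i) * (t ^ (i div p) / fact (i div p)))"
    unfolding e by (rule sum.mono_neutral_cong_right) auto
  also have "\<dots> = (\<Sum>j | p * j \<le> n. s ^ (n - p * j) / fact (n - p * j) * (t ^ j / fact j))"
    using assms by (intro sum.reindex_bij_witness[of _ "\<lambda>j. p * j" "\<lambda>i. i div p"]) auto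
  finally show ?thesis .
qed

definition dwork_coeff :: "nat \<Rightarrow> nat \<Rightarrow> 'a::field_char_0" where
  "dwork_coeff p n = fps_nth (exp_pow p 1 (1 / of_nat p)) n"

text \<open>Coefficient form of E' = (1 + X^(p-1)) E for E = exp(X + X^p / p).\<close>

lemma dwork_coeff_rec:
  assumes "p > 0"
  shows "of_nat (n + p) * dwork_coeff p (n + p)
     = (dwork_coeff p (n + p - 1) + dwork_coeff p n :: 'a::field_char_0)"
proof -
  let ?E = "exp_pow p 1 (1 / of_nat p) :: 'a fps"
  have "fps_const (1 / of_nat p) * of_nat p = (1 :: 'a fps)"
    using assms by (simp add: fps_of_nat[symmetric])
  then have c: "fps_const (1 / of_nat p) * (of_nat p * f) = f" for f :: "'a fps"
    by (metis mult.assoc mult_1)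
  have "fps_deriv ?E = ?E + fps_X ^ (p - 1) * ?E"
    unfolding exp_pow_deriv[OF assms] c by (simp add: algebra_simps)
  then have "fps_nth (fps_deriv ?E) (n + p - 1) = fps_nth (?E + fps_X ^ (p - 1) * ?E) (n + p - 1)"
    by simp
  then show ?thesis using assms by (simp add: dwork_coeff_def fps_X_power_mult_nth)
qed

text \<open>If \<open>u^p = u\<close>, then u X + u X^p / p arises from X + X^p / p by replacing X
  with u X. Teichmueller values satisfy this hypothesis.\<close>

lemma exp_pow_nth_root:
  assumes "p > 0" "u ^ p = u"
  shows "fps_nth (exp_pow p u (u / of_nat p)) n = dwork_coeff p n * u ^ n"
proof -
  have "u ^ (n - p * j) * u ^ j = u ^ n" if "p * j \<le> n" for j
  proof -
    have "u ^ j = u ^ (p * j)" using assms(2) by (simp add: power_mult)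
    then show ?thesis using that by (simp flip: power_add)
  qed
  then show ?thesis using assms(1)
    by (auto simp: dwork_coeff_def exp_pow_nth sum_distrib_right power_divide intro!: sum.cong)
qed

text \<open>One step from \<open>(y, n)\<close> to \<open>(y + 1, n + p - 1)\<close>, which
  preserves \<open>(p - 1) y = n\<close>. By that relation \<open>p (y + 1 + K) - y\<close> equals
  the index \<open>n + p (K + 1)\<close>, the very factor in \<open>dwork_coeff_rec\<close>.\<close>

lemma dwork_sum_step:
  fixes y :: "'a::field_char_0"
  assumes "p > 0" and y: "(of_nat p - 1) * y = of_nat n"
  shows "(\<Sum>k<Suc K. of_nat p ^ k * pochhammer y k * dwork_coeff p (n + p * k))
      + of_nat p * (\<Sum>k<K. of_nat p ^ k * pochhammer (y + 1) k * dwork_coeff p (n + p - 1 + p * k))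
    = (1 - of_nat p) * dwork_coeff p n
      + of_nat p ^ Suc K * pochhammer (y + 1) K * dwork_coeff p (n + p * K)"
proof (induction K)
  case 0
  show ?case by (simp add: algebra_simps)
next
  case (Suc K)
  let ?N = "n + p * K"
  define c where "c = (dwork_coeff p :: nat \<Rightarrow> 'a)"
  define A where "A = of_nat p ^ Suc K * pochhammer (y + 1) K"
  have "(of_nat p * (y + 1 + of_nat K) - y) * c (?N + p) = of_nat (?N + p) * c (?N + p)"
    using y by (simp add: algebra_simps)
  also have "\<dots> = c (?N + p - 1) + c ?N"
    using dwork_coeff_rec[OF assms(1), of ?N] by (simp only: c_def)
  finally have r:
    "y * c (?N + p) + c (?N + p - 1) = of_nat p * (y + 1 + of_nat K) * c (?N + p) - c ?N"
    by (simp add: algebra_simps)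
  have i: "n + p * Suc K = ?N + p" "n + p - 1 + p * K = ?N + p - 1" using assms(1) by auto
  have "(\<Sum>k<Suc (Suc K). of_nat p ^ k * pochhammer y k * c (n + p * k))
      + of_nat p * (\<Sum>k<Suc K. of_nat p ^ k * pochhammer (y + 1) k * c (n + p - 1 + p * k))
    = (1 - of_nat p) * c n + A * c ?N + A * (y * c (?N + p) + c (?N + p - 1))"
    using Suc.IH
      unfolding c_def[symmetric] sum.lessThan_Suc[of _ "Suc K"] sum.lessThan_Suc[of _ K] i
    unfolding A_def pochhammer_rec[of y K] by (simp add: distrib_left mult_ac add.assoc)
  also have "\<dots> = (1 - of_nat p) * c n + A * (of_nat p * (y + 1 + of_nat K) * c (?N + p))"
    unfolding r by (simp add: algebra_simps)
  also have "\<dots> = (1 - of_nat p) * c n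
      + of_nat p ^ Suc (Suc K) * pochhammer (y + 1) (Suc K) * c (n + p * Suc K)"
    by (simp add: A_def i pochhammer_Suc algebra_simps)
  finally show ?case by (simp only: c_def)
qed

text \<open>This telescoping identity is the trace formula behind the Gross-Koblitz formula: both sides
  compute the trace of the Frobenius operator on the twisted de Rham cohomology of
  \<open>exp (X + X\<^sup>p / p)\<close>, up to the error in the last sum.\<close>

lemma dwork_trace_identity:
  fixes y :: "'a::field_char_0"
  assumes "p > 0" and "(of_nat p - 1) * y = of_nat n"
  shows "(\<Sum>k<K. of_nat p ^ k * pochhammer y k * dwork_coeff p (n + p * k))
    = (1 - of_nat p) * (\<Sum>j<K. (- of_nat p) ^ j * dwork_coeff p (n + (p - 1) * j))
      + of_nat p ^ K * (\<Sum>j<K. (- 1) ^ j * pochhammer (y + of_nat (Suc j)) (K - Suc j)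
          * dwork_coeff p (n + (p - 1) * j + p * (K - Suc j)))"
  using assms(2)
proof (induction K arbitrary: y n)
  case 0
  then show ?case by simp
next
  case (Suc K)
  let ?P = "of_nat p :: 'a"
  have "(?P - 1) * (y + 1) = of_nat (n + p - 1)"
    using Suc.prems assms(1) by (simp add: algebra_simps of_nat_diff)
  note IH = Suc.IH[OF this]
  have i: "n + p - 1 + (p - 1) * j = n + (p - 1) * Suc j" for j using assms(1) by auto
  have c: "y + 1 + of_nat (Suc j) = y + of_nat (Suc (Suc j))" for j by simp
  have "(\<Sum>k<Suc K. ?P ^ k * pochhammer y k * dwork_coeff p (n + p * k))
    = (1 - ?P) * dwork_coeff p n + ?P ^ Suc K * pochhammer (y + 1) K * dwork_coeff p (n + p * K)
      - ?P * (\<Sum>k<K. ?P ^ k * pochhammer (y + 1) k * dwork_coeff p (n + p - 1 + p * k))"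
    using dwork_sum_step[OF assms(1) Suc.prems, of K] by (simp add: algebra_simps)
  also have "\<dots> = (1 - ?P) * (\<Sum>j<Suc K. (- ?P) ^ j * dwork_coeff p (n + (p - 1) * j))
      + ?P ^ Suc K * (\<Sum>j<Suc K. (- 1) ^ j * pochhammer (y + of_nat (Suc j)) (Suc K - Suc j)
          * dwork_coeff p (n + (p - 1) * j + p * (Suc K - Suc j)))"
    unfolding IH i c sum.lessThan_Suc_shift
    by (simp add: algebra_simps sum_negf sum_distrib_left flip: sum_subtractf)
  finally show ?case .
qed

section \<open>Congruences between p-adic integers\<close>

lemma Rep_padic_int_mod_self:
  "Rep_padic_int (x :: 'p::prime_card padic_int) n mod int CARD('p) ^ n = Rep_padic_int x n"
  using Rep_padic_int_mod[of n n x] by simp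

lemma Rep_padic_int_of_int:
  "Rep_padic_int (of_int k :: 'p::prime_card padic_int) n = k mod int CARD('p) ^ n"
proof -
  have nat: "Rep_padic_int (of_nat m :: 'p padic_int) n = int m mod int CARD('p) ^ n" for m
    by (induction m) (simp_all add: zero_padic_int.rep_eq plus_padic_int.rep_eq
        one_padic_int.rep_eq mod_simps)
  show ?thesis
  proof (cases k)
    case (nonneg m)
    then show ?thesis using nat by simp
  next
    case (neg m)
    then show ?thesis using nat[of "Suc m"]
      by (simp add: uminus_padic_int.rep_eq mod_simps del: of_nat_Suc)
  qed
qed

instance padic_int :: (prime_card) ring_char_0
proof
  show "inj (of_nat :: nat \<Rightarrow> 'a padic_int)"
  proof (rule injI)
    fix i j :: nat
    assume e: "(of_nat i :: 'a padic_int) = of_nat j"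
    let ?n = "i + j"
    have "1 < CARD('a)" using prime_card[where 'a='a] prime_gt_1_nat by blast
    then have "?n < CARD('a) ^ ?n" using power_gt_expt[of "CARD('a)"] by simp
    then have "int i mod int CARD('a) ^ ?n = int i" "int j mod int CARD('a) ^ ?n = int j"
      by (auto intro!: mod_pos_pos_trivial simp flip: of_nat_power)
    moreover have "Rep_padic_int (of_int (int i) :: 'a padic_int) ?n
        = Rep_padic_int (of_int (int j) :: 'a padic_int) ?n" using e by simp
    ultimately show "i = j" unfolding Rep_padic_int_of_int by simp
  qed
qed

instance fract :: ("{idom, ring_char_0}") field_char_0
proof
  show "inj (of_nat :: nat \<Rightarrow> 'a fract)"
    by (auto intro!: injI simp: of_nat_fract eq_fract)
qed

abbreviation pp :: "'p::prime_card padic_int" where "pp \<equiv> of_nat CARD('p)"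

lemma p_power_dvd_iff:
  fixes x :: "'p::prime_card padic_int"
  shows "pp ^ n dvd x \<longleftrightarrow> Rep_padic_int x n = 0"
proof
  assume "pp ^ n dvd x"
  then obtain y where x: "x = of_int (int CARD('p) ^ n) * y" by (auto elim: dvdE)
  show "Rep_padic_int x n = 0"
    unfolding x times_padic_int.rep_eq Rep_padic_int_of_int by simp
next
  assume z: "Rep_padic_int x n = 0"
  let ?P = "int CARD('p)"
  have P: "?P > 0" by simp
  \<comment> \<open>Division by \<open>p^n\<close> loses \<open>n\<close> digits, so the residue of
    index \<open>m\<close> of the quotient is read off from index \<open>n + m\<close>.\<close>
  let ?f = "\<lambda>m. Rep_padic_int x (n + m) div ?P ^ n"
  have "?f m = ?f k mod ?P ^ m" if "m \<le> k" for m k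
  proof -
    have "Rep_padic_int x (n + m) = Rep_padic_int x (n + k) mod (?P ^ n * ?P ^ m)"
      using Rep_padic_int_mod[of "n + m" "n + k" x] that by (simp add: power_add)
    also have "\<dots> = ?P ^ n * (?f k mod ?P ^ m) + Rep_padic_int x (n + k) mod ?P ^ n"
      by (simp add: zmod_zmult2_eq)
    finally show ?thesis using P by simp
  qed
  then have r: "Rep_padic_int (Abs_padic_int ?f :: 'p padic_int) = ?f"
    by (intro Abs_padic_int_inverse) auto
  have "x = of_int (?P ^ n) * (Abs_padic_int ?f :: 'p padic_int)"
  proof (rule Rep_padic_int_inject[THEN iffD1], rule ext)
    fix m
    have "?P ^ n dvd Rep_padic_int x (n + m)"
      using z Rep_padic_int_mod[of n "n + m" x] by (simp add: dvd_eq_mod_eq_0)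
    then have "?P ^ n * ?f m = Rep_padic_int x (n + m)" by simp
    moreover have "Rep_padic_int x (n + m) mod ?P ^ m = Rep_padic_int x m"
      using Rep_padic_int_mod[of m "n + m" x] by simp
    ultimately show "Rep_padic_int x m
      = Rep_padic_int (of_int (?P ^ n) * (Abs_padic_int ?f :: 'p padic_int)) m"
      unfolding times_padic_int.rep_eq Rep_padic_int_of_int r by (simp add: mod_mult_left_eq)
  qed
  then show "pp ^ n dvd x" by (metis dvd_triv_left of_int_of_nat_eq of_int_power)
qed

definition pcong :: "nat \<Rightarrow> 'p::prime_card padic_int \<Rightarrow> 'p padic_int \<Rightarrow> bool" where
  "pcong n x y \<longleftrightarrow> pp ^ n dvd x - y"

lemma pcong_iff_Rep: "pcong n x y \<longleftrightarrow> Rep_padic_int x n = Rep_padic_int y n"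
proof -
  have "Rep_padic_int (x - y) n = (Rep_padic_int x n - Rep_padic_int y n) mod int CARD('a) ^ n"
    by (simp add: minus_padic_int.rep_eq)
  then have "Rep_padic_int (x - y) n = 0
      \<longleftrightarrow> Rep_padic_int x n mod int CARD('a) ^ n = Rep_padic_int y n mod int CARD('a) ^ n"
    by (simp add: mod_eq_dvd_iff dvd_eq_mod_eq_0)
  then show ?thesis by (simp add: pcong_def p_power_dvd_iff Rep_padic_int_mod_self)
qed

lemma pcong_refl [simp]: "pcong n x x" by (simp add: pcong_def)

lemma pcong_0 [simp]: "pcong 0 x y" by (simp add: pcong_def)

lemma pcong_sym: "pcong n x y \<Longrightarrow> pcong n y x" by (simp add: pcong_iff_Rep)

lemma pcong_trans [trans]: "pcong n x y \<Longrightarrow> pcong n y z \<Longrightarrow> pcong n x z"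
  by (simp add: pcong_iff_Rep)

lemma pcong_mono: "pcong n x y \<Longrightarrow> m \<le> n \<Longrightarrow> pcong m x y"
  unfolding pcong_def by (rule dvd_trans[OF le_imp_power_dvd])

lemma pcong_add: "pcong n a b \<Longrightarrow> pcong n c d \<Longrightarrow> pcong n (a + c) (b + d)"
  unfolding pcong_def using dvd_add[of _ "a - b" "c - d"] by (simp add: algebra_simps)

lemma pcong_minus: "pcong n a b \<Longrightarrow> pcong n (- a) (- b)"
  unfolding pcong_def by (metis dvd_minus_iff minus_diff_eq minus_diff_minus)

lemma pcong_diff: "pcong n a b \<Longrightarrow> pcong n c d \<Longrightarrow> pcong n (a - c) (b - d)"
  using pcong_add[of n a b "- c" "- d"] pcong_minus[of n c d] by simp

lemma pcong_mult: "pcong n a b \<Longrightarrow> pcong n c d \<Longrightarrow> pcong n (a * c) (b * d)"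
proof -
  assume *: "pcong n a b" "pcong n c d"
  have "a * c - b * d = (a - b) * c + b * (c - d)" by (simp add: algebra_simps)
  then show ?thesis using * unfolding pcong_def by (metis dvd_add dvd_mult dvd_mult2)
qed

lemma pcong_power: "pcong n a b \<Longrightarrow> pcong n (a ^ k) (b ^ k)"
  by (induction k) (auto intro: pcong_mult)

lemma pcong_prod: "(\<And>i. i \<in> A \<Longrightarrow> pcong n (f i) (g i)) \<Longrightarrow> pcong n (prod f A) (prod g A)"
  by (induction A rule: infinite_finite_induct) (auto intro: pcong_mult)

lemma pcong_sum: "(\<And>i. i \<in> A \<Longrightarrow> pcong n (f i) (g i)) \<Longrightarrow> pcong n (sum f A) (sum g A)"
  by (induction A rule: infinite_finite_induct) (auto intro: pcong_add)

lemma pcong_eqI: "(\<And>n. pcong n x y) \<Longrightarrow> x = y"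
  by (auto simp: pcong_iff_Rep Rep_padic_int_inject[symmetric])

section \<open>Completeness, density of the naturals, and units\<close>

lemma padic_int_complete:
  fixes f :: "nat \<Rightarrow> 'p::prime_card padic_int"
  assumes "\<And>m. pcong m (f (Suc m)) (f m)"
  shows "\<exists>y. \<forall>m. pcong m y (f m)"
proof -
  have c: "pcong m (f k) (f m)" if "m \<le> k" for m k
    using that
  proof (induction k rule: dec_induct)
    case (step k)
    then show ?case using pcong_mono[OF assms[of k]] pcong_trans by blast
  qed simp
  let ?g = "\<lambda>m. Rep_padic_int (f m) m"
  have "?g m = ?g k mod int CARD('p) ^ m" if "m \<le> k" for m k
    using c[OF that] Rep_padic_int_mod[OF that, of "f k"] by (simp add: pcong_iff_Rep)
  then have "Rep_padic_int (Abs_padic_int ?g :: 'p padic_int) = ?g"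
    by (intro Abs_padic_int_inverse) auto
  then show ?thesis by (intro exI[of _ "Abs_padic_int ?g"]) (simp add: pcong_iff_Rep)
qed

lemma nat_approx: "\<exists>k::nat. k > 0 \<and> pcong n x (of_nat k :: 'p::prime_card padic_int)"
proof -
  \<comment> \<open>The summand \<open>p^n\<close> makes the approximation positive, as the
    sequences in the definition of \<open>morita_Gamma\<close> must be.\<close>
  let ?k = "nat (Rep_padic_int x n) + CARD('p) ^ n"
  have "Rep_padic_int x n \<ge> 0"
    using Rep_padic_int_mod_self[of x n] pos_mod_sign[of "int CARD('p) ^ n" "Rep_padic_int x n"]
    by simp
  then have "int ?k mod int CARD('p) ^ n = Rep_padic_int x n"
    using Rep_padic_int_mod_self[of x n] by simp
  then have "pcong n x (of_int (int ?k))"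
    unfolding pcong_iff_Rep Rep_padic_int_of_int by simp
  then show ?thesis by (intro exI[of _ ?k]) (simp only: of_int_of_nat_eq, simp)
qed

lemma p_dvd_of_int_iff: "(pp :: 'p::prime_card padic_int) dvd of_int k \<longleftrightarrow> int CARD('p) dvd k"
  using p_power_dvd_iff[of 1 "of_int k :: 'p padic_int"] unfolding Rep_padic_int_of_int
  by (simp add: dvd_eq_mod_eq_0)

lemma p_dvd_of_nat_iff: "(pp :: 'p::prime_card padic_int) dvd of_nat k \<longleftrightarrow> CARD('p) dvd k"
  using p_dvd_of_int_iff[of "int k", where 'p='p] by simp

lemma pcong_of_int_iff:
  "pcong n (of_int a :: 'p::prime_card padic_int) (of_int b) \<longleftrightarrow> [a = b] (mod int CARD('p) ^ n)"
  unfolding pcong_iff_Rep Rep_padic_int_of_int cong_def ..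

text \<open>If \<open>b\<close> inverts \<open>x\<close> modulo \<open>p\<close> and
  \<open>d = 1 - x b\<close>, then \<open>b (1 + d + ... + d^(n-1))\<close> inverts \<open>x\<close>
  modulo \<open>p^n\<close>. Inverses modulo \<open>p^n\<close> are unique, so these approximations
  are compatible and converge.\<close>

lemma padic_unit:
  fixes x :: "'p::prime_card padic_int"
  assumes "\<not> pp dvd x"
  shows "x dvd 1"
proof -
  obtain a where a: "pcong 1 x (of_nat a)" using nat_approx by blast
  have "\<not> CARD('p) dvd a"
  proof
    assume "CARD('p) dvd a"
    then have "pp dvd (x - of_nat a) + (of_nat a :: 'p padic_int)"
      using a unfolding pcong_def by (intro dvd_add) (simp_all add: p_dvd_of_nat_iff)
    then show False using assms by simp
  qed
  then have "coprime (int a) (int CARD('p))"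
    using prime_imp_coprime[OF prime_card[where 'a='p]] by (simp add: coprime_commute)
  then obtain b where b: "[int a * b = 1] (mod int CARD('p))" using cong_solve_coprime_int by blast
  have "pcong 1 (of_int (int a * b) :: 'p padic_int) (of_int 1)"
    unfolding pcong_of_int_iff using b by simp
  with pcong_mult[OF a pcong_refl[of 1 "of_int b"]] have "pcong 1 (x * of_int b) 1"
    using pcong_trans by fastforce
  then have d: "pp dvd 1 - x * of_int b" unfolding pcong_def
    by (metis dvd_minus_iff minus_diff_eq power_one_right)
  have "\<exists>c. pcong n (x * c) 1" for n
  proof -
    have "1 - (1 - x * of_int b) ^ n = x * (of_int b * (\<Sum>i<n. (1 - x * of_int b) ^ i))"
      by (simp add: one_diff_power_eq mult.assoc)
    moreover have "pp ^ n dvd (1 - x * of_int b) ^ n" using d by (rule dvd_power_same)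
    ultimately have "pcong n (1 - (x * (of_int b * (\<Sum>i<n. (1 - x * of_int b) ^ i)))) 0"
      by (simp add: pcong_def flip: \<open>1 - (1 - x * of_int b) ^ n = _\<close>)
    from pcong_diff[OF pcong_refl[of n 1] this] show ?thesis by auto
  qed
  then obtain c where c: "\<And>n. pcong n (x * c n) 1" by metis
  have "pcong n (c (Suc n)) (c n)" for n
  proof -
    have "pcong n (c n * (x * c (Suc n))) (c n * 1)"
      by (intro pcong_mult pcong_refl pcong_mono[OF c]) auto
    moreover have "pcong n (x * c n * c (Suc n)) (1 * c (Suc n))"
      by (intro pcong_mult pcong_refl c)
    moreover have "c n * (x * c (Suc n)) = x * c n * c (Suc n)" by (simp add: mult_ac)
    ultimately show ?thesis using pcong_sym pcong_trans by fastforce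
  qed
  from padic_int_complete[OF this] obtain y where y: "\<And>m. pcong m y (c m)" by blast
  have "pcong n (x * y) 1" for n
    using pcong_trans[OF pcong_mult[OF pcong_refl y] c] by blast
  then have "x * y = 1" by (rule pcong_eqI)
  then show ?thesis by (metis dvd_triv_left)
qed

lemma p_not_unit: "\<not> (pp :: 'p::prime_card padic_int) dvd 1"
  using p_dvd_of_nat_iff[of 1, where 'p='p] prime_card[where 'a='p] by auto

lemma p_dvd_mult_iff:
  fixes x y :: "'p::prime_card padic_int"
  shows "pp dvd x * y \<longleftrightarrow> pp dvd x \<or> pp dvd y"
proof
  assume *: "pp dvd x * y"
  show "pp dvd x \<or> pp dvd y"
  proof (rule disjCI)
    assume "\<not> pp dvd y"
    then have "y dvd 1" by (rule padic_unit)
    then obtain z where "1 = y * z" by (elim dvdE)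
    then have "x = x * y * z" by (simp add: mult.assoc)
    then show "pp dvd x" using * by (metis dvd_mult2)
  qed
qed auto

text \<open>In the factorisation of \<open>x^p - y^p\<close> by \<open>x - y\<close> the cofactor is
  congruent to \<open>p y^(p-1)\<close> modulo \<open>p\<close>, which yields one more factor
  \<open>p\<close>.\<close>

lemma pcong_power_p:
  fixes x y :: "'p::prime_card padic_int"
  assumes "pcong n x y" "n > 0"
  shows "pcong (Suc n) (x ^ CARD('p)) (y ^ CARD('p))"
proof -
  let ?p = "CARD('p)"
  have xy: "pcong 1 x y" using assms pcong_mono[of n x y 1] by simp
  have "pcong 1 (\<Sum>i<?p. y ^ (?p - Suc i) * x ^ i) (\<Sum>i<?p. y ^ (?p - Suc i) * y ^ i)"
    by (intro pcong_sum pcong_mult pcong_power pcong_refl xy)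
  also have "(\<Sum>i<?p. y ^ (?p - Suc i) * y ^ i) = (\<Sum>i<?p. y ^ (?p - 1))"
    by (intro sum.cong) (auto simp flip: power_add)
  also have "\<dots> = pp * y ^ (?p - 1)" by simp
  also have "pcong 1 \<dots> 0" by (simp add: pcong_def)
  finally have "pp dvd (\<Sum>i<?p. y ^ (?p - Suc i) * x ^ i)" by (simp add: pcong_def)
  then have "pp ^ n * pp dvd (x - y) * (\<Sum>i<?p. y ^ (?p - Suc i) * x ^ i)"
    using assms(1) unfolding pcong_def by (intro mult_dvd_mono)
  then show ?thesis by (simp add: pcong_def power_diff_sumr2 mult.commute)
qed

lemma pcong_power_p_power:
  fixes x y :: "'p::prime_card padic_int"
  assumes "pcong 1 x y"
  shows "pcong (Suc n) (x ^ CARD('p) ^ n) (y ^ CARD('p) ^ n)"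
proof (induction n)
  case (Suc n)
  then show ?case using pcong_power_p[OF Suc] by (simp add: mult.commute flip: power_mult)
qed (use assms in simp)

section \<open>The Teichmueller character\<close>

lemma mod_ring_pow_card: "(a :: 'p::prime_card mod_ring) ^ CARD('p) = a"
  using finite_field_power_card_eq_same[of a] by simp

lemma of_int_to_int_mod_ring [simp]: "of_int (to_int_mod_ring a) = (a :: 'p::prime_card mod_ring)"
  by (simp add: of_int_of_int_mod_ring)

lemma of_int_mod_ring_eq_iff:
  "(of_int k :: 'p::prime_card mod_ring) = of_int l \<longleftrightarrow> [k = l] (mod int CARD('p))"
  unfolding of_int_of_int_mod_ring cong_def by transfer auto

lemma of_int_mod_ring_eq_0_iff: "(of_int k :: 'p::prime_card mod_ring) = 0 \<longleftrightarrow> int CARD('p) dvd k"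
  using of_int_mod_ring_eq_iff[of k 0, where 'p='p] by (simp add: cong_0_iff)

lemma of_nat_mod_ring_eq_0_iff: "(of_nat k :: 'p::prime_card mod_ring) = 0 \<longleftrightarrow> CARD('p) dvd k"
  using of_int_mod_ring_eq_0_iff[of "int k", where 'p='p] by simp

abbreviation lift_mod :: "'p::prime_card mod_ring \<Rightarrow> 'p padic_int" where
  "lift_mod a \<equiv> of_int (to_int_mod_ring a)"

lemma pcong_lift_mod:
  assumes "of_int k = (a :: 'p::prime_card mod_ring)"
  shows "pcong 1 (lift_mod a) (of_int k)"
  unfolding pcong_of_int_iff power_one_right of_int_mod_ring_eq_iff[symmetric]
  using assms by simp

text \<open>Existence: the powers \<open>a^(p^m)\<close> of a lift converge, because
  \<open>a^p\<close> is congruent to \<open>a\<close> and taking p-th powers sharpens congruences.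
  Uniqueness: a multiplicative candidate satisfies \<open>\<psi> a ^ (p^m) = \<psi> a\<close>, so it
  coincides with this limit.\<close>

lemma teich_conditions:
  "teichmuller (0 :: 'p mod_ring) = 0 \<and> teichmuller (1 :: 'p mod_ring) = 1
    \<and> (\<forall>a b :: 'p mod_ring. teichmuller (a * b) = teichmuller a * teichmuller b)
    \<and> (\<forall>a :: 'p::prime_card mod_ring. pcong 1 (teichmuller a) (lift_mod a))"
proof -
  define Q where "Q = (\<lambda>\<psi> :: 'p mod_ring \<Rightarrow> 'p padic_int.
      \<psi> 0 = 0 \<and> \<psi> 1 = 1 \<and> (\<forall>a b. \<psi> (a * b) = \<psi> a * \<psi> b) \<and>
     (\<forall>a. of_nat CARD('p) dvd \<psi> a - of_int (to_int_mod_ring a)))"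
  let ?p = "CARD('p)"
  let ?f = "\<lambda>a m. (lift_mod a :: 'p padic_int) ^ ?p ^ m"
  have "pcong m (?f a (Suc m)) (?f a m)" for a m
  proof -
    have "pcong 1 (lift_mod a ^ ?p) (lift_mod a :: 'p padic_int)"
      using pcong_lift_mod[of "to_int_mod_ring a ^ ?p" a] mod_ring_pow_card[of a]
      by (simp add: pcong_sym)
    from pcong_mono[OF pcong_power_p_power[OF this, of m], of m] show ?thesis
      by (simp flip: power_mult)
  qed
  then have "\<forall>a. \<exists>y. \<forall>m. pcong m y (?f a m)" by (intro allI padic_int_complete)
  then obtain T where T: "\<And>a m. pcong m (T a) (?f a m)" by metis
  have T1: "pcong 1 (T a) (lift_mod a)" for a
  proof -
    have "pcong 1 (?f a 1) (lift_mod a)"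
      using pcong_lift_mod[of "to_int_mod_ring a ^ ?p" a] mod_ring_pow_card[of a]
      by (simp add: pcong_sym)
    with T[of 1 a] show ?thesis by (rule pcong_trans)
  qed
  have Teq: "T a = z" if "\<And>m. pcong m z (?f a m)" for a z
    by (rule pcong_eqI, rule pcong_trans[OF T pcong_sym[OF that]])
  have "Q T"
    unfolding Q_def
  proof (intro conjI allI)
    show "T 0 = 0" by (rule Teq) (simp add: zero_power)
    show "T 1 = 1" by (rule Teq) simp
    show "of_nat CARD('p) dvd T a - of_int (to_int_mod_ring a)" for a
      using T1[of a] by (simp add: pcong_def)
    show "T (a * b) = T a * T b" for a b
    proof (rule Teq)
      fix m
      have "pcong 1 (lift_mod (a * b)) (lift_mod a * lift_mod b :: 'p padic_int)"
        using pcong_lift_mod[of "to_int_mod_ring a * to_int_mod_ring b" "a * b"] by simp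
      then have "pcong (Suc m) (?f (a * b) m) ((lift_mod a * lift_mod b) ^ ?p ^ m)"
        by (rule pcong_power_p_power)
      then have "pcong m (?f a m * ?f b m) (?f (a * b) m)"
        by (auto simp: power_mult_distrib intro: pcong_sym dest: pcong_mono[of "Suc m" _ _ m])
      then show "pcong m (T a * T b) (?f (a * b) m)"
        by (rule pcong_trans[OF pcong_mult[OF T T]])
    qed
  qed
  moreover have "\<psi> = T" if "Q \<psi>" for \<psi>
  proof (rule ext, rule Teq[symmetric])
    fix a m
    from that have pw: "\<psi> (a ^ k) = \<psi> a ^ k" for k
      by (induction k) (auto simp: Q_def)
    have "\<psi> a ^ ?p ^ m = \<psi> a"
    proof (induction m)
      case (Suc m)
      have "\<psi> a ^ ?p ^ Suc m = (\<psi> a ^ ?p ^ m) ^ ?p" by (simp add: mult.commute flip: power_mult)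
      then show ?case using Suc pw[of ?p] by (simp add: mod_ring_pow_card)
    qed simp
    moreover have "pcong 1 (\<psi> a) (lift_mod a)" using that by (simp add: Q_def pcong_def)
    ultimately show "pcong m (\<psi> a) (?f a m)"
      using pcong_power_p_power[of "\<psi> a" "lift_mod a" m] pcong_mono[of "Suc m" _ _ m] by simp
  qed
  ultimately have "Q (THE \<psi>. Q \<psi>)" by (rule theI)
  then have "Q teichmuller" unfolding teichmuller_def Q_def .
  then show ?thesis unfolding Q_def pcong_def power_one_right .
qed

lemma teich_0 [simp]: "teichmuller 0 = 0"
  using teich_conditions by blast

lemma teich_1 [simp]: "teichmuller 1 = 1"
  using teich_conditions by blast

lemma teich_mult: "teichmuller (a * b) = teichmuller a * teichmuller b"
  using teich_conditions by blast

lemma teich_cong: "pcong 1 (teichmuller a) (lift_mod a)"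
  using teich_conditions by blast

lemma teich_power: "teichmuller (a ^ k) = teichmuller a ^ k"
  by (induction k) (auto simp: teich_mult)

lemma teich_pow_card: "teichmuller (a :: 'p::prime_card mod_ring) ^ CARD('p) = teichmuller a"
  by (simp add: mod_ring_pow_card flip: teich_power)

lemma teich_pow_card_power:
  "teichmuller (a :: 'p::prime_card mod_ring) ^ CARD('p) ^ n = teichmuller a"
  by (induction n) (simp_all add: power_mult teich_pow_card)

lemma teich_eq_iff: "teichmuller a = teichmuller b \<longleftrightarrow> a = b"
proof
  assume "teichmuller a = teichmuller b"
  then have "pcong 1 (lift_mod a) (lift_mod b)"
    using pcong_trans[OF pcong_sym[OF teich_cong[of a]]] teich_cong[of b] by simp
  then show "a = b"
    unfolding pcong_of_int_iff power_one_right of_int_mod_ring_eq_iff[symmetric] by simp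
qed simp

lemma teich_eq_0_iff [simp]: "teichmuller a = 0 \<longleftrightarrow> a = 0"
  using teich_eq_iff[of a 0] by simp

lemma teich_pow_card_minus_1:
  assumes "(a :: 'p::prime_card mod_ring) \<noteq> 0"
  shows "teichmuller a ^ (CARD('p) - 1) = 1"
proof -
  have "teichmuller a ^ (CARD('p) - 1) * teichmuller a = 1 * teichmuller a"
    using teich_pow_card[of a] by (simp flip: power_Suc2)
  then show ?thesis using assms by (simp only: mult_cancel_right teich_eq_0_iff) simp
qed

lemma pcong_teich_of_nat:
  "pcong (Suc n) (teichmuller (of_nat m :: 'p::prime_card mod_ring)) (of_nat m ^ CARD('p) ^ n)"
proof -
  have "pcong 1 (lift_mod (of_nat m)) (of_int (int m) :: 'p padic_int)"
    by (rule pcong_lift_mod) simp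
  then have "pcong 1 (teichmuller (of_nat m)) (of_nat m :: 'p padic_int)"
    using teich_cong[of "of_nat m :: 'p mod_ring"] pcong_trans by fastforce
  from pcong_power_p_power[OF this, of n] show ?thesis by (simp add: teich_pow_card_power)
qed

lemma card_nonzero_mod_ring: "card (UNIV - {0 :: 'p::prime_card mod_ring}) = CARD('p) - 1"
  by (simp add: card_Diff_singleton)

lemma sum_power_roots:
  fixes z :: "'a::idom"
  assumes "z ^ n = 1" "z \<noteq> 1"
  shows "(\<Sum>j<n. z ^ j) = 0"
proof -
  have "(z - 1) * (\<Sum>j<n. z ^ j) = 0" using assms(1) by (simp flip: power_diff_1_eq)
  then show ?thesis using assms(2) by simp
qed

text \<open>Counting the roots of \<open>X^a - 1\<close> replaces the choice of a primitive
  root.\<close>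

lemma exists_power_neq_1:
  assumes "0 < a" "a < CARD('p) - 1"
  shows "\<exists>g :: 'p::prime_card mod_ring. g \<noteq> 0 \<and> g ^ a \<noteq> 1"
proof (rule ccontr)
  assume *: "\<not> ?thesis"
  let ?q = "Polynomial.monom 1 a - 1 :: 'p mod_ring poly"
  have dq: "degree ?q \<le> a" by (intro degree_diff_le) (auto simp: degree_monom_le)
  have "poly.coeff ?q a = 1" using assms(1) by simp
  then have q0: "?q \<noteq> 0" by (metis Polynomial.coeff_0 zero_neq_one)
  have "UNIV - {0} \<subseteq> {x. poly ?q x = 0}" using * by (auto simp: poly_monom)
  then have "card (UNIV - {0 :: 'p mod_ring}) \<le> card {x. poly ?q x = 0}"
    by (intro card_mono) auto
  also have "\<dots> \<le> a" using card_poly_roots_bound[OF q0] dq by simp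
  finally show False using assms(2) by (simp add: card_nonzero_mod_ring)
qed

lemma sum_teich_power:
  assumes "\<not> (CARD('p) - 1) dvd a"
  shows "(\<Sum>x\<in>UNIV - {0 :: 'p::prime_card mod_ring}. teichmuller x ^ a) = 0"
proof -
  let ?n = "CARD('p) - 1"
  have n: "?n > 0" using nontriv[where 'a='p] by simp
  have m: "teichmuller x ^ a = teichmuller x ^ (a mod ?n)" if "x \<noteq> 0" for x :: "'p mod_ring"
  proof -
    have "teichmuller x ^ a = teichmuller x ^ (?n * (a div ?n) + a mod ?n)" by simp
    then show ?thesis
      by (simp only: power_add power_mult teich_pow_card_minus_1[OF that] power_one mult_1)
  qed
  have "0 < a mod ?n" "a mod ?n < ?n" using assms n by (auto simp: dvd_eq_mod_eq_0)
  then obtain g :: "'p mod_ring" where g: "g \<noteq> 0" "g ^ (a mod ?n) \<noteq> 1"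
    using exists_power_neq_1 by blast
  have g1: "teichmuller g ^ a \<noteq> 1"
    using g teich_eq_iff[of "g ^ (a mod ?n)" 1] by (simp add: m teich_power)
  let ?S = "\<Sum>x\<in>UNIV - {0 :: 'p mod_ring}. teichmuller x ^ a"
  \<comment> \<open>Multiplication by \<open>g\<close> permutes the nonzero residues and scales the
    sum by a factor other than 1.\<close>
  have "?S = (\<Sum>x\<in>UNIV - {0 :: 'p mod_ring}. teichmuller (g * x) ^ a)"
    using g by (intro sum.reindex_bij_witness[of _ "\<lambda>x. g * x" "\<lambda>x. x / g"]) auto
  also have "\<dots> = teichmuller g ^ a * ?S"
    by (simp add: teich_mult power_mult_distrib sum_distrib_left)
  finally have "(teichmuller g ^ a - 1) * ?S = 0" by (simp add: algebra_simps)
  then show ?thesis using g1 by simp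
qed

section \<open>Morita's gamma function\<close>

text \<open>Multiples of \<open>p\<close> are replaced by 1 instead of being omitted, so that
  products run over plain initial segments and obey a one-step recursion.\<close>

definition unit_part :: "nat \<Rightarrow> 'p::prime_card padic_int" where
  "unit_part i = (if CARD('p) dvd i then 1 else of_nat i)"

definition unit_fact :: "nat \<Rightarrow> 'p::prime_card padic_int" where
  "unit_fact n = (\<Prod>i<n. unit_part i)"

lemma unit_fact_0 [simp]: "unit_fact 0 = 1" by (simp add: unit_fact_def)

lemma unit_fact_Suc: "unit_fact (Suc n) = unit_fact n * unit_part n"
  by (simp add: unit_fact_def)

lemma p_not_dvd_unit_part: "\<not> pp dvd (unit_part i :: 'p::prime_card padic_int)"
  by (simp add: unit_part_def p_not_unit p_dvd_of_nat_iff)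

lemma p_not_dvd_unit_fact: "\<not> pp dvd (unit_fact n :: 'p::prime_card padic_int)"
  by (induction n) (simp_all add: p_not_unit unit_fact_Suc p_dvd_mult_iff p_not_dvd_unit_part)

lemma morita_Gamma_nat_eq: "morita_Gamma_nat n = (- 1) ^ n * unit_fact n"
proof -
  have "(\<Prod>i | 0 < i \<and> i < n \<and> \<not> CARD('a) dvd i. of_nat i :: 'a padic_int)
      = (\<Prod>i<n. unit_part i)"
    by (rule prod.mono_neutral_cong_left) (auto simp: unit_part_def intro: gr0I)
  then show ?thesis by (simp add: morita_Gamma_nat_def unit_fact_def)
qed

text \<open>The multiples of \<open>p\<close> up to \<open>n\<close> contribute
  \<open>p^(n div p) (n div p)!\<close>. The argument is \<open>Suc n\<close> because
  \<open>unit_fact\<close> multiplies over indices strictly below it.\<close>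

lemma fact_eq_unit_fact:
  "(fact n :: 'p::prime_card padic_int)
     = pp ^ (n div CARD('p)) * fact (n div CARD('p)) * unit_fact (Suc n)"
proof (induction n)
  case 0
  then show ?case by (simp add: unit_fact_Suc unit_part_def)
next
  case (Suc n)
  let ?p = "CARD('p)"
  show ?case
  proof (cases "?p dvd Suc n")
    case True
    then have d: "Suc n div ?p = Suc (n div ?p)" by (simp add: div_Suc dvd_eq_mod_eq_0)
    have "Suc n = ?p * Suc (n div ?p)" using True d by (metis dvd_mult_div_cancel)
    then have "(of_nat (Suc n) :: 'p padic_int) = pp * of_nat (Suc (n div ?p))"
      by (metis of_nat_mult)
    moreover have "unit_fact (Suc (Suc n)) = (unit_fact (Suc n) :: 'p padic_int)"
      using True by (simp add: unit_fact_Suc[of "Suc n"] unit_part_def)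
    ultimately show ?thesis unfolding d fact_Suc Suc.IH by (simp add: mult_ac)
  next
    case False
    then have d: "Suc n div ?p = n div ?p" by (simp add: div_Suc dvd_eq_mod_eq_0)
    have "unit_fact (Suc (Suc n)) = unit_fact (Suc n) * (of_nat (Suc n) :: 'p padic_int)"
      using False by (simp add: unit_fact_Suc[of "Suc n"] unit_part_def del: of_nat_Suc)
    then show ?thesis unfolding d fact_Suc Suc.IH by (simp add: mult_ac)
  qed
qed

lemma pcong_unit_part:
  assumes "n > 0"
  shows "pcong n (unit_part (i + CARD('p) ^ n)) (unit_part i :: 'p::prime_card padic_int)"
proof -
  have "CARD('p) dvd i + CARD('p) ^ n \<longleftrightarrow> CARD('p) dvd i"
    using assms by (simp add: dvd_add_left_iff)
  then show ?thesis by (simp add: unit_part_def pcong_def)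
qed

lemma pcong_unit_fact_add:
  assumes "n > 0"
  shows "pcong n (unit_fact (k + CARD('p) ^ n))
    (unit_fact k * unit_fact (CARD('p) ^ n) :: 'p::prime_card padic_int)"
proof (induction k)
  case (Suc k)
  from pcong_mult[OF this pcong_unit_part[OF assms, of k]] show ?case
    by (simp add: unit_fact_Suc mult_ac)
qed simp

lemma sum_lessThan_odd_dvd:
  fixes p :: nat
  assumes "odd p"
  shows "p dvd (\<Sum>c<p. c)"
proof -
  obtain k where "p = 2 * k + 1" using assms by (elim oddE)
  moreover have "2 * (\<Sum>c<p. c) = p * (p - 1)"
    by (induction p) (auto simp: algebra_simps)
  ultimately have "(\<Sum>c<p. c) = p * k" by simp
  then show ?thesis by simp
qed

text \<open>First order expansion in \<open>p^n\<close>: its square vanishes modulo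
  \<open>p^(n+1)\<close> because \<open>n > 0\<close>.\<close>

lemma pcong_prod_shift:
  fixes x :: "'p::prime_card padic_int"
  assumes "n > 0"
  shows "pcong (Suc n) (\<Prod>c<k. x + of_nat c * pp ^ n)
    (x ^ k + x ^ (k - 1) * pp ^ n * of_nat (\<Sum>c<k. c))"
proof (induction k)
  case (Suc k)
  let ?q = "pp ^ n :: 'p padic_int" and ?s = "of_nat (\<Sum>c<k. c) :: 'p padic_int"
  have "(x ^ k + x ^ (k - 1) * ?q * ?s) * (x + of_nat k * ?q)
      - (x ^ Suc k + x ^ (Suc k - 1) * ?q * of_nat (\<Sum>c<Suc k. c))
      = ?q * ?q * (x ^ (k - 1) * ?s * of_nat k)"
    by (cases k) (simp_all add: algebra_simps)
  moreover have "pp ^ Suc n dvd ?q * ?q"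
    using le_imp_power_dvd[of "Suc n" "n + n" "pp :: 'p padic_int"] assms by (simp add: power_add)
  ultimately have "pcong (Suc n) ((x ^ k + x ^ (k - 1) * ?q * ?s) * (x + of_nat k * ?q))
      (x ^ Suc k + x ^ (Suc k - 1) * ?q * of_nat (\<Sum>c<Suc k. c))"
    unfolding pcong_def by (metis dvd_mult2)
  with pcong_mult[OF Suc.IH pcong_refl] show ?case
    unfolding prod.lessThan_Suc by (rule pcong_trans)
qed simp

text \<open>In the induction step the residues below \<open>p^(n+1)\<close> are grouped by their
  class modulo \<open>p^n\<close>. The class of a unit \<open>i\<close> contributes
  \<open>i^p\<close>, since the first order term carries the factor 0 + 1 + ... + (p - 1), a
  multiple of the odd \<open>p\<close>. So the product is congruent to the p-th power of the
  previous one.\<close>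

lemma prime_power_wilson:
  assumes "odd CARD('p)" "n > 0"
  shows "pcong n (unit_fact (CARD('p) ^ n) :: 'p::prime_card padic_int) (- 1)"
  using assms(2)
proof (induction n rule: nat_induct_non_zero)
  case 1
  let ?p = "CARD('p)"
  obtain k where k: "?p = Suc k" using nontriv[where 'a='p] by (cases ?p) auto
  have "(fact k :: 'p padic_int) = unit_fact ?p" using fact_eq_unit_fact[of k, where 'p='p] k
    by simp
  moreover have "pcong 1 (of_int (fact k) :: 'p padic_int) (of_int (- 1))"
    unfolding pcong_of_int_iff using wilson_theorem[OF prime_card[where 'a='p]] k by simp
  ultimately show ?case by simp
next
  case (Suc n)
  let ?p = "CARD('p)" and ?q = "CARD('p) ^ n"
  have "unit_fact (?p * ?q) = (\<Prod>c<?p. \<Prod>i\<in>{c * ?q..<c * ?q + ?q}. unit_part i :: 'p padic_int)"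
    unfolding unit_fact_def by (rule prod.nat_group[symmetric])
  also have "\<dots> = (\<Prod>c<?p. \<Prod>i<?q. unit_part (i + c * ?q))"
  proof (rule prod.cong[OF refl])
    fix c
    show "(\<Prod>i\<in>{c * ?q..<c * ?q + ?q}. unit_part i :: 'p padic_int)
      = (\<Prod>i<?q. unit_part (i + c * ?q))"
      by (rule prod.reindex_bij_witness[of _ "\<lambda>i. i + c * ?q" "\<lambda>i. i - c * ?q"]) auto
  qed
  finally have "unit_fact (?p ^ Suc n)
      = (\<Prod>i<?q. \<Prod>c<?p. unit_part (i + c * ?q) :: 'p padic_int)"
    by (subst prod.swap) simp
  moreover have "pcong (Suc n) (\<Prod>c<?p. unit_part (i + c * ?q)) (unit_part i ^ ?p :: 'p padic_int)" for i
  proof (cases "?p dvd i")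
    case True
    then have "?p dvd i + c * ?q" for c using Suc.hyps by simp
    then show ?thesis using True by (simp add: unit_part_def)
  next
    case False
    then have "\<not> ?p dvd i + c * ?q" for c using Suc.hyps by (simp add: dvd_add_left_iff)
    then have "(\<Prod>c<?p. unit_part (i + c * ?q) :: 'p padic_int)
      = (\<Prod>c<?p. of_nat i + of_nat c * pp ^ n)"
      by (simp add: unit_part_def)
    also have "pcong (Suc n) \<dots> (of_nat i ^ ?p + of_nat i ^ (?p - 1) * pp ^ n * of_nat (\<Sum>c<?p. c))"
      by (rule pcong_prod_shift[OF Suc.hyps])
    also have "pcong (Suc n) \<dots> (of_nat i ^ ?p + 0)"
    proof (rule pcong_add[OF pcong_refl])
      have "pp dvd (of_nat (\<Sum>c<?p. c) :: 'p padic_int)"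
        using sum_lessThan_odd_dvd[OF assms(1)] p_dvd_of_nat_iff by blast
      then have "pp ^ n * pp dvd pp ^ n * (of_nat (\<Sum>c<?p. c) :: 'p padic_int)"
        by (rule mult_dvd_mono[OF dvd_refl])
      then have "pp ^ Suc n dvd of_nat i ^ (?p - 1) * (pp ^ n * (of_nat (\<Sum>c<?p. c) :: 'p padic_int))"
        unfolding power_Suc2 by (rule dvd_mult)
      then show "pcong (Suc n) (of_nat i ^ (?p - 1) * pp ^ n * (of_nat (\<Sum>c<?p. c) :: 'p padic_int)) 0"
        unfolding pcong_def mult.assoc diff_zero .
    qed
    finally show ?thesis using False by (simp add: unit_part_def)
  qed
  ultimately have "pcong (Suc n) (unit_fact (?p ^ Suc n)) (\<Prod>i<?q. unit_part i ^ ?p :: 'p padic_int)"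
    by (auto intro: pcong_prod)
  also have "(\<Prod>i<?q. unit_part i ^ ?p :: 'p padic_int) = unit_fact ?q ^ ?p"
    by (simp add: unit_fact_def prod_power_distrib)
  also have "pcong (Suc n) \<dots> ((- 1) ^ ?p)" by (rule pcong_power_p[OF Suc.IH Suc.hyps])
  also have "(- 1) ^ ?p = (- 1 :: 'p padic_int)" using assms(1) by simp
  finally show ?case .
qed

text \<open>The sign \<open>(-1)^n\<close> in the gamma function is what makes it continuous: for
  odd \<open>p\<close> the sign \<open>(-1)^(p^n)\<close> cancels the \<open>- 1\<close> of Wilson's
  theorem.\<close>

lemma pcong_morita_Gamma_nat_mult:
  assumes "odd CARD('p)" "n > 0"
  shows "pcong n (morita_Gamma_nat (k + j * CARD('p) ^ n)) (morita_Gamma_nat k :: 'p::prime_card padic_int)"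
proof (induction j)
  case (Suc j)
  let ?q = "CARD('p) ^ n" and ?k = "k + j * CARD('p) ^ n"
  have "pcong n (unit_fact (?k + ?q)) (unit_fact ?k * (- 1) :: 'p padic_int)"
    using pcong_trans[OF pcong_unit_fact_add[OF assms(2)] pcong_mult[OF pcong_refl prime_power_wilson[OF assms]]] .
  from pcong_mult[OF pcong_refl this, of "(- 1) ^ (?k + ?q)"]
  have "pcong n (morita_Gamma_nat (?k + ?q)) (morita_Gamma_nat ?k :: 'p padic_int)"
    using assms by (simp add: morita_Gamma_nat_eq power_add)
  then show ?case using Suc pcong_trans by (fastforce simp: add_ac)
qed simp

lemma pcong_of_nat_iff:
  "pcong n (of_nat a :: 'p::prime_card padic_int) (of_nat b) \<longleftrightarrow> [a = b] (mod CARD('p) ^ n)"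
  using pcong_of_int_iff[of n "int a" "int b", where 'p='p] by (simp flip: cong_int_iff)

lemma pcong_morita_Gamma_nat:
  assumes "odd CARD('p)" "pcong n (of_nat a :: 'p::prime_card padic_int) (of_nat b)"
  shows "pcong n (morita_Gamma_nat a) (morita_Gamma_nat b :: 'p padic_int)"
proof (cases "n = 0")
  case False
  have le: "pcong n (morita_Gamma_nat b) (morita_Gamma_nat a :: 'p padic_int)"
    if cg: "[a = b] (mod CARD('p) ^ n)" and ab: "a \<le> b" for a b
  proof -
    obtain j where "b = a + j * CARD('p) ^ n"
      using cong_le_nat[OF ab] cong_sym[OF cg] by (auto simp: add.commute)
    then show ?thesis using pcong_morita_Gamma_nat_mult[OF assms(1)] False by simp
  qed
  have "[a = b] (mod CARD('p) ^ n)" using assms(2) by (simp add: pcong_of_nat_iff)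
  then show ?thesis using le[of a b] le[of b a] by (cases "a \<le> b") (auto intro: pcong_sym cong_sym)
qed simp

section \<open>The p-adic metric and the continuous extension of the gamma function\<close>

lemma dist_le_if_pcong:
  assumes "pcong n x (y :: 'p::prime_card padic_int)"
  shows "dist x y \<le> 1 / real CARD('p) ^ n"
proof (cases "x = y")
  case False
  then obtain m where m: "\<not> pcong m x y" using pcong_eqI by blast
  have "k \<le> m" if "pcong k x y" for k
    using m that pcong_mono[of k x y m] by (meson nat_le_linear)
  then have "n \<le> (GREATEST k. Rep_padic_int x k = Rep_padic_int y k)"
    using assms by (intro Greatest_le_nat[of _ n m]) (auto simp: pcong_iff_Rep)
  moreover have "1 \<le> real CARD('p)" using nontriv[where 'a='p] by simp
  ultimately show ?thesis using False
    by (auto simp: dist_padic_int_def intro!: divide_left_mono power_increasing)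
qed (simp add: dist_padic_int_def)

lemma pcong_if_dist_less:
  assumes "dist x y < 1 / real CARD('p) ^ n"
  shows "pcong n x (y :: 'p::prime_card padic_int)"
proof (cases "x = y")
  case False
  let ?P = "\<lambda>k. Rep_padic_int x k = Rep_padic_int y k"
  let ?G = "GREATEST k. ?P k"
  obtain m where m: "\<not> pcong m x y" using False pcong_eqI by blast
  have "k \<le> m" if "pcong k x y" for k
    using m that pcong_mono[of k x y m] by (meson nat_le_linear)
  then have "?P ?G" by (intro GreatestI_nat[of ?P 0 m]) (auto simp: pcong_iff_Rep Rep_padic_int_0)
  then have G: "pcong ?G x y" by (simp add: pcong_iff_Rep)
  have p1: "1 < real CARD('p)" using nontriv[where 'a='p] by simp
  have "n \<le> ?G"
  proof (rule ccontr)
    assume "\<not> n \<le> ?G"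
    then have "real CARD('p) ^ ?G \<le> real CARD('p) ^ n" using p1 by (intro power_increasing) auto
    then have "1 / real CARD('p) ^ n \<le> 1 / real CARD('p) ^ ?G"
      using p1 by (intro divide_left_mono) auto
    then show False using assms False by (simp add: dist_padic_int_def)
  qed
  then show ?thesis using G pcong_mono by blast
qed simp

lemma tendsto_padic_iff:
  fixes f :: "'b \<Rightarrow> 'p::prime_card padic_int"
  shows "(f \<longlongrightarrow> l) F \<longleftrightarrow> (\<forall>n. eventually (\<lambda>x. pcong n (f x) l) F)"
proof
  assume *: "(f \<longlongrightarrow> l) F"
  show "\<forall>n. eventually (\<lambda>x. pcong n (f x) l) F"
  proof
    fix n
    have "0 < 1 / real CARD('p) ^ n" by simp
    then have "eventually (\<lambda>x. dist (f x) l < 1 / real CARD('p) ^ n) F" using * tendstoD by blast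
    then show "eventually (\<lambda>x. pcong n (f x) l) F"
      by (rule eventually_mono) (rule pcong_if_dist_less)
  qed
next
  assume *: "\<forall>n. eventually (\<lambda>x. pcong n (f x) l) F"
  show "(f \<longlongrightarrow> l) F"
  proof (rule tendstoI)
    fix e :: real assume "e > 0"
    have "1 / real CARD('p) < 1" using nontriv[where 'a='p] by simp
    then obtain n where n: "(1 / real CARD('p)) ^ n < e" using real_arch_pow_inv \<open>e > 0\<close> by blast
    show "eventually (\<lambda>x. dist (f x) l < e) F"
      using *[rule_format, of n]
      by (rule eventually_mono) (use dist_le_if_pcong n in \<open>fastforce simp: power_one_over\<close>)
  qed
qed

text \<open>This resolves the definite description in \<open>morita_Gamma\<close>: values at
  approximating naturals are compatible modulo every \<open>p^m\<close>, completeness provides the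
  candidate, and some positive sequence tending to \<open>x\<close> forces uniqueness.\<close>

lemma pcong_morita_Gamma_of_nat:
  assumes "odd CARD('p)" "pcong n x (of_nat k :: 'p::prime_card padic_int)"
  shows "pcong n (morita_Gamma x) (morita_Gamma_nat k)"
proof -
  have "\<forall>m. \<exists>k>0. pcong m x (of_nat k)" using nat_approx by blast
  from choice[OF this] obtain s where s: "\<And>m. s m > 0" "\<And>m. pcong m x (of_nat (s m))" by blast
  have "pcong m (of_nat (s (Suc m)) :: 'p padic_int) (of_nat (s m))" for m
    using pcong_trans[OF pcong_sym[OF pcong_mono[OF s(2)[of "Suc m"], of m]] s(2)] by simp
  then have "pcong m (morita_Gamma_nat (s (Suc m))) (morita_Gamma_nat (s m) :: 'p padic_int)" for m
    by (rule pcong_morita_Gamma_nat[OF assms(1)])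
  from padic_int_complete[of "\<lambda>m. morita_Gamma_nat (s m)", OF this]
  obtain y where y: "\<And>m. pcong m y (morita_Gamma_nat (s m) :: 'p padic_int)" by blast
  have y': "pcong m y (morita_Gamma_nat j)" if "pcong m x (of_nat j)" for m j
    using pcong_trans[OF y pcong_morita_Gamma_nat[OF assms(1) pcong_trans[OF pcong_sym[OF s(2)] that]]] .
  have "morita_Gamma x = y"
    unfolding morita_Gamma_def
  proof (rule the_equality, intro allI impI)
    fix s :: "nat \<Rightarrow> nat"
    assume "(\<lambda>k. of_nat (s k) :: 'p padic_int) \<longlonglongrightarrow> x"
    then show "(\<lambda>k. morita_Gamma_nat (s k)) \<longlonglongrightarrow> y"
      unfolding tendsto_padic_iff
        by (auto elim!: eventually_mono intro!: pcong_sym[OF y'] intro: pcong_sym)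
  next
    fix z :: "'p padic_int"
    assume z: "\<forall>s. (\<forall>k. 0 < s k) \<longrightarrow> (\<lambda>k. of_nat (s k)) \<longlonglongrightarrow> x \<longrightarrow> (\<lambda>k. morita_Gamma_nat (s k)) \<longlonglongrightarrow> z"
    have "(\<lambda>k. of_nat (s k)) \<longlonglongrightarrow> x"
      unfolding tendsto_padic_iff
    proof
      fix n show "eventually (\<lambda>k. pcong n (of_nat (s k)) x) sequentially"
        using eventually_ge_at_top[of n] by eventually_elim (rule pcong_sym[OF pcong_mono[OF s(2)]])
    qed
    then have "(\<lambda>k. morita_Gamma_nat (s k)) \<longlonglongrightarrow> z" using z s(1) by blast
    moreover have "(\<lambda>k. morita_Gamma_nat (s k)) \<longlonglongrightarrow> y"
      unfolding tendsto_padic_iff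
    proof
      fix n show "eventually (\<lambda>k. pcong n (morita_Gamma_nat (s k)) y) sequentially"
        using eventually_ge_at_top[of n] by eventually_elim (rule pcong_sym[OF pcong_mono[OF y]])
    qed
    ultimately show "z = y" by (rule LIMSEQ_unique)
  qed
  then show ?thesis using y' assms(2) by blast
qed

lemma pcong_morita_Gamma:
  assumes "odd CARD('p)" "pcong n x (y :: 'p::prime_card padic_int)"
  shows "pcong n (morita_Gamma x) (morita_Gamma y)"
proof -
  obtain k where k: "pcong n y (of_nat k)" using nat_approx by blast
  then show ?thesis
    using pcong_morita_Gamma_of_nat[OF assms(1)] pcong_trans[OF assms(2) k] pcong_sym pcong_trans
      by metis
qed

lemma morita_Gamma_of_nat:
  assumes "odd CARD('p)"
  shows "morita_Gamma (of_nat k :: 'p::prime_card padic_int) = morita_Gamma_nat k"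
  by (rule pcong_eqI) (rule pcong_morita_Gamma_of_nat[OF assms pcong_refl])

lemma morita_Gamma_0:
  assumes "odd CARD('p)"
  shows "morita_Gamma (0 :: 'p::prime_card padic_int) = 1"
  using morita_Gamma_of_nat[OF assms, of 0] by (simp add: morita_Gamma_nat_eq)

lemma p_dvd_cong:
  assumes "pcong n x (y :: 'p::prime_card padic_int)" "n > 0"
  shows "pp dvd x \<longleftrightarrow> pp dvd y"
proof -
  have "pp dvd x - y" using pcong_mono[OF assms(1), of 1] assms(2) by (simp add: pcong_def)
  then show ?thesis by (metis diff_add_cancel dvd_add_right_iff)
qed

lemma p_not_dvd_morita_Gamma:
  assumes "odd CARD('p)"
  shows "\<not> pp dvd morita_Gamma (x :: 'p::prime_card padic_int)"
proof -
  obtain k where "pcong 1 x (of_nat k)" using nat_approx by blast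
  from p_dvd_cong[OF pcong_morita_Gamma_of_nat[OF assms this]] show ?thesis
    using p_not_dvd_unit_fact[of k, where 'p='p]
      by (cases "even k") (auto simp: morita_Gamma_nat_eq)
qed

lemma morita_Gamma_neq_0:
  "odd CARD('p) \<Longrightarrow> morita_Gamma (x :: 'p::prime_card padic_int) \<noteq> 0"
  using p_not_dvd_morita_Gamma[of x] by auto

lemma morita_Gamma_plus1:
  assumes "odd CARD('p)"
  shows "morita_Gamma (x + 1 :: 'p::prime_card padic_int)
    = (if pp dvd x then - 1 else - x) * morita_Gamma x"
proof (rule pcong_eqI)
  fix n
  \<comment> \<open>The modulus \<open>p^(n+1)\<close> ensures that \<open>k\<close> detects whether
    \<open>p\<close> divides \<open>x\<close> also for \<open>n = 0\<close>.\<close>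
  obtain k where k: "pcong (Suc n) x (of_nat k)" using nat_approx by blast
  have dvd: "pp dvd x \<longleftrightarrow> CARD('p) dvd k" using p_dvd_cong[OF k] by (simp add: p_dvd_of_nat_iff)
  have "pcong (Suc n) (x + 1) (of_nat (Suc k))" using pcong_add[OF k pcong_refl, of 1]
    by (simp add: add.commute)
  then have "pcong (Suc n) (morita_Gamma (x + 1)) (morita_Gamma_nat (Suc k))"
    by (rule pcong_morita_Gamma_of_nat[OF assms])
  also have "morita_Gamma_nat (Suc k) = (- unit_part k) * (morita_Gamma_nat k :: 'p padic_int)"
    by (simp add: morita_Gamma_nat_eq unit_fact_Suc)
  also have "pcong (Suc n) \<dots> ((if pp dvd x then - 1 else - x) * morita_Gamma x)"
    using k by (intro pcong_mult pcong_sym[OF pcong_morita_Gamma_of_nat[OF assms]])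
      (auto simp: unit_part_def dvd intro: pcong_minus pcong_sym)
  finally show "pcong n (morita_Gamma (x + 1)) ((if pp dvd x then - 1 else - x) * morita_Gamma x)"
    by (rule pcong_mono) simp
qed

text \<open>Descending by the functional equation divides by the next integer, or by
  \<open>- 1\<close> at multiples of \<open>p\<close>. This is how reciprocals of
  \<open>unit_fact\<close> come to appear in the Mahler coefficients.\<close>

lemma morita_Gamma_minus_of_nat:
  assumes "odd CARD('p)"
  shows "morita_Gamma (- of_nat n :: 'p::prime_card padic_int) * unit_fact (Suc n)
    = (- 1) ^ (n div CARD('p))"
proof (induction n)
  case 0
  then show ?case using morita_Gamma_0[OF assms] by (simp add: unit_fact_Suc unit_part_def)
next
  case (Suc n)
  let ?x = "- of_nat (Suc n) :: 'p padic_int"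
  have "?x + 1 = - of_nat n" by simp
  from morita_Gamma_plus1[OF assms, of ?x, unfolded this]
  have e:
    "morita_Gamma (- of_nat n) = (if CARD('p) dvd Suc n then - 1 else of_nat (Suc n)) * morita_Gamma ?x"
    by (simp add: p_dvd_of_nat_iff del: of_nat_Suc)
  show ?case
  proof (cases "CARD('p) dvd Suc n")
    case True
    then show ?thesis using Suc.IH e
      by (simp add: unit_fact_Suc[of "Suc n"] unit_part_def div_Suc dvd_eq_mod_eq_0 minus_equation_iff del: of_nat_Suc)
  next
    case False
    then show ?thesis using Suc.IH e
      by (simp add: unit_fact_Suc[of "Suc n"] unit_part_def div_Suc dvd_eq_mod_eq_0 mult_ac del: of_nat_Suc)
  qed
qed

section \<open>The multiplication formula and valuations\<close>

text \<open>The multiplication formula on the dense set of integers \<open>- R\<close>. The step to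
  \<open>- (R + 1)\<close> contributes a factor \<open>m\<close> unless \<open>p\<close> divides
  \<open>R + 1\<close>, and \<open>R - R div p\<close> counts those factors.\<close>

lemma morita_Gamma_prod_minus_of_nat:
  fixes mi :: "'p::prime_card padic_int"
  assumes "odd CARD('p)" and m: "of_nat m * mi = 1"
  shows "(\<Prod>h<m. morita_Gamma ((- of_nat R + of_nat h) * mi))
    = of_nat m ^ (R - R div CARD('p)) * morita_Gamma (- of_nat R)
      * (\<Prod>h<m. morita_Gamma (of_nat h * mi))"
proof (induction R)
  case 0
  then show ?case by (simp add: morita_Gamma_0[OF assms(1)])
next
  case (Suc R)
  let ?F = "\<lambda>x. \<Prod>h<m. morita_Gamma ((x + of_nat h) * mi)"
  define x where "x = (- of_nat (Suc R) :: 'p padic_int)"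
  define h where "h = (if CARD('p) dvd Suc R then - 1 else - x)"
  let ?M = "if CARD('p) dvd Suc R then 1 else of_nat m :: 'p padic_int"
  have mp: "\<not> pp dvd mi"
  proof
    assume "pp dvd mi"
    then have "pp dvd of_nat m * mi" by (rule dvd_mult)
    then show False using m p_not_unit[where 'p='p] by simp
  qed
  have x1: "x + 1 = - of_nat R" by (simp add: x_def)
  have dx: "pp dvd x \<longleftrightarrow> CARD('p) dvd Suc R"
    unfolding x_def dvd_minus_iff by (rule p_dvd_of_nat_iff)
  have dxm: "pp dvd x * mi \<longleftrightarrow> CARD('p) dvd Suc R"
    unfolding p_dvd_mult_iff dx using mp by simp
  \<comment> \<open>Raising \<open>x\<close> by 1 shifts the \<open>m\<close> arguments by one
    place: the first is lost and \<open>x / m + 1\<close> is gained, so a single use of the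
    functional equation suffices.\<close>
  have "?F (x + 1) * morita_Gamma (x * mi) = (\<Prod>h<Suc m. morita_Gamma ((x + of_nat h) * mi))"
    unfolding prod.lessThan_Suc_shift by (simp add: add.assoc)
  also have "\<dots> = ?F x * morita_Gamma (x * mi + 1)"
    using m by (simp add: distrib_right)
  also have "\<dots> = (?F x * (if CARD('p) dvd Suc R then - 1 else - (x * mi))) * morita_Gamma (x * mi)"
    unfolding morita_Gamma_plus1[OF assms(1)] dxm by (rule mult.assoc[symmetric])
  finally have F1: "?F (- of_nat R) = ?F x * (if CARD('p) dvd Suc R then - 1 else - (x * mi))"
    unfolding mult_cancel_right x1 using morita_Gamma_neq_0[OF assms(1)] by blast
  have 1: "?M * ?F (- of_nat R) = h * ?F x"
  proof (cases "CARD('p) dvd Suc R")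
    case False
    have "of_nat m * (?F x * - (x * mi)) = (of_nat m * mi) * (- x * ?F x)" by (simp add: mult_ac)
    then show ?thesis unfolding F1 using False m by (simp add: h_def)
  next
    case True
    then show ?thesis unfolding F1 h_def by simp
  qed
  have 2: "morita_Gamma (- of_nat R) = h * morita_Gamma x"
    using morita_Gamma_plus1[OF assms(1), of x] unfolding x1 dx h_def .
  have 3: "of_nat m ^ (Suc R - Suc R div CARD('p)) = ?M * of_nat m ^ (R - R div CARD('p))"
  proof (cases "CARD('p) dvd Suc R")
    case False
    then have "Suc R div CARD('p) = R div CARD('p)" by (simp add: div_Suc dvd_eq_mod_eq_0)
    moreover have "R div CARD('p) \<le> R" by (rule div_le_dividend)
    ultimately show ?thesis using False by (simp add: Suc_diff_le)
  qed (simp add: div_Suc dvd_eq_mod_eq_0)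
  have "of_nat (Suc R) \<noteq> (0 :: 'p padic_int)" by (simp only: of_nat_eq_0_iff)
  then have "h \<noteq> 0" by (simp add: h_def x_def del: of_nat_Suc)
  moreover have "h * ?F x = h * (?M * of_nat m ^ (R - R div CARD('p)) * morita_Gamma x
      * (\<Prod>h<m. morita_Gamma (of_nat h * mi)))"
    unfolding 1[symmetric] Suc.IH 2 by (simp only: mult_ac)
  ultimately have "?F x = ?M * of_nat m ^ (R - R div CARD('p)) * morita_Gamma x
      * (\<Prod>h<m. morita_Gamma (of_nat h * mi))"
    by (simp only: mult_cancel_left) blast
  then show ?case unfolding 3 x_def .
qed

theorem morita_Gamma_multiplication:
  fixes mi z :: "'p::prime_card padic_int"
  assumes "odd CARD('p)" and m: "of_nat m * mi = 1"
    and z: "(pp - 1) * z = of_nat r" and r: "r < CARD('p)"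
  shows "(\<Prod>h<m. morita_Gamma ((z + of_nat h) * mi))
    = teichmuller (of_nat m) ^ r * morita_Gamma z * (\<Prod>h<m. morita_Gamma (of_nat h * mi))"
proof (rule pcong_eqI)
  fix n
  let ?p = "CARD('p)"
  \<comment> \<open>As \<open>(p - 1) (1 + p + ... + p^n) = p^(n+1) - 1\<close>, the integer
    \<open>- R\<close> is congruent to \<open>z\<close> modulo \<open>p^(n+1)\<close>. Moreover
    \<open>R - R div p = p^n r\<close>, so the power of \<open>m\<close> is
    \<open>(m^(p^n))^r\<close>, which approximates \<open>teichmuller m ^ r\<close>.\<close>
  define R where "R = r * (\<Sum>i<Suc n. ?p ^ i)"
  have p1: "?p > 1" using nontriv[where 'a='p] .
  have "R = r + ?p * (r * (\<Sum>i<n. ?p ^ i))"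
    unfolding R_def sum.lessThan_Suc_shift by (simp add: algebra_simps sum_distrib_left)
  then have "R div ?p = r * (\<Sum>i<n. ?p ^ i)" using r p1 by simp
  then have Rdiv: "R - R div ?p = ?p ^ n * r" by (simp add: R_def algebra_simps)
  have "(pp - 1) * (\<Sum>i<Suc n. pp ^ i) = (pp ^ Suc n - 1 :: 'p padic_int)"
    by (simp only: power_diff_1_eq)
  then have "(pp - 1) * (z + of_nat R) = of_nat r * pp ^ Suc n"
  proof -
    assume S: "(pp - 1) * (\<Sum>i<Suc n. pp ^ i) = (pp ^ Suc n - 1 :: 'p padic_int)"
    have "(pp - 1) * (z + of_nat R)
        = (pp - 1) * z + of_nat r * ((pp - 1) * (\<Sum>i<Suc n. pp ^ i))"
      by (simp add: R_def distrib_left mult_ac del: sum.lessThan_Suc)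
    then show ?thesis unfolding S z by (simp add: right_diff_distrib)
  qed
  moreover have "\<not> pp dvd (pp - 1 :: 'p padic_int)"
  proof
    assume "pp dvd (pp - 1 :: 'p padic_int)"
    from dvd_diff[OF dvd_refl this] show False using p_not_unit[where 'p='p] by simp
  qed
  then have "(pp - 1 :: 'p padic_int) dvd 1" by (rule padic_unit)
  then obtain w where w: "1 = (pp - 1 :: 'p padic_int) * w" by (elim dvdE)
  have "z + of_nat R = w * ((pp - 1) * (z + of_nat R))"
    using w by (simp add: mult.assoc[symmetric] mult.commute[of w])
  ultimately have eq: "z + of_nat R = w * (of_nat r * pp ^ Suc n)" by (simp only:)
  have zR: "pcong (Suc n) z (- of_nat R)"
    unfolding pcong_def diff_minus_eq_add eq by (intro dvd_mult dvd_refl)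
  have "pcong (Suc n) (\<Prod>h<m. morita_Gamma ((z + of_nat h) * mi))
      (\<Prod>h<m. morita_Gamma ((- of_nat R + of_nat h) * mi))"
    by (intro pcong_prod pcong_morita_Gamma[OF assms(1)] pcong_mult pcong_add zR pcong_refl)
  also have "\<dots> = (of_nat m ^ ?p ^ n) ^ r * morita_Gamma (- of_nat R)
      * (\<Prod>h<m. morita_Gamma (of_nat h * mi))"
    unfolding morita_Gamma_prod_minus_of_nat[OF assms(1) m] Rdiv by (simp add: power_mult)
  also have "pcong (Suc n) \<dots> (teichmuller (of_nat m) ^ r * morita_Gamma z
      * (\<Prod>h<m. morita_Gamma (of_nat h * mi)))"
    by (intro pcong_mult pcong_refl pcong_power pcong_sym[OF pcong_teich_of_nat]
        pcong_sym[OF pcong_morita_Gamma[OF assms(1) zR]])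
  finally show "pcong n (\<Prod>h<m. morita_Gamma ((z + of_nat h) * mi))
      (teichmuller (of_nat m) ^ r * morita_Gamma z * (\<Prod>h<m. morita_Gamma (of_nat h * mi)))"
    by (rule pcong_mono) simp
qed

section \<open>The embedding into the field of p-adic numbers\<close>

lemma to_padic_0: "to_padic 0 = 0" by (rule Zero_fract_def[symmetric])
lemma to_padic_1: "to_padic 1 = 1" by (rule One_fract_def[symmetric])
lemma to_padic_add: "to_padic (x + y) = to_padic x + to_padic y" by simp
lemma to_padic_mult: "to_padic (x * y) = to_padic x * to_padic y" by simp
lemma to_padic_minus: "to_padic (- x) = - to_padic x" by simp
lemma to_padic_diff: "to_padic (x - y) = to_padic x - to_padic y" by simp
lemma to_padic_of_nat: "to_padic (of_nat n) = of_nat n" by (simp add: of_nat_fract)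
lemma to_padic_of_int: "to_padic (of_int n) = of_int n"
  by (cases n) (simp_all add: to_padic_of_nat to_padic_minus del: minus_fract of_nat_Suc)
lemma to_padic_power: "to_padic (x ^ n) = to_padic x ^ n"
  by (induction n) (simp_all add: to_padic_1 to_padic_mult del: mult_fract)
lemma to_padic_sum: "to_padic (sum f A) = (\<Sum>x\<in>A. to_padic (f x))"
  by (induction A rule: infinite_finite_induct) (simp_all add: to_padic_0 to_padic_add del: add_fract)
lemma to_padic_prod: "to_padic (prod f A) = (\<Prod>x\<in>A. to_padic (f x))"
  by (induction A rule: infinite_finite_induct) (simp_all add: to_padic_1 to_padic_mult del: mult_fract)
lemma to_padic_fact: "to_padic (fact n) = fact n"
  by (metis of_nat_fact to_padic_of_nat)
lemma to_padic_pochhammer: "to_padic (pochhammer x n) = pochhammer (to_padic x) n"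
  by (simp add: pochhammer_prod to_padic_prod to_padic_add to_padic_of_nat del: add_fract)
lemma to_padic_eq_iff: "to_padic x = to_padic y \<longleftrightarrow> x = y" by (simp add: eq_fract)
lemma to_padic_eq_0_iff: "to_padic x = 0 \<longleftrightarrow> x = 0"
  using to_padic_eq_iff[of x 0] by (simp add: to_padic_0)

lemmas to_padic_simps = to_padic_0 to_padic_1 to_padic_add to_padic_mult to_padic_minus
  to_padic_diff to_padic_of_nat to_padic_of_int to_padic_power to_padic_sum to_padic_prod
  to_padic_fact to_padic_pochhammer

text \<open>\<open>val_ge x r\<close> says \<open>(p - 1) v(x) \<ge> r\<close>: the scaling makes \<open>(- p) ^ (1 / (p - 1))\<close> have
  valuation 1, and \<open>k!\<close> have valuation at most \<open>k\<close>.\<close>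

definition val_ge :: "'p::prime_card padic \<Rightarrow> real \<Rightarrow> bool" where
  "val_ge x r \<longleftrightarrow> (\<exists>k::int. \<exists>u. x = of_nat CARD('p) powi k * to_padic u
     \<and> r \<le> real (CARD('p) - 1) * of_int k)"

lemma val_geI:
  "x = of_nat CARD('p) powi k * to_padic u \<Longrightarrow> r \<le> real (CARD('p) - 1) * of_int k
    \<Longrightarrow> val_ge (x :: 'p::prime_card padic) r"
  unfolding val_ge_def by blast

lemma val_ge_mono: "val_ge x r \<Longrightarrow> s \<le> r \<Longrightarrow> val_ge x s"
  unfolding val_ge_def by (blast intro: order_trans)

lemma card_minus_1_pos: "real (CARD('p::prime_card) - 1) > 0"
  using nontriv[where 'a='p] by simp

lemma val_ge_0 [simp]: "val_ge (0 :: 'p::prime_card padic) r"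
proof -
  obtain k :: nat where "r < real k * real (CARD('p) - 1)"
    using reals_Archimedean3[OF card_minus_1_pos[where 'p='p]] by blast
  then show ?thesis
    by (intro val_geI[of _ "int k" 0]) (simp_all add: to_padic_0 mult.commute)
qed

lemma val_ge_to_padic: "val_ge (to_padic u :: 'p::prime_card padic) 0"
  by (rule val_geI[of _ 0 u]) simp_all

lemma val_ge_powi:
  "val_ge (of_nat CARD('p) powi k :: 'p::prime_card padic) (real (CARD('p) - 1) * of_int k)"
  by (rule val_geI[of _ k 1]) (simp_all add: to_padic_1)

lemma val_ge_power:
  "val_ge (of_nat CARD('p) ^ k :: 'p::prime_card padic) (real (CARD('p) - 1) * real k)"
  using val_ge_powi[of "int k", where 'p='p] by simp

lemma val_ge_mult:
  fixes x y :: "'p::prime_card padic"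
  assumes "val_ge x r" "val_ge y s"
  shows "val_ge (x * y) (r + s)"
proof -
  obtain k u l v where *:
    "x = of_nat CARD('p) powi k * to_padic u" "r \<le> real (CARD('p) - 1) * of_int k"
    "y = of_nat CARD('p) powi l * to_padic v" "s \<le> real (CARD('p) - 1) * of_int l"
    using assms unfolding val_ge_def by blast
  then show ?thesis
    by (intro val_geI[of _ "k + l" "u * v"])
      (simp_all add: power_int_add to_padic_mult mult_ac algebra_simps del: mult_fract)
qed

lemma val_ge_add:
  fixes x y :: "'p::prime_card padic"
  assumes "val_ge x r" "val_ge y r"
  shows "val_ge (x + y) r"
proof -
  have *:
    "val_ge (of_nat CARD('p) powi k * to_padic u + of_nat CARD('p) powi l * to_padic v :: 'p padic) r"
    if "k \<le> l" "r \<le> real (CARD('p) - 1) * of_int k" for k l u v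
  proof (rule val_geI[OF _ that(2)])
    have "(of_nat CARD('p) :: 'p padic) powi l
      = of_nat CARD('p) powi k * of_nat CARD('p) ^ nat (l - k)"
      using that(1) power_int_add[of "of_nat CARD('p) :: 'p padic" k "l - k"]
      by (simp add: power_int_def)
    then show "of_nat CARD('p) powi k * to_padic u + of_nat CARD('p) powi l * to_padic v
        = of_nat CARD('p) powi k * to_padic (u + pp ^ nat (l - k) * v)"
      by (simp only: to_padic_simps) (simp only: algebra_simps)
  qed
  obtain k u l v
    where "x = of_nat CARD('p) powi k * to_padic u" "r \<le> real (CARD('p) - 1) * of_int k"
    "y = of_nat CARD('p) powi l * to_padic v" "r \<le> real (CARD('p) - 1) * of_int l"
    using assms unfolding val_ge_def by blast
  then show ?thesis using *[of k l u v] *[of l k v u] by (cases "k \<le> l") (simp_all add: add.commute)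
qed

lemma val_ge_mult_to_padic: "val_ge x r \<Longrightarrow> val_ge (to_padic u * x) r"
  using val_ge_mult[OF val_ge_to_padic, of x r u] by simp

lemma val_ge_minus: "val_ge x r \<Longrightarrow> val_ge (- x) r"
  using val_ge_mult_to_padic[of x r "- 1"] by (simp only: to_padic_simps) simp

lemma val_ge_diff: "val_ge x r \<Longrightarrow> val_ge y r \<Longrightarrow> val_ge (x - y) r"
  using val_ge_add[OF _ val_ge_minus, of x r y] by simp

lemma val_ge_sum: "(\<And>i. i \<in> A \<Longrightarrow> val_ge (f i) r) \<Longrightarrow> val_ge (sum f A) r"
  by (induction A rule: infinite_finite_induct) (auto intro: val_ge_add)

lemma val_ge_to_padic_iff:
  "val_ge (to_padic x :: 'p::prime_card padic) (real (CARD('p) - 1) * real n) \<longleftrightarrow> pp ^ n dvd x"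
proof
  assume "pp ^ n dvd x"
  then obtain y where "x = pp ^ n * y" by (elim dvdE)
  then show "val_ge (to_padic x) (real (CARD('p) - 1) * real n)"
    by (intro val_geI[of _ "int n" y]) (simp_all only: to_padic_simps, simp_all)
next
  assume "val_ge (to_padic x :: 'p padic) (real (CARD('p) - 1) * real n)"
  then obtain k u where ku: "to_padic x = (of_nat CARD('p) :: 'p padic) powi k * to_padic u"
    "real (CARD('p) - 1) * real n \<le> real (CARD('p) - 1) * of_int k" unfolding val_ge_def by blast
  then have nk: "int n \<le> k" using card_minus_1_pos[where 'p='p]
    by (simp add: mult_le_cancel_left_pos)
  then have "to_padic x = to_padic (pp ^ nat k * u)"
    using ku(1) by (simp only: to_padic_simps) (simp add: power_int_def)
  then have "x = pp ^ nat k * u" by (simp only: to_padic_eq_iff)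
  then show "pp ^ n dvd x" using nk by (simp add: dvd_mult2 le_imp_power_dvd)
qed

text \<open>Replaces uniqueness of limits: the numerator of \<open>x\<close> is divisible by every
  power of \<open>p\<close>.\<close>

lemma val_ge_imp_0:
  assumes "\<And>r. val_ge (x :: 'p::prime_card padic) r"
  shows "x = 0"
proof -
  obtain a b where x: "x = Fract a b" "b \<noteq> 0" by (cases x) auto
  then have ab: "to_padic a = to_padic b * x" by (simp add: eq_fract)
  have "pp ^ n dvd a" for n
    using val_ge_mult_to_padic[OF assms, of b "real (CARD('p) - 1) * real n"]
    unfolding ab[symmetric] val_ge_to_padic_iff .
  then have "a = 0" by (intro pcong_eqI) (simp add: pcong_def)
  then show ?thesis using ab x(2) by (simp add: to_padic_0 to_padic_eq_0_iff)
qed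

lemma val_ge_inverse_unit:
  assumes "\<not> pp dvd (u :: 'p::prime_card padic_int)"
  shows "val_ge (1 / to_padic u) 0"
proof -
  obtain w where "1 = u * w" using padic_unit[OF assms] by (elim dvdE)
  then have "to_padic u * to_padic w = 1" by (simp only: to_padic_simps flip: to_padic_mult)
  then have "1 / to_padic u = to_padic w"
    by (metis mult_zero_left nonzero_mult_div_cancel_left zero_neq_one)
  then show ?thesis using val_ge_to_padic by metis
qed

text \<open>Legendre: \<open>(p - 1) e\<close> is \<open>k\<close> minus its digit sum in base
  \<open>p\<close>, and \<open>k < p^D\<close> bounds that sum by \<open>(p - 1) D\<close>. The
  recursion from \<open>k\<close> to \<open>k div p\<close> proves both estimates without mentioning
  digits.\<close>

lemma fact_valuation:
  obtains e u where "(fact k :: 'p::prime_card padic_int) = pp ^ e * u" "\<not> pp dvd u"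
    "(CARD('p) - 1) * e \<le> k" "\<And>D. k < CARD('p) ^ D \<Longrightarrow> k \<le> (CARD('p) - 1) * (e + D)"
proof -
  let ?p = "CARD('p)"
  have p1: "?p > 1" using nontriv[where 'a='p] .
  have "\<exists>e u. (fact k :: 'p padic_int) = pp ^ e * u \<and> \<not> pp dvd u \<and> (?p - 1) * e \<le> k
    \<and> (\<forall>D. k < ?p ^ D \<longrightarrow> k \<le> (?p - 1) * (e + D))"
  proof (induction k rule: less_induct)
    case (less k)
    show ?case
    proof (cases "k = 0")
      case True
      then show ?thesis by (intro exI[of _ 0] exI[of _ 1]) (simp add: p_not_unit)
    next
      case False
      let ?l = "k div ?p"
      have "?l < k" using False p1 by simp
      from less[OF this] obtain e u where eu: "(fact ?l :: 'p padic_int) = pp ^ e * u"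
        "\<not> pp dvd u" "(?p - 1) * e \<le> ?l" "\<And>D. ?l < ?p ^ D \<Longrightarrow> ?l \<le> (?p - 1) * (e + D)" by blast
      obtain q where q: "?p = Suc q" using p1 by (cases ?p) auto
      have kk: "k = ?p * ?l + k mod ?p" "k mod ?p < ?p" using p1 by simp_all
      show ?thesis
      proof (intro exI conjI allI impI)
        show "fact k = pp ^ (?l + e) * (u * unit_fact (Suc k) :: 'p padic_int)"
          unfolding fact_eq_unit_fact[of k] eu(1) by (simp add: power_add mult_ac)
        show "\<not> pp dvd u * (unit_fact (Suc k) :: 'p padic_int)"
          using eu(2) by (simp add: p_dvd_mult_iff p_not_dvd_unit_fact)
        have "q * ?l + q * e \<le> q * ?l + ?l" using eu(3) q by simp
        also have "\<dots> \<le> k" using kk q by (metis add.commute le_add1 mult_Suc)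
        finally show "(?p - 1) * (?l + e) \<le> k" using q by (simp add: distrib_left)
        fix D assume D: "k < ?p ^ D"
        then obtain D' where D': "D = Suc D'" using False by (cases D) auto
        have "?l < ?p ^ D'" using D p1 by (simp add: D' div_less_iff_less_mult mult.commute)
        then have "?l \<le> q * (e + D')" using eu(4) q by simp
        moreover have "k \<le> q * ?l + ?l + q" using kk q
          by (metis add.commute add_le_mono1 less_Suc_eq_le mult_Suc add_le_cancel_left)
        ultimately have "k \<le> q * ?l + q * (e + D') + q" by linarith
        then show "k \<le> (?p - 1) * (?l + e + D)" using q D' by (simp add: algebra_simps)
      qed
    qed
  qed
  then show ?thesis using that by blast
qed

lemma val_ge_inverse_fact: "val_ge (1 / fact k :: 'p::prime_card padic) (- real k)"
proof -
  obtain e u where eu: "(fact k :: 'p padic_int) = pp ^ e * u" "\<not> pp dvd u" "(CARD('p) - 1) * e \<le> k"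
    using fact_valuation[of k, where 'p='p] by metis
  have "(1 / fact k :: 'p padic) = of_nat CARD('p) powi (- int e) * (1 / to_padic u)"
    unfolding to_padic_fact[symmetric] eu(1) to_padic_simps
      by (simp add: power_int_minus divide_simps)
  moreover have "real ((CARD('p) - 1) * e) \<le> real k" using eu(3) of_nat_le_iff by blast
  then have "- real k \<le> real (CARD('p) - 1) * of_int (- int e) + 0" by simp
  ultimately show ?thesis
    using val_ge_mono[OF val_ge_mult[OF val_ge_powi val_ge_inverse_unit[OF eu(2)]]] by metis
qed

lemma val_ge_fact:
  assumes "k < CARD('p) ^ D"
  shows "val_ge (fact k :: 'p::prime_card padic) (real k - real (CARD('p) - 1) * real D)"
proof -
  obtain e u where eu: "(fact k :: 'p padic_int) = pp ^ e * u" "k \<le> (CARD('p) - 1) * (e + D)"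
    using fact_valuation[of k, where 'p='p] assms by metis
  have "real k \<le> real ((CARD('p) - 1) * (e + D))" using eu(2) of_nat_le_iff by blast
  then have "real k - real (CARD('p) - 1) * real D \<le> real (CARD('p) - 1) * of_int (int e)"
    by (simp only: of_nat_mult of_nat_add) (simp add: algebra_simps)
  moreover have "(fact k :: 'p padic) = of_nat CARD('p) powi (int e) * to_padic u"
    unfolding to_padic_fact[symmetric] eu(1) to_padic_simps by simp
  ultimately show ?thesis by (intro val_geI)
qed

text \<open>Known for integers. It is enough to approximate \<open>x\<close> modulo the exact power
  \<open>p^e\<close> of \<open>p\<close> in \<open>k!\<close>, because the cofactor is a
  unit.\<close>

lemma fact_dvd_pochhammer_padic: "fact k dvd pochhammer (x :: 'p::prime_card padic_int) k"
proof -
  obtain e u where eu: "(fact k :: 'p padic_int) = pp ^ e * u" "\<not> pp dvd u"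
    using fact_valuation[of k, where 'p='p] by metis
  obtain n where n: "pcong e x (of_nat n)" using nat_approx by blast
  have "pcong e (pochhammer x k) (pochhammer (of_nat n) k)"
    unfolding pochhammer_prod by (intro pcong_prod pcong_add pcong_refl n)
  moreover have "pp ^ e dvd (pochhammer (of_nat n) k :: 'p padic_int)"
  proof -
    obtain j where "pochhammer (int n) k = fact k * j"
      using fact_dvd_pochhammer[of k "int n"] by (elim dvdE)
    then have "pochhammer (of_nat n) k = (fact k * of_int j :: 'p padic_int)"
      by (metis of_int_fact of_int_mult of_int_of_nat_eq pochhammer_of_nat)
    then show ?thesis by (simp add: eu(1) mult.assoc)
  qed
  ultimately have "pp ^ e dvd pochhammer x k"
    unfolding pcong_def by (metis diff_add_cancel dvd_add)
  moreover have "u dvd 1" by (rule padic_unit[OF eu(2)])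
  ultimately show ?thesis unfolding eu(1)
    by (metis mult.right_neutral mult_dvd_mono mult_unit_dvd_iff)
qed

lemma val_ge_pochhammer_div_fact:
  "val_ge (pochhammer (to_padic x :: 'p::prime_card padic) k / fact k) 0"
proof -
  obtain y where "pochhammer x k = fact k * y" using fact_dvd_pochhammer_padic[of k x]
    by (elim dvdE)
  then have "pochhammer (to_padic x) k = fact k * to_padic y"
    by (simp only: to_padic_simps flip: to_padic_pochhammer)
  then show ?thesis using val_ge_to_padic[of y] by simp
qed

section \<open>Mahler coefficients\<close>

lemma degree_pcompose_shift_diff:
  fixes f :: "'a::idom poly"
  shows "degree (pcompose f [:1, 1:] - f) \<le> degree f - 1"
proof (induction f)
  case (pCons c g)
  show ?case
  proof (cases "degree g = 0")
    case True
    then obtain d where "g = [:d:]" by (metis degree_0_id)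
    then have "pcompose (pCons c g) [:1, 1:] - pCons c g = [:d:]" by (simp add: pcompose_pCons)
    then show ?thesis by simp
  next
    case False
    have eq: "pcompose (pCons c g) [:1, 1:] - pCons c g
        = pCons 0 (pcompose g [:1, 1:] - g) + pcompose g [:1, 1:]"
      by (intro poly_eqI) (simp add: pcompose_pCons coeff_pCons split: nat.split)
    have "degree (pCons 0 (pcompose g [:1, 1:] - g)) \<le> degree g"
      using pCons.IH False degree_pCons_le[of 0 "pcompose g [:1, 1:] - g"] by simp
    moreover have "degree (pcompose g [:1, 1:]) \<le> degree g" by (simp add: degree_pcompose)
    ultimately have "degree (pcompose (pCons c g) [:1, 1:] - pCons c g) \<le> degree g"
      unfolding eq by (rule degree_add_le)
    moreover have "degree (pCons c g) = Suc (degree g)" using False by auto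
    ultimately show ?thesis by simp
  qed
qed simp

text \<open>Pascal's rule, in the form that drives the inductions on the length of a binomial
  sum.\<close>

lemma sum_choose_Suc:
  fixes g :: "nat \<Rightarrow> 'a::comm_ring_1"
  shows "(\<Sum>j\<le>Suc m. of_nat (Suc m choose j) * g j)
    = (\<Sum>j\<le>m. of_nat (m choose j) * (g j + g (Suc j)))"
proof -
  have "(\<Sum>j\<le>Suc m. of_nat (Suc m choose j) * g j)
      = g 0 + (\<Sum>j\<le>m. of_nat (m choose j) * g (Suc j)) + (\<Sum>j\<le>m. of_nat (m choose Suc j) * g (Suc j))"
    unfolding sum.atMost_Suc_shift by (simp add: algebra_simps sum.distrib)
  also have "g 0 + (\<Sum>j\<le>m. of_nat (m choose j) * g (Suc j))
    + (\<Sum>j\<le>m. of_nat (m choose Suc j) * g (Suc j))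
      = (\<Sum>j\<le>m. of_nat (m choose j) * g (Suc j)) + (\<Sum>j\<le>Suc m. of_nat (m choose j) * g j)"
    unfolding sum.atMost_Suc_shift by simp
  also have "(\<Sum>j\<le>Suc m. of_nat (m choose j) * g j) = (\<Sum>j\<le>m. of_nat (m choose j) * g j)"
    by (simp add: binomial_eq_0)
  finally show ?thesis by (simp add: algebra_simps sum.distrib)
qed

text \<open>Each step of the induction is a finite difference twisted by \<open>- 1 + P q\<close>: it lowers the
  degree of \<open>f\<close> by one or gains a factor \<open>P\<close> at the cost of raising the degree by \<open>P - 1\<close>.\<close>

lemma dvd_twisted_difference:
  fixes f q :: "int poly" and P :: nat
  assumes "P > 0" "degree q \<le> P - 1" "degree f \<le> e" "e + k * P < m + P"
  shows "int P ^ k dvd (\<Sum>j\<le>m. of_nat (m choose j) *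
    (poly f (int j) * (\<Prod>i\<in>{j..<m}. - 1 + int P * poly q (int (i + s)))))"
  using assms(3,4)
proof (induction m arbitrary: f e k s)
  case 0
  then have "k = 0" by (cases k) auto
  then show ?case by simp
next
  case (Suc m)
  \<comment> \<open>The offset \<open>s\<close> absorbs the reindexing of the product by one in each
    step.\<close>
  let ?Q = "\<lambda>s i. - 1 + int P * poly q (int (i + s))"
  let ?S = "\<lambda>f s. \<Sum>j\<le>m. of_nat (m choose j) * (poly f (int j) * (\<Prod>i\<in>{j..<m}. ?Q s i))"
  let ?f1 = "pcompose f [:1, 1:] - f"
  let ?f2 = "pcompose q [:int s, 1:] * f"
  have "(\<Sum>j\<le>Suc m. of_nat (Suc m choose j) * (poly f (int j) * (\<Prod>i\<in>{j..<Suc m}. ?Q s i)))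
    = (\<Sum>j\<le>m. of_nat (m choose j) * (poly f (int j) * (\<Prod>i\<in>{j..<Suc m}. ?Q s i)
        + poly f (int (Suc j)) * (\<Prod>i\<in>{Suc j..<Suc m}. ?Q s i)))"
    by (rule sum_choose_Suc)
  also have "\<dots> = (\<Sum>j\<le>m. of_nat (m choose j)
      * ((poly ?f1 (int j) + int P * poly ?f2 (int j)) * (\<Prod>i\<in>{j..<m}. ?Q (Suc s) i)))"
  proof (rule sum.cong[OF refl])
    fix j assume "j \<in> {..m}"
    then have 1: "(\<Prod>i\<in>{j..<Suc m}. ?Q s i) = ?Q s j * (\<Prod>i\<in>{Suc j..<Suc m}. ?Q s i)"
      by (intro prod.atLeast_Suc_lessThan) simp
    have 2: "(\<Prod>i\<in>{Suc j..<Suc m}. ?Q s i) = (\<Prod>i\<in>{j..<m}. ?Q (Suc s) i)"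
      unfolding prod.shift_bounds_Suc_ivl by simp
    have 3:
      "poly ?f1 (int j) + int P * poly ?f2 (int j) = poly f (int j) * ?Q s j + poly f (int (Suc j))"
      by (simp add: poly_pcompose algebra_simps)
    show "of_nat (m choose j) * (poly f (int j) * (\<Prod>i\<in>{j..<Suc m}. ?Q s i)
          + poly f (int (Suc j)) * (\<Prod>i\<in>{Suc j..<Suc m}. ?Q s i))
        = of_nat (m choose j) * ((poly ?f1 (int j) + int P * poly ?f2 (int j)) * (\<Prod>i\<in>{j..<m}. ?Q (Suc s) i))"
      unfolding 3 1 2 by (simp only: distrib_right mult.assoc)
  qed
  also have "\<dots> = ?S ?f1 (Suc s) + int P * ?S ?f2 (Suc s)"
    unfolding sum_distrib_left sum.distrib[symmetric]
    by (rule sum.cong[OF refl]) (simp only: distrib_left distrib_right mult_ac)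
  finally have eq:
    "(\<Sum>j\<le>Suc m. of_nat (Suc m choose j) * (poly f (int j) * (\<Prod>i\<in>{j..<Suc m}. ?Q s i)))
      = ?S ?f1 (Suc s) + int P * ?S ?f2 (Suc s)" .
  \<comment> \<open>The inequality \<open>e + k P < m + P\<close> survives in both branches: here
    \<open>e\<close> and \<open>m\<close> drop by one, in the other branch \<open>e\<close> grows by
    \<open>P - 1\<close> while \<open>k\<close> and \<open>m\<close> drop by one. For
    \<open>e = 0\<close> the difference of the constant \<open>f\<close> is zero.\<close>
  have "int P ^ k dvd ?S ?f1 (Suc s)"
  proof (cases "e = 0")
    case True
    then obtain c where "f = [:c:]" using Suc.prems(1) by (metis degree_0_id le_zero_eq)
    then show ?thesis by simp
  next
    case False
    show ?thesis
      using degree_pcompose_shift_diff[of f] Suc.prems False by (intro Suc.IH[of ?f1 "e - 1"]) auto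
  qed
  moreover have "int P ^ k dvd int P * ?S ?f2 (Suc s)"
  proof (cases k)
    case (Suc l)
    have "degree ?f2 \<le> (P - 1) + e"
      using degree_mult_le[of "pcompose q [:int s, 1:]" f] assms(2) Suc.prems(1)
      by (simp add: degree_pcompose)
    then have "int P ^ l dvd ?S ?f2 (Suc s)"
      using Suc.prems(2) Suc assms(1) by (intro Suc.IH[of ?f2 "P - 1 + e"]) auto
    then show ?thesis unfolding Suc power_Suc by (rule mult_dvd_mono[OF dvd_refl])
  qed simp
  ultimately show ?case unfolding eq by (rule dvd_add)
qed

lemma prod_linear_poly_decomp:
  fixes c :: "'b \<Rightarrow> int"
  assumes "finite A"
  shows "\<exists>r. (\<Prod>s\<in>A. [:c s, P:]) = [:\<Prod>s\<in>A. c s:] + Polynomial.smult P r \<and> degree r \<le> card A"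
  using assms
proof (induction A)
  case (insert x A)
  then obtain r where r:
    "(\<Prod>s\<in>A. [:c s, P:]) = [:\<Prod>s\<in>A. c s:] + Polynomial.smult P r" "degree r \<le> card A" by blast
  let ?r = "[:0, \<Prod>s\<in>A. c s:] + [:c x, P:] * r"
  have "(\<Prod>s\<in>insert x A. [:c s, P:]) = [:\<Prod>s\<in>insert x A. c s:] + Polynomial.smult P ?r"
    using insert by (simp add: r(1) algebra_simps smult_add_right)
  moreover have "degree ?r \<le> Suc (card A)"
    using degree_mult_le[of "[:c x, P:]" r] r(2) degree_pCons_le[of "c x" "[:P:]"]
    by (intro degree_add_le) (auto intro: order_trans[OF degree_pCons_le])
  ultimately show ?case using insert by auto
qed (auto intro: exI[of _ 0] simp: one_pCons)

lemma unit_fact_add: "unit_fact (n + k) = unit_fact n * (\<Prod>s<k. unit_part (n + s))"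
  by (induction k) (simp_all add: unit_fact_Suc mult_ac)

text \<open>The ratio is the product of the \<open>p - 1\<close> units among \<open>p\<close>
  consecutive integers: a polynomial in the block number \<open>i\<close> that is constant modulo
  \<open>p\<close>, and Wilson's theorem identifies the constant as \<open>- 1\<close>.\<close>

lemma unit_fact_block:
  assumes "odd CARD('p)" "a < CARD('p)"
  obtains q where "degree q \<le> CARD('p) - 1"
    "\<And>i. (unit_fact (Suc (a + CARD('p) * Suc i)) :: 'p::prime_card padic_int)
      = unit_fact (Suc (a + CARD('p) * i)) * of_int (- 1 + int CARD('p) * poly q (int i))"
proof -
  let ?p = "CARD('p)"
  \<comment> \<open>The omitted offset is the place of the multiple of \<open>p\<close> in the block
    that starts at \<open>a + 1 + p i\<close>.\<close>
  let ?A = "{..<?p} - {?p - 1 - a}"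
  let ?c = "\<lambda>s. int (Suc a + s)"
  have p1: "?p > 1" using nontriv[where 'a='p] .
  have dvd: "?p dvd Suc (a + ?p * i) + s \<longleftrightarrow> s = ?p - 1 - a" if "s < ?p" for s i
  proof
    have e: "Suc (a + ?p * i) + s = (Suc a + s) + ?p * i" by simp
    assume "?p dvd Suc (a + ?p * i) + s"
    then have "?p dvd Suc a + s" unfolding e by (simp only: dvd_add_left_iff[OF dvd_triv_left])
    moreover have "Suc a + s < 2 * ?p" using that assms(2) by simp
    ultimately have "Suc a + s = ?p" by (metis One_nat_def Suc_1 Suc_leI add_Suc dvd_div_mult_self
        less_2_cases less_mult_imp_div_less mult.commute mult_0 mult_1 nat.simps(3))
    then show "s = ?p - 1 - a" by simp
  next
    assume "s = ?p - 1 - a"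
    then have "Suc a + s = ?p" using assms(2) by simp
    moreover have "Suc (a + ?p * i) + s = (Suc a + s) + ?p * i" by simp
    ultimately have "Suc (a + ?p * i) + s = ?p * Suc i" by (simp only: mult_Suc_right)
    then show "?p dvd Suc (a + ?p * i) + s" by (metis dvd_triv_left)
  qed
  have blk: "(\<Prod>s<?p. unit_part (Suc (a + ?p * i) + s) :: 'p padic_int)
      = of_int (poly (\<Prod>s\<in>?A. [:?c s, int ?p:]) (int i))" for i
  proof -
    have "(\<Prod>s<?p. unit_part (Suc (a + ?p * i) + s) :: 'p padic_int)
        = (\<Prod>s\<in>?A. of_nat (Suc (a + ?p * i) + s))"
      using dvd by (intro prod.mono_neutral_cong_right) (auto simp: unit_part_def)
    also have "\<dots> = (\<Prod>s\<in>?A. of_int (?c s + int ?p * int i))"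
      by (intro prod.cong refl) (simp add: algebra_simps)
    finally show ?thesis by (simp add: poly_prod mult.commute)
  qed
  obtain r where r:
    "(\<Prod>s\<in>?A. [:?c s, int ?p:]) = [:\<Prod>s\<in>?A. ?c s:] + Polynomial.smult (int ?p) r" "degree r \<le> card ?A"
    using prod_linear_poly_decomp[of ?A ?c "int ?p"] by blast
  have cA: "card ?A = ?p - 1" using p1 assms(2) by (simp add: card_Diff_singleton)
  have "int ?p dvd (\<Prod>s\<in>?A. ?c s) + 1"
  proof -
    let ?C = "of_int (\<Prod>s\<in>?A. ?c s) :: 'p padic_int"
    have "unit_fact (Suc a + ?p) = unit_fact (Suc a) * ?C"
      using blk[of 0] r(1) unfolding unit_fact_add by (simp add: poly_prod)
    moreover have "pcong 1 (unit_fact (Suc a + ?p ^ 1)) (unit_fact (Suc a) * unit_fact (?p ^ 1) :: 'p padic_int)"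
      by (rule pcong_unit_fact_add) simp
    moreover have "pcong 1 (unit_fact (Suc a) * unit_fact (?p ^ 1)) (unit_fact (Suc a) * (- 1) :: 'p padic_int)"
      by (intro pcong_mult pcong_refl prime_power_wilson assms(1)) simp
    ultimately have "pcong 1 (unit_fact (Suc a) * ?C) (unit_fact (Suc a) * (- 1))"
      using pcong_trans by (simp only: power_one_right) blast
    then have "pp dvd unit_fact (Suc a) * (?C + 1)" by (simp add: pcong_def distrib_left)
    then have "pp dvd (of_int ((\<Prod>s\<in>?A. ?c s) + 1) :: 'p padic_int)"
      by (simp add: p_dvd_mult_iff p_not_dvd_unit_fact)
    then show ?thesis by (simp only: p_dvd_of_int_iff)
  qed
  then obtain d where d: "(\<Prod>s\<in>?A. ?c s) + 1 = int ?p * d" by (elim dvdE)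
  show ?thesis
  proof
    show "degree (r + [:d:]) \<le> ?p - 1" using r(2) cA by (intro degree_add_le) auto
    fix i
    have "Suc (a + ?p * Suc i) = Suc (a + ?p * i) + ?p" by simp
    moreover have "poly (\<Prod>s\<in>?A. [:?c s, int ?p:]) (int i) = - 1 + int ?p * poly (r + [:d:]) (int i)"
      unfolding r(1) using d by (simp add: algebra_simps)
    ultimately show "(unit_fact (Suc (a + ?p * Suc i)) :: 'p padic_int)
      = unit_fact (Suc (a + ?p * i)) * of_int (- 1 + int ?p * poly (r + [:d:]) (int i))"
      using blk[of i] by (simp only: unit_fact_add)
  qed
qed

text \<open>Up to sign these are the Mahler coefficients of \<open>x \<mapsto> \<Gamma>\<^sub>p (p x - a)\<close>.\<close>

definition mahler_coeff :: "nat \<Rightarrow> nat \<Rightarrow> 'p::prime_card padic" where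
  "mahler_coeff a m = (\<Sum>j\<le>m. of_nat (m choose j) * (1 / to_padic (unit_fact (Suc (a + CARD('p) * j)))))"

lemma to_padic_unit_fact_neq_0: "to_padic (unit_fact n :: 'p::prime_card padic_int) \<noteq> 0"
  using p_not_dvd_unit_fact[of n, where 'p='p] by (auto simp: to_padic_eq_0_iff)

text \<open>The terms of the coefficient have denominators \<open>(a + p j)!\<close> and
  \<open>p^(m-j) (m-j)!\<close>, and \<open>(a + p j)!\<close> is \<open>p^j j!\<close> times a
  \<open>unit_fact\<close>. Clearing \<open>p^m m!\<close> leaves a binomial coefficient over that
  unit.\<close>

lemma dwork_coeff_eq_mahler:
  assumes "a < CARD('p)"
  shows "of_nat CARD('p) ^ m * fact m * dwork_coeff CARD('p) (a + CARD('p) * m)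
    = (mahler_coeff a m :: 'p::prime_card padic)"
proof -
  let ?p = "CARD('p)" and ?P = "of_nat CARD('p) :: 'p padic"
  have p1: "?p > 1" using nontriv[where 'a='p] .
  have P0: "?P \<noteq> 0" by simp
  have f:
    "(fact (a + ?p * j) :: 'p padic)
    = ?P ^ j * fact j * to_padic (unit_fact (Suc (a + ?p * j)))" for j
  proof -
    have "(a + ?p * j) div ?p = j" using assms p1 by simp
    then have "(fact (a + ?p * j) :: 'p padic_int) = pp ^ j * fact j * unit_fact (Suc (a + ?p * j))"
      using fact_eq_unit_fact[of "a + ?p * j", where 'p='p] by simp
    then show ?thesis by (simp only: to_padic_simps flip: to_padic_fact)
  qed
  have iff: "?p * j \<le> a + ?p * m \<longleftrightarrow> j \<le> m" for j
  proof
    assume "?p * j \<le> a + ?p * m"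
    then have "?p * j < ?p * Suc m" using assms by simp
    then show "j \<le> m" using p1 by (simp only: mult_less_cancel1 less_Suc_eq_le)
  qed (simp add: trans_le_add2)
  have "dwork_coeff ?p (a + ?p * m)
      = (\<Sum>j\<le>m. 1 / fact (a + ?p * m - ?p * j) * ((1 / ?P) ^ j / fact j))"
    unfolding dwork_coeff_def using p1 by (simp add: exp_pow_nth iff atMost_def)
  also have "\<dots> = (\<Sum>j\<le>m. 1 / fact (a + ?p * j) * ((1 / ?P) ^ (m - j) / fact (m - j)))"
    by (rule sum.reindex_bij_witness[of _ "\<lambda>j. m - j" "\<lambda>j. m - j"])
      (auto simp: diff_mult_distrib2 le_imp_diff_is_add)
  finally have "?P ^ m * fact m * dwork_coeff ?p (a + ?p * m)
      = (\<Sum>j\<le>m. ?P ^ m * fact m * (1 / fact (a + ?p * j) * ((1 / ?P) ^ (m - j) / fact (m - j))))"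
    by (simp add: sum_distrib_left)
  also have "\<dots> = mahler_coeff a m"
    unfolding mahler_coeff_def
  proof (rule sum.cong[OF refl])
    fix j assume "j \<in> {..m}"
    then have jm: "j \<le> m" by simp
    have "?P ^ m = ?P ^ j * ?P ^ (m - j)" using jm by (simp flip: power_add)
    then show "?P ^ m * fact m * (1 / fact (a + ?p * j) * ((1 / ?P) ^ (m - j) / fact (m - j)))
        = of_nat (m choose j) * (1 / to_padic (unit_fact (Suc (a + ?p * j))))"
      unfolding f binomial_fact[OF jm] using P0 to_padic_unit_fact_neq_0[where 'p='p]
      by (simp add: field_simps)
  qed
  finally show ?thesis .
qed

lemma mult_cancel_inverse: "(u :: 'a::field) \<noteq> 0 \<Longrightarrow> (u * v) * (c * (1 / u)) = c * v"
  by simp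

lemma eq_inverse_mult: "(a :: 'a::field) \<noteq> 0 \<Longrightarrow> a * b = c \<Longrightarrow> b = 1 / a * c"
  by auto

text \<open>After multiplication by the unit \<open>unit_fact (Suc (a + p m))\<close> the sum is a
  twisted difference of the constant polynomial 1, with the twist supplied by
  \<open>unit_fact_block\<close>.\<close>

lemma val_ge_mahler_coeff:
  assumes "odd CARD('p)" "a < CARD('p)"
  shows "val_ge (mahler_coeff a m :: 'p::prime_card padic) (real (CARD('p) - 1) * (real m / real CARD('p)))"
proof -
  let ?p = "CARD('p)" and ?U = "\<lambda>j. unit_fact (Suc (a + CARD('p) * j)) :: 'p padic_int"
  have p1: "?p > 1" using nontriv[where 'a='p] .
  obtain q where q: "degree q \<le> ?p - 1"
    "\<And>i. ?U (Suc i) = ?U i * of_int (- 1 + int ?p * poly q (int i))"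
    using unit_fact_block[OF assms] by blast
  let ?Q = "\<lambda>i. - 1 + int ?p * poly q (int (i + 0))"
  have U: "?U m = ?U j * of_int (\<Prod>i\<in>{j..<m}. ?Q i)" if "j \<le> m" for j
    using that
  proof (induction m rule: dec_induct)
    case (step n)
    then show ?case unfolding q(2)[of n] by (simp add: prod.atLeastLessThan_Suc mult_ac)
  qed simp
  let ?S = "\<Sum>j\<le>m. of_nat (m choose j) * (poly 1 (int j) * (\<Prod>i\<in>{j..<m}. ?Q i))"
  have "to_padic (?U m) * mahler_coeff a m = to_padic (of_int ?S)"
    unfolding mahler_coeff_def sum_distrib_left of_int_sum to_padic_sum
  proof (rule sum.cong[OF refl])
    fix j assume "j \<in> {..m}"
    then have *: "?U m = ?U j * of_int (\<Prod>i\<in>{j..<m}. ?Q i)" by (intro U) simp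
    have "to_padic (?U m) * (of_nat (m choose j) * (1 / to_padic (?U j)))
        = of_nat (m choose j) * to_padic (of_int (\<Prod>i\<in>{j..<m}. ?Q i))"
      unfolding * to_padic_mult[of "?U j"]
      by (rule mult_cancel_inverse[OF to_padic_unit_fact_neq_0])
    then show "to_padic (?U m) * (of_nat (m choose j) * (1 / to_padic (?U j)))
        = to_padic (of_int (of_nat (m choose j) * (poly 1 (int j) * (\<Prod>i\<in>{j..<m}. ?Q i))))"
      by (simp only: of_int_mult of_int_of_nat_eq to_padic_mult to_padic_of_nat poly_1 mult_1)
  qed
  then have e: "mahler_coeff a m = 1 / to_padic (?U m) * to_padic (of_int ?S)"
    by (rule eq_inverse_mult[OF to_padic_unit_fact_neq_0])
  \<comment> \<open>The largest \<open>k\<close> with \<open>k p < m + p\<close>, the hypothesis of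
    \<open>dvd_twisted_difference\<close> for \<open>e = 0\<close>.\<close>
  define k where "k = nat \<lceil>real m / real ?p\<rceil>"
  have "0 \<le> real m / real ?p" by simp
  then have "0 \<le> \<lceil>real m / real ?p\<rceil>" by linarith
  then have "real k = of_int \<lceil>real m / real ?p\<rceil>" by (simp add: k_def)
  then have kub: "real k < real m / real ?p + 1" and klb: "real m / real ?p \<le> real k"
    using ceiling_correct[of "real m / real ?p"] by linarith+
  have "real (k * ?p) < real (m + ?p)"
    using kub p1 by (simp only: of_nat_mult of_nat_add) (simp add: field_simps)
  then have "0 + k * ?p < m + ?p" unfolding of_nat_less_iff by simp
  then have "int ?p ^ k dvd ?S"
    using q(1) p1 by (intro dvd_twisted_difference[where e=0]) auto
  then obtain c where "?S = int ?p ^ k * c" by (elim dvdE)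
  then have "(of_int ?S :: 'p padic_int) = pp ^ k * of_int c" by simp
  then have "pp ^ k dvd (of_int ?S :: 'p padic_int)" by simp
  then have "val_ge (to_padic (of_int ?S) :: 'p padic) (real (?p - 1) * real k)"
    by (simp only: val_ge_to_padic_iff)
  then have "val_ge (mahler_coeff a m :: 'p padic) (0 + real (?p - 1) * real k)"
    unfolding e by (intro val_ge_mult val_ge_inverse_unit p_not_dvd_unit_fact)
  moreover have "real (?p - 1) * (real m / real ?p) \<le> 0 + real (?p - 1) * real k"
    using card_minus_1_pos[where 'p='p] klb
    by (simp only: add_0 mult_le_cancel_left_pos)
  ultimately show ?thesis by (rule val_ge_mono)
qed

section \<open>Gamma values as sums of Dwork coefficients\<close>

text \<open>For \<open>n = a + p m\<close> the denominator \<open>p^m m!\<close> costs at most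
  \<open>p m\<close>, hence at most \<open>n\<close>, in scaled valuation, and the Mahler
  coefficient returns \<open>(p - 1) m / p\<close>, which is about
  \<open>(p - 1) n / p^2\<close>.\<close>

abbreviation dwork_slope :: "'p::prime_card itself \<Rightarrow> real" where
  "dwork_slope _ \<equiv> real (CARD('p) - 1) / real CARD('p) ^ 2"

lemma val_ge_dwork_coeff:
  assumes "odd CARD('p)"
  shows "val_ge (dwork_coeff CARD('p) n :: 'p::prime_card padic) ((dwork_slope TYPE('p) - 1) * real n)"
proof -
  let ?p = "CARD('p)"
  have p1: "?p > 1" using nontriv[where 'a='p] .
  define a m where "a = n mod ?p" and "m = n div ?p"
  have n: "n = a + ?p * m" and a: "a < ?p" using p1 by (simp_all add: a_def m_def)
  define \<sigma> where "\<sigma> = dwork_slope TYPE('p)"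
  have \<sigma>: "\<sigma> \<le> 1" "\<sigma> * real ?p = real (?p - 1) / real ?p"
  proof -
    have "real (?p - 1) \<le> real ?p * real ?p" using p1
      by (metis diff_le_self le_square le_trans of_nat_le_iff of_nat_mult)
    then show "\<sigma> \<le> 1" using p1 by (simp add: \<sigma>_def power2_eq_square)
  qed (use p1 in \<open>simp add: \<sigma>_def power2_eq_square\<close>)
  have "(of_nat ?p :: 'p padic) ^ m * fact m \<noteq> 0" by simp
  then have "(dwork_coeff ?p n :: 'p padic) = 1 / (of_nat ?p ^ m * fact m) * mahler_coeff a m"
    using dwork_coeff_eq_mahler[OF a, of m] unfolding n[symmetric] by (rule eq_inverse_mult)
  also have "\<dots> = of_nat ?p powi (- int m) * (1 / fact m) * mahler_coeff a m"
    by (simp add: power_int_minus divide_inverse)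
  finally have e: "(dwork_coeff ?p n :: 'p padic) = \<dots>" .
  have "val_ge (dwork_coeff ?p n :: 'p padic)
      (real (?p - 1) * of_int (- int m) + (- real m) + real (?p - 1) * (real m / real ?p))"
    unfolding e by (intro val_ge_mult val_ge_powi val_ge_inverse_fact val_ge_mahler_coeff assms a)
  moreover have "(\<sigma> - 1) * real n
      \<le> real (?p - 1) * of_int (- int m) + (- real m) + real (?p - 1) * (real m / real ?p)"
  proof -
    have "(\<sigma> - 1) * real n = (\<sigma> - 1) * real a + (\<sigma> * real ?p) * real m - real ?p * real m"
      by (simp add: n algebra_simps)
    also have "\<dots> \<le> (\<sigma> * real ?p) * real m - real ?p * real m"
      using \<sigma>(1) by (simp add: mult_nonpos_nonneg)
    also have "\<dots> = real (?p - 1) * of_int (- int m) + (- real m)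
      + real (?p - 1) * (real m / real ?p)"
      unfolding \<sigma>(2) using p1 by (simp add: algebra_simps of_nat_diff)
    finally show ?thesis .
  qed
  ultimately show ?thesis unfolding \<sigma>_def by (rule val_ge_mono)
qed

lemma binomial_inversion_alternating:
  fixes u :: "nat \<Rightarrow> 'a::comm_ring_1"
  shows "(\<Sum>k\<le>N. of_nat (N choose k) * ((- 1) ^ k * (\<Sum>j\<le>k. of_nat (k choose j) * u j)))
    = (- 1) ^ N * u N"
proof (induction N arbitrary: u)
  case (Suc N)
  have "(- 1) ^ k * (\<Sum>j\<le>k. of_nat (k choose j) * u j)
      + (- 1) ^ Suc k * (\<Sum>j\<le>Suc k. of_nat (Suc k choose j) * u j)
    = - ((- 1) ^ k * (\<Sum>j\<le>k. of_nat (k choose j) * u (Suc j)))" for k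
    unfolding sum_choose_Suc by (simp add: distrib_left sum.distrib)
  then show ?case
    unfolding sum_choose_Suc[of N "\<lambda>k. (- 1) ^ k * (\<Sum>j\<le>k. of_nat (k choose j) * u j)"]
    using Suc.IH[of "\<lambda>j. u (Suc j)"] by (simp add: sum_negf)
qed simp

lemma pochhammer_minus_of_nat:
  "pochhammer (- of_nat N :: 'a::field_char_0) k = (- 1) ^ k * fact k * of_nat (N choose k)"
proof -
  have "of_nat (N choose k) = (- 1) ^ k * pochhammer (- of_nat N :: 'a) k / fact k"
    by (simp add: binomial_gbinomial gbinomial_pochhammer)
  then have "(- 1) ^ k * fact k * of_nat (N choose k)
    = ((- 1) ^ k * (- 1) ^ k) * pochhammer (- of_nat N :: 'a) k"
    by simp
  then show ?thesis by (simp flip: power_mult_distrib)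
qed

text \<open>At \<open>x = - N\<close> the Pochhammer symbols make the series a finite binomial
  transform of the Mahler coefficients. Inverting it returns the single value
  \<open>(-1)^N / unit_fact (Suc (a + p N))\<close>, which is a gamma value.\<close>

lemma dwork_sum_minus_of_nat:
  assumes "odd CARD('p)" "a < CARD('p)"
  shows "val_ge ((\<Sum>k<K. of_nat CARD('p) ^ k * pochhammer (- of_nat N) k * dwork_coeff CARD('p) (a + CARD('p) * k))
     - to_padic (morita_Gamma (- of_nat (a + CARD('p) * N)) :: 'p::prime_card padic_int))
     (real (CARD('p) - 1) * (real K / real CARD('p)))"
proof -
  let ?p = "CARD('p)"
  have p1: "?p > 1" using nontriv[where 'a='p] .
  define t
    where "t = (\<lambda>k. of_nat ?p ^ k * pochhammer (- of_nat N) k * dwork_coeff ?p (a + ?p * k) :: 'p padic)"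
  have t: "t k = of_nat (N choose k) * ((- 1) ^ k * mahler_coeff a k)" for k
    unfolding t_def pochhammer_minus_of_nat dwork_coeff_eq_mahler[OF assms(2), symmetric]
    by (simp add: mult_ac)
  \<comment> \<open>Terms beyond \<open>N\<close> vanish, and \<open>K + Suc N\<close> exceeds both
    \<open>N\<close> and the truncation point \<open>K\<close>.\<close>
  have "(\<Sum>k<K + Suc N. t k) = (\<Sum>k\<le>N. t k)"
    by (rule sum.mono_neutral_right) (auto simp: t)
  also have "\<dots> = (- 1) ^ N * (1 / to_padic (unit_fact (Suc (a + ?p * N))))"
    unfolding t mahler_coeff_def by (rule binomial_inversion_alternating)
  also have "\<dots> = to_padic (morita_Gamma (- of_nat (a + ?p * N)))"
  proof -
    have "(a + ?p * N) div ?p = N" using assms(2) p1 by simp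
    then have "morita_Gamma (- of_nat (a + ?p * N)) * unit_fact (Suc (a + ?p * N))
      = (- 1 :: 'p padic_int) ^ N"
      using morita_Gamma_minus_of_nat[OF assms(1), of "a + ?p * N"] by simp
    then have "to_padic (unit_fact (Suc (a + ?p * N))) * to_padic (morita_Gamma (- of_nat (a + ?p * N)))
        = (- 1 :: 'p padic) ^ N"
      unfolding to_padic_mult[symmetric] mult.commute[of "unit_fact _"]
      by (simp only: to_padic_simps)
    from eq_inverse_mult[OF to_padic_unit_fact_neq_0 this] show ?thesis by (simp only: mult.commute)
  qed
  finally have full: "(\<Sum>k<K + Suc N. t k) = \<dots>" .
  have "(\<Sum>k<K. t k) - (\<Sum>k<K + Suc N. t k) = - (\<Sum>k\<in>{K..<K + Suc N}. t k)"
  proof -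
    have "(\<Sum>k<K. t k) + (\<Sum>k\<in>{K..<K + Suc N}. t k) = (\<Sum>k<K + Suc N. t k)"
      using sum.atLeastLessThan_concat[OF le0 le_add1, of t K "Suc N"] unfolding atLeast0LessThan .
    then show ?thesis by (simp only: eq_diff_eq diff_add_eq flip: \<open>_ = (\<Sum>k<K + Suc N. t k)\<close>) simp
  qed
  moreover have tk:
    "val_ge (t k) (real (?p - 1) * (real K / real ?p))" if "k \<in> {K..<K + Suc N}" for k
  proof -
    have "t k = to_padic (of_nat (N choose k) * (- 1) ^ k) * mahler_coeff a k"
      unfolding t to_padic_simps by (simp only: mult.assoc)
    then have "val_ge (t k) (real (?p - 1) * (real k / real ?p))"
      using val_ge_mult_to_padic[OF val_ge_mahler_coeff[OF assms]] by metis
    moreover have "real (?p - 1) * (real K / real ?p) \<le> real (?p - 1) * (real k / real ?p)"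
      using that by (intro mult_left_mono divide_right_mono) auto
    ultimately show ?thesis by (rule val_ge_mono)
  qed
  have "val_ge (- (\<Sum>k\<in>{K..<K + Suc N}. t k)) (real (?p - 1) * (real K / real ?p))"
    by (rule val_ge_minus[OF val_ge_sum[OF tk]])
  ultimately show ?thesis
    unfolding full[symmetric] t_def[symmetric] by (simp only:)
qed

text \<open>The Mahler expansion of \<open>Gamma_p (p x - a)\<close>, carried from negative integers
  to all \<open>x\<close> by density.\<close>

lemma dwork_sum_approx:
  fixes x :: "'p::prime_card padic_int"
  assumes "odd CARD('p)" "a < CARD('p)"
  shows "val_ge ((\<Sum>k<K. of_nat CARD('p) ^ k * pochhammer (to_padic x) k * dwork_coeff CARD('p) (a + CARD('p) * k))
     - to_padic (morita_Gamma (pp * x - of_nat a)))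
     (real (CARD('p) - 1) * (real K / real CARD('p)))"
proof -
  let ?p = "CARD('p)"
  let ?r = "real (?p - 1) * (real K / real ?p)"
  have p1: "?p > 1" using nontriv[where 'a='p] .
  \<comment> \<open>Dwork coefficients of index up to \<open>a + p K\<close> may have scaled
    valuation as low as \<open>- (a + p K)\<close>; this modulus absorbs the loss and leaves
    \<open>K\<close>.\<close>
  define M where "M = K + a + ?p * K"
  obtain N where "pcong M (- x) (of_nat N)" using nat_approx by blast
  from pcong_minus[OF this] have N: "pcong M x (- of_nat N)" by simp
  have "real (?p - 1) * (real K / real ?p) = real K * (real (?p - 1) / real ?p)" by simp
  also have "\<dots> \<le> real K * 1" using p1 by (intro mult_left_mono) auto
  finally have rK: "?r \<le> real K" by simp
  have rM: "?r \<le> real (?p - 1) * real M"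
  proof -
    have "real K \<le> real M" by (simp add: M_def)
    also have "\<dots> \<le> real (?p - 1) * real M"
      using p1 mult_right_mono[of 1 "real (?p - 1)" "real M"] by simp
    finally show ?thesis using rK by simp
  qed
  have "pcong M (pp * x - of_nat a) (- of_nat (a + ?p * N))"
    using pcong_diff[OF pcong_mult[OF pcong_refl[of M pp] N] pcong_refl[of M "of_nat a"]]
    by (simp only: mult_minus_right of_nat_add of_nat_mult minus_add_distrib) (simp only: diff_conv_add_uminus add.commute)
  then have "pcong M (morita_Gamma (pp * x - of_nat a)) (morita_Gamma (- of_nat (a + ?p * N)))"
    by (rule pcong_morita_Gamma[OF assms(1)])
  then have "val_ge (to_padic (morita_Gamma (pp * x - of_nat a) - morita_Gamma (- of_nat (a + ?p * N))))
      (real (?p - 1) * real M)"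
    unfolding val_ge_to_padic_iff pcong_def .
  then have g: "val_ge (to_padic (morita_Gamma (pp * x - of_nat a))
      - to_padic (morita_Gamma (- of_nat (a + ?p * N)))) ?r"
    unfolding to_padic_diff using rM by (rule val_ge_mono)
  let ?t = "\<lambda>y k. of_nat ?p ^ k * pochhammer y k * dwork_coeff ?p (a + ?p * k) :: 'p padic"
  have d: "val_ge (?t (to_padic x) k - ?t (- of_nat N) k) ?r" if "k < K" for k
  proof -
    have "pcong M (pochhammer x k) (pochhammer (- of_nat N) k)"
      unfolding pochhammer_prod by (intro pcong_prod pcong_add pcong_refl N)
    then have v:
      "val_ge (to_padic (pochhammer x k - pochhammer (- of_nat N) k)) (real (?p - 1) * real M)"
      unfolding val_ge_to_padic_iff pcong_def .
    have e: "?t (to_padic x) k - ?t (- of_nat N) k = to_padic (pp ^ k)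
        * (to_padic (pochhammer x k - pochhammer (- of_nat N) k) * dwork_coeff ?p (a + ?p * k))"
      unfolding to_padic_simps by (simp only: algebra_simps)
    have "val_ge (?t (to_padic x) k - ?t (- of_nat N) k)
        (real (?p - 1) * real M + (dwork_slope TYPE('p) - 1) * real (a + ?p * k))"
      unfolding e by (intro val_ge_mult_to_padic val_ge_mult v val_ge_dwork_coeff assms)
    moreover have "?r \<le> real (?p - 1) * real M + (dwork_slope TYPE('p) - 1) * real (a + ?p * k)"
    proof -
      have "real M \<le> real (?p - 1) * real M"
        using p1 mult_right_mono[of 1 "real (?p - 1)" "real M"] by simp
      moreover have "0 \<le> dwork_slope TYPE('p) * real (a + ?p * k)" by simp
      moreover have "real (a + ?p * k) \<le> real a + real ?p * real K" using that by simp
      moreover have "real M = real K + real a + real ?p * real K" by (simp add: M_def)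
      ultimately show ?thesis using rK unfolding left_diff_distrib mult_1 by linarith
    qed
    ultimately show ?thesis by (rule val_ge_mono)
  qed
  have "(\<Sum>k<K. ?t (to_padic x) k) - to_padic (morita_Gamma (pp * x - of_nat a))
      = (\<Sum>k<K. ?t (to_padic x) k - ?t (- of_nat N) k)
        + ((\<Sum>k<K. ?t (- of_nat N) k) - to_padic (morita_Gamma (- of_nat (a + ?p * N))))
        - (to_padic (morita_Gamma (pp * x - of_nat a)) - to_padic (morita_Gamma (- of_nat (a + ?p * N))))"
    unfolding sum_subtractf by simp
  then show ?thesis
    using val_ge_diff[OF val_ge_add[OF val_ge_sum[of "{..<K}", OF d] dwork_sum_minus_of_nat[OF assms, where K=K and N=N]] g]
    by (simp only: lessThan_iff)
qed

text \<open>With \<open>pi^(p-1) = - p\<close> this is \<open>c_n pi^n\<close> for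
  \<open>n = a + (p - 1) j\<close>, divided by \<open>pi^a\<close>; the division keeps it in the
  base field.\<close>

definition dwork_term :: "nat \<Rightarrow> nat \<Rightarrow> 'p::prime_card padic" where
  "dwork_term a j = (- of_nat CARD('p)) ^ j * dwork_coeff CARD('p) (a + (CARD('p) - 1) * j)"

lemma val_ge_dwork_term:
  assumes "odd CARD('p)"
  shows "val_ge (dwork_term a j :: 'p::prime_card padic)
    (dwork_slope TYPE('p) * (real (CARD('p) - 1) * real j) - real a)"
proof -
  let ?p = "CARD('p)"
  have e: "(dwork_term a j :: 'p padic)
      = to_padic ((- 1) ^ j) * (of_nat ?p ^ j * dwork_coeff ?p (a + (?p - 1) * j))"
    unfolding dwork_term_def to_padic_simps by (simp only: power_minus[of "of_nat ?p"] mult.assoc)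
  have "val_ge (dwork_term a j :: 'p padic)
      (real (?p - 1) * real j + (dwork_slope TYPE('p) - 1) * real (a + (?p - 1) * j))"
    unfolding e by (intro val_ge_mult_to_padic val_ge_mult val_ge_power val_ge_dwork_coeff assms)
  moreover have "dwork_slope TYPE('p) * (real (?p - 1) * real j) - real a
      \<le> real (?p - 1) * real j + (dwork_slope TYPE('p) - 1) * real (a + (?p - 1) * j)"
  proof -
    have "0 \<le> dwork_slope TYPE('p) * real a" by simp
    then show ?thesis unfolding of_nat_add of_nat_mult left_diff_distrib distrib_left mult_1
      by linarith
  qed
  ultimately show ?thesis by (rule val_ge_mono)
qed

text \<open>Arithmetic for the next bound: \<open>P\<close> stands for \<open>p\<close>,
  \<open>K\<close> for \<open>p^D\<close>, and \<open>a + P (K - 1) - j\<close> for the index of the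
  Dwork coefficient.\<close>

lemma dwork_error_exponent:
  fixes P K j a D \<sigma> :: real
  assumes "a \<le> P - 1" "0 \<le> a" "j \<le> K - 1" "0 \<le> \<sigma>"
  shows "\<sigma> * (P - 1) * (K - 1) - (P - 1) * D
    \<le> (P - 1) * K + (0 + (0 + ((K - 1 - j) - (P - 1) * D)) + (\<sigma> - 1) * (a + P * (K - 1) - j))"
proof -
  have "(P - 1) * (K - 1) \<le> a + P * (K - 1) - j" using assms by (simp add: algebra_simps)
  then have "\<sigma> * ((P - 1) * (K - 1)) \<le> \<sigma> * (a + P * (K - 1) - j)"
    using assms(4) by (rule mult_left_mono)
  then show ?thesis using assms(1) by (simp add: algebra_simps)
qed

text \<open>The factor \<open>p^K\<close> alone does not outweigh the denominators of coefficients
  of index near \<open>p K\<close>. The Pochhammer symbol supplies the valuation of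
  \<open>k!\<close> for \<open>k = K - 1 - j\<close>, and with \<open>K = p^D\<close> Legendre's
  estimate loses only \<open>(p - 1) D\<close>, which is logarithmic in \<open>K\<close>.\<close>

lemma dwork_error_bound:
  fixes b :: "'p::prime_card padic_int"
  assumes "odd CARD('p)" "a < CARD('p)"
  shows "val_ge (of_nat CARD('p) ^ (CARD('p) ^ D) * (\<Sum>j<CARD('p) ^ D. (- 1) ^ j
      * pochhammer (to_padic b + of_nat (Suc j)) (CARD('p) ^ D - Suc j)
      * dwork_coeff CARD('p) (a + (CARD('p) - 1) * j + CARD('p) * (CARD('p) ^ D - Suc j))))
    (dwork_slope TYPE('p) * real (CARD('p) - 1) * (real CARD('p) ^ D - 1) - real (CARD('p) - 1) * real D)"
    (is "val_ge _ ?r")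
proof -
  let ?p = "CARD('p)" and ?K = "CARD('p) ^ D"
  have p1: "?p > 1" using nontriv[where 'a='p] .
  have K0: "?K > 0" using p1 by simp
  define \<sigma> where "\<sigma> = dwork_slope TYPE('p)"
  have \<sigma>: "\<sigma> \<ge> 0" by (simp add: \<sigma>_def)
  have "val_ge (of_nat ?p ^ ?K * ((- 1) ^ j
      * pochhammer (to_padic b + of_nat (Suc j)) (?K - Suc j)
      * dwork_coeff ?p (a + (?p - 1) * j + ?p * (?K - Suc j)))) ?r" if j: "j < ?K" for j
  proof -
    let ?k = "?K - Suc j" and ?n = "a + (?p - 1) * j + ?p * (?K - Suc j)"
    let ?y = "to_padic b + of_nat (Suc j)"
    have kD: "?k < ?p ^ D" using K0 by simp
    have y: "?y = to_padic (b + of_nat (Suc j))" by (simp only: to_padic_simps)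
    have po: "val_ge (pochhammer ?y ?k) (0 + (real ?k - real (?p - 1) * real D))"
      using val_ge_mult[OF val_ge_pochhammer_div_fact[of "b
        + of_nat (Suc j)" ?k] val_ge_fact[OF kD]]
      unfolding y by simp
    have m: "val_ge ((- 1) ^ j :: 'p padic) 0"
      using val_ge_to_padic[of "(- 1) ^ j :: 'p padic_int"] unfolding to_padic_simps .
    have "val_ge (of_nat ?p ^ ?K * ((- 1) ^ j * pochhammer ?y ?k * dwork_coeff ?p ?n))
      (real (?p - 1) * real ?K + (0 + (0 + (real ?k - real (?p - 1) * real D)) + (\<sigma> - 1) * real ?n))"
      unfolding \<sigma>_def by (intro val_ge_mult val_ge_power m po val_ge_dwork_coeff assms(1))
    moreover have "?r \<le> real (?p - 1) * real ?K
        + (0 + (0 + (real ?k - real (?p - 1) * real D)) + (\<sigma> - 1) * real ?n)"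
    proof -
      have k: "real ?k = real ?K - 1 - real j" using j by (simp add: of_nat_diff Suc_leI)
      have P: "real (?p - 1) = real ?p - 1" using p1 by (simp add: of_nat_diff)
      have n: "real ?n = real a + real ?p * (real ?K - 1) - real j"
        unfolding of_nat_add of_nat_mult k P by (simp add: algebra_simps)
      have "real (Suc a) \<le> real ?p" using assms(2) by (simp only: of_nat_le_iff Suc_le_eq)
      then have a: "real a \<le> real ?p - 1" by simp
      have rr: "?r = \<sigma> * real (?p - 1) * (real ?p ^ D - 1) - real (?p - 1) * real D"
        by (simp only: \<sigma>_def)
      have j': "real j \<le> real ?K - 1" using k by linarith
      show ?thesis
        using dwork_error_exponent[OF a of_nat_0_le_iff j' \<sigma>, of "real D"]
        unfolding rr unfolding k n P unfolding of_nat_power .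
    qed
    ultimately show ?thesis by (rule val_ge_mono)
  qed
  then show ?thesis unfolding sum_distrib_left by (intro val_ge_sum) simp
qed

lemma eventually_exp_minus_linear_ge:
  fixes c d q r :: real
  assumes "c > 0" "q > 1"
  shows "eventually (\<lambda>D. r \<le> c * (q ^ D - 1) - d * real D) sequentially"
proof -
  have "filterlim (\<lambda>D::nat. c * (q ^ D - 1) - d * real D) at_top sequentially"
    using assms by real_asymp
  then show ?thesis by (simp add: filterlim_at_top)
qed

theorem dwork_sum_limit:
  fixes b :: "'p::prime_card padic_int"
  assumes "odd CARD('p)" "a < CARD('p)" and b: "(pp - 1) * b = of_nat a"
  shows "eventually (\<lambda>K. val_ge ((1 - of_nat CARD('p)) * (\<Sum>j<K. dwork_term a j)
    - to_padic (morita_Gamma b)) r) sequentially"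
proof -
  let ?p = "CARD('p)"
  have p1: "?p > 1" using nontriv[where 'a='p] .
  define \<sigma> where "\<sigma> = dwork_slope TYPE('p)"
  have \<sigma>: "\<sigma> > 0" using card_minus_1_pos[where 'p='p] by (simp add: \<sigma>_def)
  let ?B = "\<lambda>D. \<sigma> * real (?p - 1) * (real ?p ^ D - 1) - real (?p - 1) * real D"
  \<comment> \<open>\<open>b = a / (p - 1)\<close> is fixed by \<open>x \<mapsto> p x - a\<close>,
    so the gamma value approximated is the one at \<open>b\<close> itself.\<close>
  have pb: "pp * b - of_nat a = b" using b by (simp add: algebra_simps flip: b)
  have bb: "(of_nat ?p - 1) * to_padic b = of_nat a"
    using arg_cong[OF b, of to_padic] unfolding to_padic_simps .
  have 1:
    "val_ge ((1 - of_nat ?p) * (\<Sum>j<?p ^ D. dwork_term a j) - to_padic (morita_Gamma b)) (?B D)" for D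
  proof -
    let ?K = "?p ^ D"
    let ?W = "\<Sum>k<?K. of_nat ?p ^ k * pochhammer (to_padic b) k * dwork_coeff ?p (a + ?p * k)"
    have "val_ge (?W - to_padic (morita_Gamma b)) (real (?p - 1) * (real ?K / real ?p))"
      using dwork_sum_approx[OF assms(1,2), where K="?K" and x=b] unfolding pb .
    moreover have "?B D \<le> real (?p - 1) * (real ?K / real ?p)"
    proof -
      have "\<sigma> * real (?p - 1) * (real ?p ^ D - 1) \<le> \<sigma> * real ?p * real ?p ^ D"
        using \<sigma> p1 by (intro mult_mono mult_left_mono) auto
      also have "\<dots> = real (?p - 1) * (real ?K / real ?p)"
        by (simp add: \<sigma>_def power2_eq_square)
      finally show ?thesis using mult_nonneg_nonneg[of "real (?p - 1)" "real D"] by linarith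
    qed
    ultimately have w: "val_ge (?W - to_padic (morita_Gamma b)) (?B D)" by (rule val_ge_mono)
    have p0: "?p > 0" using p1 by simp
    have tr: "?W = (1 - of_nat ?p) * (\<Sum>j<?K. dwork_term a j) + of_nat ?p ^ ?K * (\<Sum>j<?K. (- 1) ^ j
      * pochhammer (to_padic b + of_nat (Suc j)) (?K - Suc j)
      * dwork_coeff ?p (a + (?p - 1) * j + ?p * (?K - Suc j)))"
      using dwork_trace_identity[OF p0 bb, of ?K] unfolding dwork_term_def .
    have "x = y + e \<Longrightarrow> y - g = (x - g) - e" for x y e g :: "'p padic" by simp
    from this[OF tr] show ?thesis
      using val_ge_diff[OF w dwork_error_bound[OF assms(1,2), where D=D and b=b, folded \<sigma>_def]]
      by (simp only:)
  qed
  \<comment> \<open>The summand \<open>a\<close> pays for the loss in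
    \<open>val_ge_dwork_term\<close> when the sum is extended from \<open>p^D\<close> to larger
    \<open>K\<close>.\<close>
  have "eventually (\<lambda>D. max r 0 + real a \<le> ?B D) sequentially"
    using \<sigma> p1 by (intro eventually_exp_minus_linear_ge) auto
  then obtain D where D: "max r 0 + real a \<le> ?B D" by (auto simp: eventually_sequentially)
  have D0: "r \<le> ?B D" using D by simp
  have "val_ge ((1 - of_nat ?p) * (\<Sum>j<K. dwork_term a j) - to_padic (morita_Gamma b)) r"
    if K: "K \<ge> ?p ^ D" for K
  proof -
    have s: "(\<Sum>j<K. dwork_term a j) = (\<Sum>j<?p ^ D. dwork_term a j)
        + (\<Sum>j\<in>{?p ^ D..<K}. dwork_term a j :: 'p padic)"
      using sum.atLeastLessThan_concat[OF le0 K, of "dwork_term a", symmetric]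
        unfolding atLeast0LessThan .
    have "val_ge (dwork_term a j :: 'p padic) r" if "j \<in> {?p ^ D..<K}" for j
    proof (rule val_ge_mono[OF val_ge_dwork_term[OF assms(1)]])
      have "real (?p ^ D) \<le> real j" using that by (simp only: of_nat_le_iff atLeastLessThan_iff)
      then have le: "real ?p ^ D - 1 \<le> real j" unfolding of_nat_power by linarith
      have "\<sigma> * (real (?p - 1) * (real ?p ^ D - 1)) \<le> \<sigma> * (real (?p - 1) * real j)"
        using \<sigma> by (intro mult_left_mono le) auto
      then have "?B D \<le> \<sigma> * (real (?p - 1) * real j)"
        using mult_nonneg_nonneg[of "real (?p - 1)" "real D"] unfolding mult.assoc[symmetric]
          by linarith
      then show "r \<le> dwork_slope TYPE('p) * (real (?p - 1) * real j) - real a"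
        using D unfolding \<sigma>_def by linarith
    qed
    then have "val_ge (to_padic (1 - pp) * (\<Sum>j\<in>{?p ^ D..<K}. dwork_term a j :: 'p padic)) r"
      by (intro val_ge_mult_to_padic val_ge_sum)
    moreover have "w * (x + y) - z = (w * x - z) + w * y" for w x y z :: "'p padic"
      by (simp add: algebra_simps)
    ultimately show ?thesis
      using val_ge_add[OF val_ge_mono[OF 1 D0]] unfolding s to_padic_simps by (simp only:)
  qed
  then show ?thesis by (auto simp: eventually_sequentially)
qed

section \<open>Dwork's additive character\<close>

abbreviation teich_padic :: "'p::prime_card mod_ring \<Rightarrow> 'p padic" where
  "teich_padic u \<equiv> to_padic (teichmuller u)"

definition dwork_exp :: "'p::prime_card mod_ring \<Rightarrow> 'p padic fps" where
  "dwork_exp u = exp_pow CARD('p) (teich_padic u) (teich_padic u / of_nat CARD('p))"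

lemma card_pos: "CARD('p::prime_card) > 0"
  by simp

lemma dwork_exp_nth:
  "fps_nth (dwork_exp u) n = dwork_coeff CARD('p) n * teich_padic (u :: 'p::prime_card mod_ring) ^ n"
  unfolding dwork_exp_def
  by (rule exp_pow_nth_root) (simp_all only: card_pos to_padic_power[symmetric] teich_pow_card)

text \<open>Its nonzero roots are the \<open>pi\<close> with \<open>pi^(p-1) = - p\<close>. The
  factor \<open>fps_const 1\<close> matches the shape in \<open>exp_pow_eq_compose\<close>.\<close>

definition frobenius_poly :: "'p::prime_card padic fps" where
  "frobenius_poly = fps_const (of_nat CARD('p)) * fps_X + fps_const 1 * fps_X ^ CARD('p)"

lemma frobenius_poly_mult_nth:
  "fps_nth (frobenius_poly * h) n = (if n = 0 then 0 else of_nat CARD('p) * fps_nth h (n - 1))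
     + (if n < CARD('p) then 0 else fps_nth (h :: 'p::prime_card padic fps) (n - CARD('p)))"
  by (simp add: frobenius_poly_def distrib_right mult.assoc fps_X_power_mult_nth)

text \<open>If X is given scaled valuation 1, both \<open>p X\<close> and \<open>X^p\<close> have
  weight \<open>p\<close>.\<close>

lemma frobenius_poly_power:
  "val_ge (fps_nth (frobenius_poly ^ k) n :: 'p::prime_card padic) (real CARD('p) * real k - real n)"
  "n > CARD('p) * k \<Longrightarrow> fps_nth (frobenius_poly ^ k :: 'p padic fps) n = 0"
proof (induction k arbitrary: n)
  case 0
  {
    case 1
    have "val_ge (1 :: 'p padic) 0" using val_ge_to_padic[of "1 :: 'p padic_int"]
      unfolding to_padic_1 .
    then show ?case by simp
  next
    case 2
    then show ?case by simp
  }
next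
  case (Suc k)
  let ?p = "CARD('p)"
  have p1: "?p > 1" using nontriv[where 'a='p] .
  {
    case 1
    have "val_ge (if n = 0 then 0 else of_nat ?p * fps_nth (frobenius_poly ^ k) (n - 1) :: 'p padic)
        (real ?p * real (Suc k) - real n)"
    proof (cases "n = 0")
      case False
      have "val_ge (of_nat ?p ^ 1 * fps_nth (frobenius_poly ^ k) (n - 1) :: 'p padic)
          (real (?p - 1) * real 1 + (real ?p * real k - real (n - 1)))"
        by (intro val_ge_mult val_ge_power Suc.IH)
      moreover have "real (?p - 1) * real 1 + (real ?p * real k - real (n - 1))
        = real ?p * real (Suc k) - real n"
        using False p1 by (simp add: of_nat_diff algebra_simps)
      ultimately have "val_ge (of_nat ?p ^ 1 * fps_nth (frobenius_poly ^ k) (n - 1) :: 'p padic)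
          (real ?p * real (Suc k) - real n)" by (simp only:)
      then show ?thesis using False by simp
    qed simp
    moreover have "val_ge (if n < ?p then 0 else fps_nth (frobenius_poly ^ k) (n - ?p) :: 'p padic)
        (real ?p * real (Suc k) - real n)"
    proof (cases "n < ?p")
      case False
      have e: "real ?p * real k - real (n - ?p) = real ?p * real (Suc k) - real n"
        using False by (simp add: of_nat_diff algebra_simps)
      show ?thesis using False Suc.IH(1)[of "n - ?p"] unfolding e by (simp only: if_False)
    qed simp
    ultimately show ?case unfolding power_Suc frobenius_poly_mult_nth by (rule val_ge_add)
  next
    case 2
    then have "n - 1 > ?p * k" "n - ?p > ?p * k" using p1 by (simp_all add: algebra_simps)
    then show ?case unfolding power_Suc frobenius_poly_mult_nth by (simp add: Suc.IH(2))
  }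
qed

lemma frobenius_poly_nth_0 [simp]: "fps_nth frobenius_poly 0 = 0"
  by (simp add: frobenius_poly_def)

lemma dwork_slope_le:
  "dwork_slope TYPE('p::prime_card) * real n \<le> real (CARD('p) - 1) * (real n / real CARD('p))"
proof -
  have "real CARD('p) ^ 2 \<ge> real CARD('p) * 1"
    unfolding power2_eq_square using nontriv[where 'a='p] by (intro mult_left_mono) auto
  then have "real (CARD('p) - 1) * real n / real CARD('p) ^ 2
    \<le> real (CARD('p) - 1) * real n / real CARD('p)"
    by (intro divide_left_mono) auto
  then show ?thesis by simp
qed

text \<open>At a root of \<open>p X + X\<^sup>p\<close> the series \<open>dwork_exp\<close> is an additive character of the residue
  field; the lemma expresses this without leaving the power series ring.\<close>

lemma dwork_exp_mult:
  assumes "odd CARD('p)"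
  obtains h
    where "dwork_exp u * dwork_exp v = dwork_exp (u + v :: 'p::prime_card mod_ring)
    + frobenius_poly * h"
    "\<And>n. val_ge (fps_nth h n) ((dwork_slope TYPE('p) - 1) * real n - 1)"
proof -
  let ?p = "CARD('p)" and ?P = "of_nat CARD('p) :: 'p padic"
  define \<sigma> where "\<sigma> = dwork_slope TYPE('p)"
  have p0: "?p > 0" by simp
  have "pcong 1 (teichmuller u + teichmuller v) (lift_mod u + lift_mod v)"
    by (intro pcong_add teich_cong)
  moreover have "pcong 1 (lift_mod (u + v)) (of_int (to_int_mod_ring u + to_int_mod_ring v))"
    by (rule pcong_lift_mod) simp
  ultimately have "pcong 1 (teichmuller u + teichmuller v) (teichmuller (u + v))"
    using pcong_trans[OF teich_cong[of "u + v"]] pcong_sym pcong_trans by (metis of_int_add)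
  \<comment> \<open>The Teichmueller lift is additive only modulo \<open>p\<close>; the defect
    \<open>p z\<close> contributes the factor exp(z (p X + X^p)).\<close>
  then obtain z where "teichmuller u + teichmuller v - teichmuller (u + v) = pp * z"
    unfolding pcong_def power_one_right by (elim dvdE)
  then have "teichmuller u + teichmuller v = teichmuller (u + v) + z * pp"
    by (simp add: algebra_simps)
  from arg_cong[OF this, of to_padic]
  have uv: "teich_padic u + teich_padic v = teich_padic (u + v) + to_padic z * ?P"
    unfolding to_padic_simps .
  then have uvp:
    "teich_padic u / ?P + teich_padic v / ?P = teich_padic (u + v) / ?P + to_padic z * 1"
    by (simp only: add_divide_distrib[symmetric]) (simp add: add_divide_distrib del: mult_fract divide_fract add_fract)
  have "dwork_exp u * dwork_exp v
    = exp_pow ?p (teich_padic u + teich_padic v) (teich_padic u / ?P + teich_padic v / ?P)"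
    unfolding dwork_exp_def exp_pow_add[OF p0] ..
  also have "\<dots> = dwork_exp (u + v) * exp_pow ?p (to_padic z * ?P) (to_padic z * 1)"
    unfolding uv uvp dwork_exp_def exp_pow_add[OF p0] ..
  also have "exp_pow ?p (to_padic z * ?P) (to_padic z * 1) = fps_exp (to_padic z) oo frobenius_poly"
    unfolding frobenius_poly_def by (rule exp_pow_eq_compose[OF p0])
  finally have e1:
    "dwork_exp u * dwork_exp v = dwork_exp (u + v) * (fps_exp (to_padic z) oo frobenius_poly)" .
  \<comment> \<open>This is (exp(z X) - 1) / X, so composing it with \<open>frobenius_poly\<close>
    exhibits the defect factor as 1 plus a multiple of \<open>frobenius_poly\<close>.\<close>
  define G where "G = Abs_fps (\<lambda>k. to_padic z ^ Suc k / fact (Suc k))"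
  have G: "fps_exp (to_padic z) = 1 + fps_X * G"
    by (rule fps_ext) (auto simp: G_def fps_X_mult_nth gr0_conv_Suc simp del: fact_Suc power_Suc)
  have e2: "fps_exp (to_padic z) oo frobenius_poly = 1 + frobenius_poly * (G oo frobenius_poly)"
    unfolding G by (simp add: fps_compose_add_distrib fps_compose_mult_distrib)
  have g: "val_ge (fps_nth (G oo frobenius_poly) n) ((\<sigma> - 1) * real n - 1)" for n
    unfolding fps_compose_nth
  proof (rule val_ge_sum)
    fix k
    show "val_ge (fps_nth G k * fps_nth (frobenius_poly ^ k) n) ((\<sigma> - 1) * real n - 1)"
    proof (cases "n > ?p * k")
      case True
      then show ?thesis by (simp add: frobenius_poly_power(2))
    next
      case False
      have "fps_nth G k = to_padic (z ^ Suc k) * (1 / fact (Suc k))"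
        unfolding G_def fps_nth_Abs_fps to_padic_power by simp
      then have "val_ge (fps_nth G k) (- real (Suc k))"
        using val_ge_mult_to_padic[OF val_ge_inverse_fact] by metis
      then have "val_ge (fps_nth G k * fps_nth (frobenius_poly ^ k) n)
          (- real (Suc k) + (real ?p * real k - real n))"
        by (intro val_ge_mult frobenius_poly_power(1))
      moreover have "(\<sigma> - 1) * real n - 1 \<le> - real (Suc k) + (real ?p * real k - real n)"
      proof -
        have "real n \<le> real (?p * k)" using False by (simp only: of_nat_le_iff)
        then have "real n / real ?p \<le> real k" using p0 by (simp add: field_simps)
        then have "real (?p - 1) * (real n / real ?p) \<le> real (?p - 1) * real k"
          by (intro mult_left_mono) auto
        also have "\<dots> = real ?p * real k - real k" using p0 by (simp add: of_nat_diff algebra_simps)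
        finally have "\<sigma> * real n \<le> real ?p * real k - real k"
          using dwork_slope_le[of n, where 'p='p] unfolding \<sigma>_def by linarith
        then show ?thesis by (simp add: algebra_simps)
      qed
      ultimately show ?thesis by (rule val_ge_mono)
    qed
  qed
  show ?thesis
  proof
    show "dwork_exp u * dwork_exp v
        = dwork_exp (u + v) + frobenius_poly * (dwork_exp (u + v) * (G oo frobenius_poly))"
      unfolding e1 e2 by (simp add: algebra_simps)
    fix n
    show "val_ge (fps_nth (dwork_exp (u + v) * (G oo frobenius_poly)) n) ((dwork_slope TYPE('p) - 1) * real n - 1)"
      unfolding fps_mult_nth \<sigma>_def[symmetric]
    proof (rule val_ge_sum)
      fix i assume "i \<in> {0..n}"
      then have i: "real n = real i + real (n - i)" by simp
      have "fps_nth (dwork_exp (u + v)) i * fps_nth (G oo frobenius_poly) (n - i)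
        = to_padic (teichmuller (u + v) ^ i) * (dwork_coeff ?p i * fps_nth (G oo frobenius_poly) (n - i))"
        unfolding dwork_exp_nth to_padic_power by (simp only: mult_ac)
      moreover have "val_ge \<dots> ((\<sigma> - 1) * real i + ((\<sigma> - 1) * real (n - i) - 1))"
        unfolding \<sigma>_def
          by (intro val_ge_mult_to_padic val_ge_mult val_ge_dwork_coeff assms g[unfolded \<sigma>_def])
      moreover have "(\<sigma> - 1) * real i + ((\<sigma> - 1) * real (n - i) - 1) = (\<sigma> - 1) * real n - 1"
        unfolding i by (simp add: algebra_simps)
      ultimately show "val_ge (fps_nth (dwork_exp (u + v)) i * fps_nth (G oo frobenius_poly) (n - i))
          ((\<sigma> - 1) * real n - 1)" by metis
    qed
  qed
qed

text \<open>The contribution to f(pi) of the exponents congruent to \<open>c\<close> modulo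
  \<open>p - 1\<close>, divided by \<open>pi^c\<close> and truncated after \<open>K\<close>
  terms.\<close>

definition class_sum :: "nat \<Rightarrow> nat \<Rightarrow> 'p::prime_card padic fps \<Rightarrow> 'p padic" where
  "class_sum c K f = (\<Sum>l<K. (- of_nat CARD('p)) ^ l * fps_nth f (c + (CARD('p) - 1) * l))"

text \<open>\<open>p X + X^p\<close> vanishes at \<open>pi\<close>: the \<open>X^p\<close> part of
  each term cancels the \<open>p X\<close> part of the preceding one, and only the boundary term of
  the truncation remains. The range of \<open>c\<close> leaves nothing over at the lower
  end.\<close>

lemma class_sum_frobenius_poly:
  assumes "0 < c" "c < CARD('p)"
  shows "class_sum c (Suc K) (frobenius_poly * (h :: 'p::prime_card padic fps))
    = of_nat CARD('p) * (- of_nat CARD('p)) ^ K * fps_nth h (c - 1 + (CARD('p) - 1) * K)"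
proof (induction K)
  case 0
  then show ?case using assms by (simp add: class_sum_def frobenius_poly_mult_nth)
next
  case (Suc K)
  let ?p = "CARD('p)" and ?P = "of_nat CARD('p) :: 'p padic"
  obtain q where q: "?p = Suc q" using assms by (cases ?p) auto
  let ?n = "c + (?p - 1) * Suc K"
  have n: "?n \<noteq> 0" "\<not> ?n < ?p" "?n - ?p = c - 1 + (?p - 1) * K" "?n - 1 = c - 1 + (?p - 1) * Suc K"
    using assms by (auto simp: q)
  have "class_sum c (Suc (Suc K)) (frobenius_poly * h)
      = class_sum c (Suc K) (frobenius_poly * h) + (- ?P) ^ Suc K * fps_nth (frobenius_poly * h) ?n"
    unfolding class_sum_def by simp
  also have "\<dots> = ?P * (- ?P) ^ K * fps_nth h (c - 1 + (?p - 1) * K)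
      + (- ?P) ^ Suc K * (?P * fps_nth h (c - 1 + (?p - 1) * Suc K) + fps_nth h (c - 1 + (?p - 1) * K))"
    unfolding Suc.IH frobenius_poly_mult_nth n(3,4) using n(1,2) by (simp only: if_False)
  also have "\<dots> = ?P * (- ?P) ^ Suc K * fps_nth h (c - 1 + (?p - 1) * Suc K)"
    unfolding power_Suc by (simp only: distrib_left) (simp add: mult_ac del: mult_Suc_right)
  finally show ?case .
qed

lemma teich_padic_power_class:
  assumes "0 < c"
  shows "teich_padic (w :: 'p::prime_card mod_ring) ^ (c + (CARD('p) - 1) * l) = teich_padic w ^ c"
proof (cases "w = 0")
  case True
  then show ?thesis using assms by (simp add: to_padic_0 zero_power)
next
  case False
  then have "teich_padic w ^ (CARD('p) - 1) = 1"
    by (simp only: to_padic_power[symmetric] teich_pow_card_minus_1[OF False] to_padic_1)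
  then show ?thesis by (simp only: power_add power_mult power_one mult_1_right)
qed

lemma class_sum_dwork_exp:
  assumes "0 < c"
  shows "class_sum c K (dwork_exp w)
    = teich_padic (w :: 'p::prime_card mod_ring) ^ c * (\<Sum>j<K. dwork_term c j)"
  unfolding class_sum_def dwork_exp_nth teich_padic_power_class[OF assms] dwork_term_def sum_distrib_left
  by (simp only: mult_ac)

text \<open>Additivity of Dwork's character at \<open>pi\<close>, one class at a time; the error is
  the boundary term from \<open>class_sum_frobenius_poly\<close>.\<close>

lemma class_sum_dwork_exp_mult:
  assumes "odd CARD('p)" "0 < c" "c < CARD('p)"
  shows "val_ge (class_sum c (Suc K) (dwork_exp u * dwork_exp v)
      - teich_padic (u + v :: 'p::prime_card mod_ring) ^ c * (\<Sum>j<Suc K. dwork_term c j))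
    (dwork_slope TYPE('p) * (real (CARD('p) - 1) * real K) - real CARD('p))"
proof -
  let ?p = "CARD('p)" and ?P = "of_nat CARD('p) :: 'p padic"
  have p1: "?p > 1" using nontriv[where 'a='p] .
  define \<sigma> where "\<sigma> = dwork_slope TYPE('p)"
  have \<sigma>: "\<sigma> \<ge> 0" by (simp add: \<sigma>_def)
  obtain h where h: "dwork_exp u * dwork_exp v = dwork_exp (u + v) + frobenius_poly * h"
    "\<And>n. val_ge (fps_nth h n) ((\<sigma> - 1) * real n - 1)"
    using dwork_exp_mult[OF assms(1), of u v] unfolding \<sigma>_def by blast
  let ?n = "c - 1 + (?p - 1) * K"
  have "class_sum c (Suc K) (dwork_exp u * dwork_exp v)
      = class_sum c (Suc K) (dwork_exp (u + v)) + class_sum c (Suc K) (frobenius_poly * h)"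
    unfolding h(1) class_sum_def by (simp only: fps_add_nth distrib_left sum.distrib)
  then have "class_sum c (Suc K) (dwork_exp u * dwork_exp v)
      - teich_padic (u + v) ^ c * (\<Sum>j<Suc K. dwork_term c j) = ?P * (- ?P) ^ K * fps_nth h ?n"
    unfolding class_sum_dwork_exp[OF assms(2)] class_sum_frobenius_poly[OF assms(2,3)] by simp
  also have "\<dots> = to_padic (pp * (- 1) ^ K) * (?P ^ K * fps_nth h ?n)"
    unfolding to_padic_simps power_minus[of ?P] by (simp only: mult_ac)
  finally have e: "class_sum c (Suc K) (dwork_exp u * dwork_exp v)
      - teich_padic (u + v) ^ c * (\<Sum>j<Suc K. dwork_term c j) = \<dots>" .
  have "val_ge (to_padic (pp * (- 1) ^ K) * (?P ^ K * fps_nth h ?n))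
      (real (?p - 1) * real K + ((\<sigma> - 1) * real ?n - 1))"
    by (intro val_ge_mult_to_padic val_ge_mult val_ge_power h)
  moreover have "\<sigma> * (real (?p - 1) * real K) - real ?p \<le> real (?p - 1) * real K
    + ((\<sigma> - 1) * real ?n - 1)"
  proof -
    have n: "real ?n = real (c - 1) + real (?p - 1) * real K" by simp
    have "0 \<le> \<sigma> * real (c - 1)" using \<sigma> by simp
    moreover have "real (c - 1) + 1 \<le> real ?p" using assms(2,3) by simp
    ultimately show ?thesis unfolding n left_diff_distrib distrib_left mult_1 by linarith
  qed
  ultimately show ?thesis unfolding e \<sigma>_def by (rule val_ge_mono)
qed

lemma sum_teich_padic_power:
  "(\<Sum>x\<in>UNIV - {0 :: 'p::prime_card mod_ring}. teich_padic x ^ a)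
    = (if (CARD('p) - 1) dvd a then of_nat (CARD('p) - 1) else 0)"
proof (cases "(CARD('p) - 1) dvd a")
  case True
  then obtain k where k: "a = (CARD('p) - 1) * k" by (elim dvdE)
  have "teich_padic x ^ a = 1" if "x \<in> UNIV - {0 :: 'p mod_ring}" for x
  proof -
    have "x \<noteq> 0" using that by simp
    then show ?thesis unfolding k
      by (simp only: to_padic_power[symmetric] power_mult teich_pow_card_minus_1[OF \<open>x \<noteq> 0\<close>] power_one to_padic_1)
  qed
  then have "(\<Sum>x\<in>UNIV - {0 :: 'p mod_ring}. teich_padic x ^ a) = (\<Sum>x\<in>UNIV - {0 :: 'p mod_ring}. 1)"
    by (rule sum.cong[OF refl])
  then show ?thesis using True
    by (simp only: sum_constant card_nonzero_mod_ring mult_1_right if_True)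
next
  case False
  then show ?thesis using sum_teich_power[OF False]
    by (simp only: to_padic_power[symmetric] to_padic_sum[symmetric] to_padic_0 if_False)
qed

lemma dvd_class:
  assumes "0 < a" "a < n" "n dvd (n - a) + i"
  obtains j :: nat where "i = a + n * j"
proof -
  obtain q where q: "(n - a) + i = n * q" using assms(3) by (elim dvdE)
  then obtain j where "q = Suc j" using assms(1,2) by (cases q) auto
  then show ?thesis using q assms(2) that[of j] by simp
qed

text \<open>The weights are the characters \<open>\<omega>^(-a)\<close> and
  \<open>\<omega>^(-b)\<close>; orthogonality keeps only index pairs in the classes of
  \<open>a\<close> and \<open>b\<close>. The carry \<open>e\<close> of \<open>a + b\<close> modulo
  \<open>p - 1\<close> shifts the resulting Cauchy product.\<close>

lemma sum_class_sum_dwork_exp: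
  assumes a: "0 < a" "a < CARD('p) - 1" and b: "0 < b" "b < CARD('p) - 1"
    and c: "a + b = c + (CARD('p) - 1) * e"
  shows "(\<Sum>u\<in>UNIV - {0 :: 'p::prime_card mod_ring}. \<Sum>v\<in>UNIV - {0}.
      teich_padic u ^ (CARD('p) - 1 - a) * teich_padic v ^ (CARD('p) - 1 - b)
        * class_sum c K (dwork_exp u * dwork_exp v))
    = of_nat (CARD('p) - 1) ^ 2 * (- of_nat CARD('p)) ^ e
      * (\<Sum>l<K. \<Sum>i | i + e \<le> l. dwork_term a i * dwork_term b (l - e - i))"
proof -
  let ?p = "CARD('p)" and ?P = "of_nat CARD('p) :: 'p padic" and ?U = "UNIV - {0 :: 'p mod_ring}"
  let ?n = "\<lambda>l. c + (?p - 1) * l"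
  define cc where "cc = (dwork_coeff ?p :: nat \<Rightarrow> 'p padic)"
  define S where "S = (\<lambda>a. \<Sum>x\<in>?U. teich_padic x ^ a)"
  have S: "S a = (if (?p - 1) dvd a then of_nat (?p - 1) else 0)" for a
    unfolding S_def by (rule sum_teich_padic_power)
  have "(\<Sum>u\<in>?U. \<Sum>v\<in>?U. teich_padic u ^ (?p - 1 - a) * teich_padic v ^ (?p - 1 - b)
        * class_sum c K (dwork_exp u * dwork_exp v))
    = (\<Sum>u\<in>?U. \<Sum>v\<in>?U. \<Sum>l<K. \<Sum>i=0..?n l. (- ?P) ^ l * cc i * cc (?n l - i)
        * (teich_padic u ^ (?p - 1 - a + i) * teich_padic v ^ (?p - 1 - b + (?n l - i))))"
    unfolding class_sum_def fps_mult_nth dwork_exp_nth sum_distrib_left cc_def power_add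
    by (simp only: mult_ac)
  also have "\<dots> = (\<Sum>l<K. \<Sum>i=0..?n l. \<Sum>u\<in>?U. \<Sum>v\<in>?U. (- ?P) ^ l * cc i * cc (?n l - i)
        * (teich_padic u ^ (?p - 1 - a + i) * teich_padic v ^ (?p - 1 - b + (?n l - i))))"
    by (subst sum.swap[of _ "{..<K}"], subst sum.swap[of _ "{..<K}"])
       (rule sum.cong[OF refl], subst sum.swap[of _ "{0.._}"], subst sum.swap[of _ "{0.._}"], rule refl)
  also have "\<dots> = (\<Sum>l<K. \<Sum>i=0..?n l. (- ?P) ^ l * cc i * cc (?n l - i)
        * (S (?p - 1 - a + i) * S (?p - 1 - b + (?n l - i))))"
    unfolding S_def sum_product by (simp only: sum_distrib_left)
  also have "\<dots> = (\<Sum>l<K. of_nat (?p - 1) ^ 2 * (- ?P) ^ e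
        * (\<Sum>i | i + e \<le> l. dwork_term a i * dwork_term b (l - e - i)))"
  proof (rule sum.cong[OF refl])
    fix l
    let ?g = "\<lambda>i. (- ?P) ^ l * cc i * cc (?n l - i) * (S (?p - 1 - a + i) * S (?p - 1 - b + (?n l - i)))"
    let ?I = "{i. i + e \<le> l}"
    have fin: "finite ?I" by (rule finite_subset[of _ "{..l}"]) auto
    have nl: "?n l = a + (?p - 1) * i + (b + (?p - 1) * (l - e - i))" if "i + e \<le> l" for i
    proof -
      have "?n l = c + (?p - 1) * (i + e + (l - e - i))" using that by simp
      also have "\<dots> = (c + (?p - 1) * e) + (?p - 1) * i + (?p - 1) * (l - e - i)"
        by (simp only: distrib_left add_ac)
      finally show ?thesis unfolding c[symmetric] by simp
    qed
    have "(\<Sum>i=0..?n l. ?g i) = (\<Sum>i\<in>(\<lambda>i. a + (?p - 1) * i) ` ?I. ?g i)"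
    proof (rule sum.mono_neutral_right)
      show "(\<lambda>i. a + (?p - 1) * i) ` ?I \<subseteq> {0..?n l}" using nl by auto
      show "\<forall>i\<in>{0..?n l} - (\<lambda>i. a + (?p - 1) * i) ` ?I. ?g i = 0"
      proof
        fix k assume k: "k \<in> {0..?n l} - (\<lambda>i. a + (?p - 1) * i) ` ?I"
        show "?g k = 0"
        proof (rule ccontr)
          assume "?g k \<noteq> 0"
          then have "S (?p - 1 - a + k) \<noteq> 0" "S (?p - 1 - b + (?n l - k)) \<noteq> 0" by auto
          then have "(?p - 1) dvd ?p - 1 - a + k" "(?p - 1) dvd ?p - 1 - b + (?n l - k)"
            unfolding S by (auto split: if_splits)
          then obtain i j where ij: "k = a + (?p - 1) * i" "?n l - k = b + (?p - 1) * j"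
            using dvd_class a b by metis
          have "?n l = k + (?n l - k)" using k by simp
          also have "\<dots> = a + b + (?p - 1) * (i + j)"
            unfolding ij(2) unfolding ij(1) by (simp add: distrib_left)
          also have "\<dots> = c + (?p - 1) * (e + i + j)" unfolding c by (simp add: distrib_left)
          finally have "l = e + i + j \<or> ?p - 1 = 0" by (simp only: add_left_cancel mult_cancel1)
          then have "i + e \<le> l" using a by auto
          then show False using k ij(1) by auto
        qed
      qed
    qed simp
    also have "\<dots> = (\<Sum>i\<in>?I. ?g (a + (?p - 1) * i))"
      using a by (subst sum.reindex) (auto simp: inj_on_def)
    also have "\<dots> = (\<Sum>i\<in>?I. of_nat (?p - 1) ^ 2 * (- ?P) ^ e * (dwork_term a i * dwork_term b (l - e - i)))"
    proof (rule sum.cong[OF refl])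
      fix i assume "i \<in> ?I"
      then have i: "i + e \<le> l" by simp
      have "?n l - (a + (?p - 1) * i) = b + (?p - 1) * (l - e - i)" unfolding nl[OF i] by simp
      moreover have "S (?p - 1 - a + (a + (?p - 1) * i)) = of_nat (?p - 1)"
      proof -
        have "?p - 1 - a + (a + (?p - 1) * i) = (?p - 1) * Suc i" using a by simp
        then show ?thesis unfolding S by (metis dvd_triv_left)
      qed
      moreover have "S (?p - 1 - b + (b + (?p - 1) * (l - e - i))) = of_nat (?p - 1)"
      proof -
        have "?p - 1 - b + (b + (?p - 1) * (l - e - i)) = (?p - 1) * Suc (l - e - i)" using b
          by simp
        then show ?thesis unfolding S by (metis dvd_triv_left)
      qed
      moreover have "(- ?P) ^ l = (- ?P) ^ e * ((- ?P) ^ i * (- ?P) ^ (l - e - i))"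
        using i by (simp flip: power_add)
      ultimately show "?g (a + (?p - 1) * i)
          = of_nat (?p - 1) ^ 2 * (- ?P) ^ e * (dwork_term a i * dwork_term b (l - e - i))"
        unfolding dwork_term_def cc_def[symmetric] power2_eq_square by (simp only: mult_ac)
    qed
    finally show "(\<Sum>i=0..?n l. ?g i) = of_nat (?p - 1) ^ 2 * (- ?P) ^ e
        * (\<Sum>i | i + e \<le> l. dwork_term a i * dwork_term b (l - e - i))"
      by (simp only: sum_distrib_left)
  qed
  finally show ?thesis by (simp only: sum_distrib_left)
qed

section \<open>Jacobi sums and the Gross-Koblitz formula\<close>

text \<open>The difference is the square of index pairs without the triangle
  \<open>i + j + e < K\<close>. Since \<open>e \<le> 1\<close>, the remaining pairs have
  \<open>i + j \<ge> K - 1\<close> and hence large valuation.\<close>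

lemma dwork_term_product:
  assumes "odd CARD('p)" "e \<le> 1"
  shows "val_ge ((\<Sum>i<K. dwork_term a i) * (\<Sum>j<K. dwork_term b j)
      - (\<Sum>l<K. \<Sum>i | i + e \<le> l. dwork_term a i * dwork_term b (l - e - i) :: 'p::prime_card padic))
    (dwork_slope TYPE('p) * (real (CARD('p) - 1) * (real K - 1)) - real a - real b)"
    (is "val_ge (_ - ?T) ?r")
proof -
  define \<sigma> where "\<sigma> = dwork_slope TYPE('p)"
  have \<sigma>: "\<sigma> \<ge> 0" by (simp add: \<sigma>_def)
  let ?f = "\<lambda>(i, j). dwork_term a i * dwork_term b j :: 'p padic"
  let ?A = "{(i, j). i + j + e < K}" and ?B = "{..<K} \<times> {..<K}"
  have fin: "finite {i. i + e \<le> l}" for l by (rule finite_subset[of _ "{..l}"]) auto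
  have "?T = (\<Sum>(l, i)\<in>Sigma {..<K} (\<lambda>l. {i. i + e \<le> l}). dwork_term a i * dwork_term b (l - e - i))"
    by (rule sum.Sigma) (auto simp: fin)
  also have "\<dots> = sum ?f ?A"
    by (rule sum.reindex_bij_witness[of _ "\<lambda>(i, j). (i + j + e, i)" "\<lambda>(l, i). (i, l - e - i)"]) auto
  finally have T: "?T = sum ?f ?A" .
  have "(\<Sum>i<K. dwork_term a i) * (\<Sum>j<K. dwork_term b j) = sum ?f ?B"
    by (simp add: sum_product sum.cartesian_product)
  also have "\<dots> = sum ?f (?B - ?A) + sum ?f ?A"
    by (rule sum.subset_diff) auto
  finally have "(\<Sum>i<K. dwork_term a i) * (\<Sum>j<K. dwork_term b j) - ?T = sum ?f (?B - ?A)"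
    unfolding T by simp
  moreover have "val_ge (?f x) ?r" if x: "x \<in> ?B - ?A" for x
  proof -
    obtain i j where ij: "x = (i, j)" "K \<le> i + j + e" using x by auto
    have "val_ge (?f x) ((\<sigma> * (real (CARD('p) - 1) * real i) - real a)
        + (\<sigma> * (real (CARD('p) - 1) * real j) - real b))"
      unfolding ij prod.case \<sigma>_def by (intro val_ge_mult val_ge_dwork_term assms)
    moreover have "?r \<le> (\<sigma> * (real (CARD('p) - 1) * real i) - real a)
        + (\<sigma> * (real (CARD('p) - 1) * real j) - real b)"
    proof -
      have "real K - 1 \<le> real i + real j" using ij(2) assms(2) by linarith
      then have "\<sigma> * (real (CARD('p) - 1) * (real K - 1))
        \<le> \<sigma> * (real (CARD('p) - 1) * (real i + real j))"
        using \<sigma> by (intro mult_left_mono) auto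
      then show ?thesis unfolding \<sigma>_def[symmetric] distrib_left by linarith
    qed
    ultimately show ?thesis by (rule val_ge_mono)
  qed
  ultimately show ?thesis by (simp only: val_ge_sum)
qed

definition jacobi_sum :: "nat \<Rightarrow> nat \<Rightarrow> 'p::prime_card padic_int" where
  "jacobi_sum a b = (\<Sum>x\<in>UNIV - {0, 1 :: 'p mod_ring}. teichmuller x ^ a * teichmuller (1 - x) ^ b)"

text \<open>Substitute \<open>u = w x\<close>, \<open>v = w (1 - x)\<close>: the total power of
  \<open>w\<close> is 1, so \<open>w\<close> only contributes the factor \<open>p - 1\<close>. Pairs
  with \<open>u + v = 0\<close> vanish because \<open>c > 0\<close>.\<close>

lemma sum_teich_eq_jacobi_sum:
  assumes "(CARD('p) - 1) dvd a + b + c" "0 < c"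
  shows "(\<Sum>u\<in>UNIV - {0 :: 'p::prime_card mod_ring}. \<Sum>v\<in>UNIV - {0}.
      teichmuller u ^ a * teichmuller v ^ b * teichmuller (u + v) ^ c)
    = of_nat (CARD('p) - 1) * jacobi_sum a b"
proof -
  let ?U = "UNIV - {0 :: 'p mod_ring}" and ?V = "UNIV - {0, 1 :: 'p mod_ring}"
  let ?f = "\<lambda>(u, v). teichmuller u ^ a * teichmuller v ^ b * teichmuller (u + v) ^ c :: 'p padic_int"
  have "(\<Sum>u\<in>?U. \<Sum>v\<in>?U. teichmuller u ^ a * teichmuller v ^ b * teichmuller (u + v) ^ c)
    = sum ?f (?U \<times> ?U)"
    by (simp add: sum.cartesian_product)
  also have "\<dots> = sum ?f {(u, v). u \<in> ?U \<and> v \<in> ?U \<and> u + v \<noteq> 0}"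
    using assms(2) by (intro sum.mono_neutral_right) (auto simp: zero_power)
  also have "\<dots> = (\<Sum>(w, x)\<in>?U \<times> ?V. teichmuller x ^ a * teichmuller (1 - x) ^ b)"
  proof (rule sum.reindex_bij_witness[of _ "\<lambda>(w, x). (w * x, w * (1 - x))" "\<lambda>(u, v). (u + v, u / (u + v))"])
    fix z assume z: "z \<in> {(u, v). u \<in> ?U \<and> v \<in> ?U \<and> u + v \<noteq> 0}"
    obtain u v where uv: "z = (u, v)" by (cases z)
    with z have nz: "u \<noteq> 0" "v \<noteq> 0" "u + v \<noteq> 0" by auto
    have v: "1 - u / (u + v) = v / (u + v)" using nz by (simp add: field_simps)
    show "(\<lambda>(w, x). (w * x, w * (1 - x))) ((\<lambda>(u, v). (u + v, u / (u + v))) z) = z"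
      unfolding uv using nz by (simp add: v)
    have "u / (u + v) \<noteq> 1" using nz v by (metis diff_self divide_eq_0_iff)
    then show "(\<lambda>(u, v). (u + v, u / (u + v))) z \<in> ?U \<times> ?V"
      unfolding uv using nz by simp
    let ?w = "u + v" and ?x = "u / (u + v)"
    obtain k where k: "a + b + c = (CARD('p) - 1) * k" using assms(1) by (elim dvdE)
    have w1: "teichmuller ?w ^ (a + b + c) = 1"
      unfolding k power_mult teich_pow_card_minus_1[OF nz(3)] by simp
    have u: "teichmuller u = teichmuller ?w * teichmuller ?x"
      using nz by (simp flip: teich_mult)
    have v': "teichmuller v = teichmuller ?w * teichmuller (1 - ?x)"
      unfolding v using nz by (simp flip: teich_mult)
    have "?f z = teichmuller u ^ a * teichmuller v ^ b * teichmuller ?w ^ c" unfolding uv by simp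
    also have "\<dots> = teichmuller ?w ^ (a + b + c) * (teichmuller ?x ^ a * teichmuller (1 - ?x) ^ b)"
      unfolding u v' power_add power_mult_distrib by (simp only: mult_ac)
    finally show "(\<lambda>(w, x). teichmuller x ^ a * teichmuller (1 - x) ^ b) ((\<lambda>(u, v). (u + v, u / (u + v))) z) = ?f z"
      unfolding w1 uv by simp
  next
    fix z assume "z \<in> ?U \<times> ?V"
    then obtain w x where wx: "z = (w, x)" "w \<noteq> 0" "x \<noteq> 0" "x \<noteq> 1" by auto
    have s: "w * x + w * (1 - x) = w" by (simp add: algebra_simps)
    show "(\<lambda>(u, v). (u + v, u / (u + v))) ((\<lambda>(w, x). (w * x, w * (1 - x))) z) = z"
      unfolding wx(1) prod.case s using wx(2) by simp
    show "(\<lambda>(w, x). (w * x, w * (1 - x))) z \<in> {(u, v). u \<in> ?U \<and> v \<in> ?U \<and> u + v \<noteq> 0}"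
      unfolding wx(1) prod.case using wx(2-4) s by auto
  qed
  also have "\<dots> = (\<Sum>w\<in>?U. jacobi_sum a b)"
    by (simp only: jacobi_sum_def sum.cartesian_product)
  also have "\<dots> = of_nat (CARD('p) - 1) * jacobi_sum a b"
    unfolding sum_constant card_nonzero_mod_ring ..
  finally show ?thesis .
qed

lemma eventually_linear_ge:
  fixes c d r :: real
  assumes "c > 0"
  shows "eventually (\<lambda>K. r \<le> c * real K - d) sequentially"
proof -
  have "filterlim (\<lambda>K::nat. c * real K - d) at_top sequentially" using assms by real_asymp
  then show ?thesis by (simp add: filterlim_at_top)
qed

text \<open>The sum over \<open>u\<close>, \<open>v\<close> of
  \<open>\<omega>^(-a)(u) \<omega>^(-b)(v)\<close> times the class sum of E(u X) E(v X) is evaluated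
  twice: orthogonality gives the partial sums for \<open>a\<close> and \<open>b\<close>, additivity
  gives the Jacobi sum times the partial sum for \<open>c\<close>. Writing \<open>1 - p\<close> for
  \<open>p - 1\<close> turns the difference into a sum.\<close>

lemma jacobi_sum_approx:
  assumes odd: "odd CARD('p)" and a: "0 < a" "a < CARD('p) - 1" and b: "0 < b" "b < CARD('p) - 1"
    and c: "0 < c" "c < CARD('p)" and e: "a + b = c + (CARD('p) - 1) * e" "e \<le> 1"
  shows "eventually (\<lambda>K. val_ge ((- of_nat CARD('p)) ^ e
        * ((1 - of_nat CARD('p)) * (\<Sum>j<K. dwork_term a j)) * ((1 - of_nat CARD('p)) * (\<Sum>j<K. dwork_term b j))
      + to_padic (jacobi_sum (CARD('p) - 1 - a) (CARD('p) - 1 - b) :: 'p::prime_card padic_int)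
        * ((1 - of_nat CARD('p)) * (\<Sum>j<K. dwork_term c j))) r) sequentially"
proof -
  let ?p = "CARD('p)" and ?U = "UNIV - {0 :: 'p mod_ring}"
  define P where "P = (of_nat ?p :: 'p padic)"
  have p1: "?p > 1" using nontriv[where 'a='p] .
  let ?a = "?p - 1 - a" and ?b = "?p - 1 - b"
  define J where "J = (to_padic (jacobi_sum ?a ?b) :: 'p padic)"
  define \<sigma> where "\<sigma> = dwork_slope TYPE('p)"
  have \<sigma>: "\<sigma> * real (?p - 1) > 0" using card_minus_1_pos[where 'p='p] by (simp add: \<sigma>_def)
  let ?S = "\<lambda>a K. \<Sum>j<K. dwork_term a j :: 'p padic"
  let ?T = "\<lambda>K. \<Sum>l<K. \<Sum>i | i + e \<le> l. dwork_term a i * dwork_term b (l - e - i) :: 'p padic"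
  have np: "of_nat (?p - 1) = P - 1" unfolding P_def using p1 by (simp add: of_nat_diff)
  have abc: "?a + ?b + c = (?p - 1) * (2 - e)"
  proof -
    have "?a + ?b + (a + b) = (?p - 1) * 2" using a b by simp
    then have "?a + ?b + c + (?p - 1) * e = (?p - 1) * 2" unfolding e(1) by simp
    then show ?thesis by (simp add: diff_mult_distrib2)
  qed
  have Jsum:
    "(\<Sum>u\<in>?U. \<Sum>v\<in>?U. teich_padic u ^ ?a * teich_padic v ^ ?b * (teich_padic (u + v) ^ c * s))
      = (P - 1) * J * s" for s
  proof -
    have "(\<Sum>u\<in>?U. \<Sum>v\<in>?U. teich_padic u ^ ?a * teich_padic v ^ ?b * (teich_padic (u + v) ^ c * s))
        = to_padic (\<Sum>u\<in>?U. \<Sum>v\<in>?U. teichmuller u ^ ?a * teichmuller v ^ ?b * teichmuller (u + v) ^ c) * s"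
      unfolding to_padic_simps sum_distrib_right by (simp only: mult_ac)
    also have "(\<Sum>u\<in>?U. \<Sum>v\<in>?U. teichmuller u ^ ?a * teichmuller v ^ ?b * teichmuller (u + v) ^ c)
        = of_nat (?p - 1) * jacobi_sum ?a ?b"
      using abc c(1) by (intro sum_teich_eq_jacobi_sum) simp_all
    finally show ?thesis unfolding to_padic_simps np J_def .
  qed
  have err: "val_ge ((P - 1) ^ 2 * (- P) ^ e * ?T (Suc K) - (P - 1) * J * ?S c (Suc K))
      (\<sigma> * (real (?p - 1) * real K) - real ?p)" for K
  proof -
    have "(P - 1) ^ 2 * (- P) ^ e * ?T (Suc K) - (P - 1) * J * ?S c (Suc K)
      = (\<Sum>u\<in>?U. \<Sum>v\<in>?U. teich_padic u ^ ?a * teich_padic v ^ ?b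
          * class_sum c (Suc K) (dwork_exp u * dwork_exp v))
        - (\<Sum>u\<in>?U. \<Sum>v\<in>?U. teich_padic u ^ ?a * teich_padic v ^ ?b * (teich_padic (u + v) ^ c * ?S c (Suc K)))"
      unfolding Jsum sum_class_sum_dwork_exp[OF a b e(1)] np P_def ..
    also have "\<dots> = (\<Sum>u\<in>?U. \<Sum>v\<in>?U. to_padic (teichmuller u ^ ?a * teichmuller v ^ ?b)
        * (class_sum c (Suc K) (dwork_exp u * dwork_exp v) - teich_padic (u + v) ^ c * ?S c (Suc K)))"
      unfolding sum_subtractf[symmetric] right_diff_distrib[symmetric] to_padic_simps ..
    finally have eq: "(P - 1) ^ 2 * (- P) ^ e * ?T (Suc K) - (P - 1) * J * ?S c (Suc K) = \<dots>" .
    show ?thesis unfolding eq \<sigma>_def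
      by (intro val_ge_sum val_ge_mult_to_padic class_sum_dwork_exp_mult[OF odd c])
  qed
  have prod: "val_ge ((P - 1) ^ 2 * (- P) ^ e * (?S a (Suc K) * ?S b (Suc K) - ?T (Suc K)))
      (\<sigma> * (real (?p - 1) * real K) - real a - real b)" for K
  proof -
    have "(P - 1) ^ 2 * (- P) ^ e = to_padic ((pp - 1) ^ 2 * (- pp) ^ e)"
      unfolding to_padic_simps P_def ..
    moreover have "real (Suc K) - 1 = real K" by simp
    note dwork_term_product[OF odd e(2), where K="Suc K" and a=a and b=b, unfolded this]
    ultimately show ?thesis unfolding \<sigma>_def by (simp only: val_ge_mult_to_padic)
  qed
  have "eventually (\<lambda>K. r \<le> \<sigma> * real (?p - 1) * real K - (real ?p + real a + real b)) sequentially"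
    using \<sigma> by (rule eventually_linear_ge)
  then have "eventually (\<lambda>K. val_ge ((- P) ^ e * ((1 - P) * ?S a (Suc K)) * ((1 - P) * ?S b (Suc K))
      + J * ((1 - P) * ?S c (Suc K))) r) sequentially"
  proof eventually_elim
    case (elim K)
    have "r \<le> \<sigma> * (real (?p - 1) * real K) - real ?p" "r
      \<le> \<sigma> * (real (?p - 1) * real K) - real a - real b"
      using elim unfolding mult.assoc by linarith+
    note v = val_ge_add[OF val_ge_mono[OF prod this(2)] val_ge_mono[OF err this(1)]]
    have "(- P) ^ e * ((1 - P) * x) * ((1 - P) * y) + J * ((1 - P) * z)
        = (P - 1) ^ 2 * (- P) ^ e * (x * y - t) + ((P - 1) ^ 2 * (- P) ^ e * t - (P - 1) * J * z)" for x y z t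
      by (simp add: algebra_simps power2_eq_square)
    from v[folded this] show ?case .
  qed
  from iffD1[OF eventually_sequentially_Suc[of "\<lambda>K. val_ge ((- P) ^ e
    * ((1 - P) * ?S a K) * ((1 - P) * ?S b K) + J * ((1 - P) * ?S c K)) r"] this]
  show ?thesis unfolding P_def J_def .
qed

text \<open>The Gross-Koblitz formula on the level of Jacobi sums: the partial sums in
  \<open>jacobi_sum_approx\<close> tend to gamma values by \<open>dwork_sum_limit\<close>, and the
  powers of \<open>pi\<close> of the three Gauss sums combine to
  \<open>pi^(a+b-c) = (- p)^e\<close>.\<close>

theorem jacobi_sum_eq_Gamma:
  fixes ga gb gc :: "'p::prime_card padic_int"
  assumes odd: "odd CARD('p)" and a: "0 < a" "a < CARD('p) - 1" and b: "0 < b" "b < CARD('p) - 1"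
    and c: "0 < c" "c < CARD('p)" and e: "a + b = c + (CARD('p) - 1) * e" "e \<le> 1"
    and g: "(pp - 1) * ga = of_nat a" "(pp - 1) * gb = of_nat b" "(pp - 1) * gc = of_nat c"
  shows "jacobi_sum (CARD('p) - 1 - a) (CARD('p) - 1 - b) * morita_Gamma gc
    = - ((- pp) ^ e * morita_Gamma ga * morita_Gamma gb)"
proof -
  let ?p = "CARD('p)" and ?J = "jacobi_sum (CARD('p) - 1 - a) (CARD('p) - 1 - b) :: 'p padic_int"
  let ?G = "\<lambda>x. to_padic (morita_Gamma x) :: 'p padic"
  have "val_ge (to_padic ((- pp) ^ e * morita_Gamma ga * morita_Gamma gb + ?J * morita_Gamma gc)) r" for r
  proof -
    \<comment> \<open>A nonnegative bound makes \<open>sb\<close> integral, as the estimate of the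
      product with \<open>sb\<close> requires.\<close>
    let ?r = "max r 0"
    let ?s = "\<lambda>a K. (1 - of_nat ?p) * (\<Sum>j<K. dwork_term a j) :: 'p padic"
    have "a < ?p" "b < ?p" using a b by auto
    then have "eventually (\<lambda>K. val_ge (?s a K - ?G ga) ?r \<and> val_ge (?s b K - ?G gb) ?r \<and> val_ge (?s c K - ?G gc) ?r
      \<and> val_ge ((- of_nat ?p) ^ e * ?s a K * ?s b K + to_padic ?J * ?s c K) ?r) sequentially"
      by (intro eventually_conj dwork_sum_limit jacobi_sum_approx assms)
    then obtain K where K:
      "val_ge (?s a K - ?G ga) ?r" "val_ge (?s b K - ?G gb) ?r" "val_ge (?s c K - ?G gc) ?r"
      "val_ge ((- of_nat ?p) ^ e * ?s a K * ?s b K + to_padic ?J * ?s c K) ?r"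
      by (auto simp: eventually_sequentially)
    define sa sb sc where "sa = ?s a K" and "sb = ?s b K" and "sc = ?s c K"
    note K = K[folded sa_def sb_def sc_def]
    have sb0: "val_ge sb 0"
    proof -
      have "val_ge ((sb - ?G gb) + ?G gb) 0"
        by (rule val_ge_add[OF val_ge_mono[OF K(2)] val_ge_to_padic]) simp
      then show ?thesis by (simp only: diff_add_cancel)
    qed
    have 1: "val_ge (?G ga * (sb - ?G gb)) ?r" by (rule val_ge_mult_to_padic[OF K(2)])
    have 2: "val_ge ((sa - ?G ga) * sb) ?r" using val_ge_mult[OF K(1) sb0] by simp
    have 3: "val_ge (to_padic ((- pp) ^ e) * ((sa - ?G ga) * sb + ?G ga * (sb - ?G gb))) ?r"
      by (intro val_ge_mult_to_padic val_ge_add 1 2)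
    have 4: "val_ge (to_padic ?J * (sc - ?G gc)) ?r" by (rule val_ge_mult_to_padic[OF K(3)])
    have "E * x * y + J * z = (E * sa * sb + J * sc) - E * ((sa - x) * sb + x * (sb - y)) - J * (sc - z)"
      for E J x y z :: "'p padic" by (simp add: algebra_simps)
    from this[of "(- of_nat ?p) ^ e" "?G ga" "?G gb" "to_padic ?J" "?G gc"]
    have "val_ge ((- of_nat ?p) ^ e * ?G ga * ?G gb + to_padic ?J * ?G gc) ?r"
      using val_ge_diff[OF val_ge_diff[OF K(4) 3[unfolded to_padic_simps]] 4] by (simp only:)
    then have "val_ge (to_padic ((- pp) ^ e * morita_Gamma ga * morita_Gamma gb + ?J * morita_Gamma gc)) ?r"
      unfolding to_padic_simps .
    then show ?thesis by (rule val_ge_mono) simp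
  qed
  then have "to_padic ((- pp) ^ e * morita_Gamma ga * morita_Gamma gb + ?J * morita_Gamma gc) = 0"
    by (rule val_ge_imp_0)
  then have "(- pp) ^ e * morita_Gamma ga * morita_Gamma gb + ?J * morita_Gamma gc = 0"
    by (simp only: to_padic_eq_0_iff)
  then show ?thesis by (simp only: add.commute eq_neg_iff_add_eq_0)
qed

section \<open>Gamma values at rational arguments\<close>

lemma sum_teich_power_minus_1:
  assumes "\<not> (CARD('p) - 1) dvd m"
  shows "(\<Sum>x\<in>UNIV - {0, 1 :: 'p::prime_card mod_ring}. teichmuller x ^ m) = - 1"
proof -
  have "UNIV - {0 :: 'p mod_ring} = insert 1 (UNIV - {0, 1})" by auto
  then have "(\<Sum>x\<in>UNIV - {0 :: 'p mod_ring}. teichmuller x ^ m)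
      = 1 + (\<Sum>x\<in>UNIV - {0, 1 :: 'p mod_ring}. teichmuller x ^ m)"
    by (simp only:) (subst sum.insert, auto)
  then show ?thesis unfolding sum_teich_power[OF assms]
    by (simp add: eq_neg_iff_add_eq_0 add.commute)
qed

lemma jacobi_sum_trivial_right:
  assumes "\<not> (CARD('p) - 1) dvd m"
  shows "jacobi_sum m (CARD('p) - 1) = (- 1 :: 'p::prime_card padic_int)"
proof -
  have "jacobi_sum m (CARD('p) - 1) = (\<Sum>x\<in>UNIV - {0, 1 :: 'p mod_ring}. teichmuller x ^ m)"
    unfolding jacobi_sum_def
  proof (rule sum.cong[OF refl])
    fix x assume "x \<in> UNIV - {0, 1 :: 'p mod_ring}"
    then have nz: "1 - x \<noteq> 0" by auto
    show "teichmuller x ^ m * teichmuller (1 - x) ^ (CARD('p) - 1) = teichmuller x ^ m"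
      by (simp only: teich_pow_card_minus_1[OF nz] mult_1_right)
  qed
  then show ?thesis using sum_teich_power_minus_1[OF assms] by simp
qed

lemma jacobi_sum_commute: "jacobi_sum a b = (jacobi_sum b a :: 'p::prime_card padic_int)"
  unfolding jacobi_sum_def
  by (rule sum.reindex_bij_witness[of _ "\<lambda>x. 1 - x" "\<lambda>x. 1 - x"]) (auto simp: mult.commute)

lemma p_minus_1_neq_0: "(pp - 1 :: 'p::prime_card padic_int) \<noteq> 0"
proof -
  have "1 < CARD('p)" by (rule nontriv)
  then have "(pp :: 'p padic_int) \<noteq> of_nat 1" by (simp only: of_nat_eq_iff)
  then show ?thesis by simp
qed

text \<open>Adds \<open>a = 0\<close> and \<open>b = 0\<close>, where the trivial character makes
  the Jacobi sum \<open>- 1\<close>. These cases arise when \<open>2 j\<close> or \<open>3 j\<close>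
  is a multiple of \<open>p - 1\<close>.\<close>

lemma jacobi_sum_eq_Gamma_general:
  fixes ga gb gc :: "'p::prime_card padic_int"
  assumes odd: "odd CARD('p)" and a: "a < CARD('p) - 1" and b: "b < CARD('p) - 1"
    and c: "0 < c" "c < CARD('p) - 1" and e: "a + b = c + (CARD('p) - 1) * e" "e \<le> 1"
    and g: "(pp - 1) * ga = of_nat a" "(pp - 1) * gb = of_nat b" "(pp - 1) * gc = of_nat c"
  shows "jacobi_sum (CARD('p) - 1 - a) (CARD('p) - 1 - b) * morita_Gamma gc
    = - ((- pp) ^ e * morita_Gamma ga * morita_Gamma gb)"
proof -
  have edge: "jacobi_sum (CARD('p) - 1 - c) (CARD('p) - 1) * morita_Gamma gc
      = - ((- pp) ^ e * morita_Gamma x * morita_Gamma y)"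
    if "e = 0" "(pp - 1) * x = of_nat c" "(pp - 1) * y = of_nat 0" for x y :: "'p padic_int"
  proof -
    have "y = 0" using that(3) p_minus_1_neq_0[where 'p='p] by simp
    moreover have "(pp - 1) * x = (pp - 1) * gc" using that(2) g(3) by simp
    then have "x = gc" using p_minus_1_neq_0[where 'p='p] by (simp only: mult_cancel_left) blast
    moreover have "\<not> (CARD('p) - 1) dvd (CARD('p) - 1 - c)" using c by (auto dest: dvd_imp_le)
    ultimately show ?thesis
      using that(1) by (simp add: jacobi_sum_trivial_right morita_Gamma_0[OF odd] del: One_nat_def)
  qed
  consider "a = 0" | "b = 0" | "0 < a" "0 < b" by auto
  then show ?thesis
  proof cases
    case 1
    then have "e = 0" using e c b by (cases e) auto
    moreover have "b = c" using 1 e \<open>e = 0\<close> by simp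
    ultimately have "jacobi_sum (CARD('p) - 1 - a) (CARD('p) - 1 - b)
        = (jacobi_sum (CARD('p) - 1 - c) (CARD('p) - 1) :: 'p padic_int)"
      using 1 by (subst jacobi_sum_commute) simp
    moreover have "(pp - 1) * gb = of_nat c" "(pp - 1) * ga = of_nat 0"
      using g 1 \<open>b = c\<close> by simp_all
    note edge[OF \<open>e = 0\<close> this]
    ultimately show ?thesis by (simp only: mult_ac)
  next
    case 2
    then have "e = 0" using e c a by (cases e) auto
    moreover have "a = c" using 2 e \<open>e = 0\<close> by simp
    ultimately show ?thesis using edge[of ga gb] g 2 by simp
  next
    case 3
    then show ?thesis using jacobi_sum_eq_Gamma[OF odd _ a _ b c(1) _ e g] c(2) by simp
  qed
qed

lemma padic_int_of_rat_eqI: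
  assumes "d \<noteq> 0" "of_int d * x = (of_int n :: 'p::prime_card padic_int)"
  shows "padic_int_of_rat (of_int n / of_int d) = x"
proof -
  let ?q = "of_int n / of_int d :: rat"
  obtain n0 d0 where q: "quotient_of ?q = (n0, d0)" by (cases "quotient_of ?q")
  have d0: "d0 > 0" using quotient_of_denom_pos[OF q] .
  have "?q = of_int n0 / of_int d0" using quotient_of_div[OF q] .
  then have "(of_int (n * d0) :: rat) = of_int (n0 * d)" using assms(1) d0
    by (simp add: field_simps)
  then have nd: "n * d0 = n0 * d" by (simp only: of_int_eq_iff)
  have "of_int d * (of_int d0 * x) = (of_int d * of_int n0 :: 'p padic_int)"
  proof -
    have "of_int d * (of_int d0 * x) = of_int d0 * (of_int d * x)" by (simp only: mult_ac)
    also have "\<dots> = of_int (n * d0)" unfolding assms(2) of_int_mult by (simp only: mult_ac)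
    also have "\<dots> = of_int d * of_int n0" unfolding nd of_int_mult by (simp only: mult_ac)
    finally show ?thesis .
  qed
  then have x: "of_int d0 * x = (of_int n0 :: 'p padic_int)" using assms(1) by simp
  show ?thesis
    unfolding padic_int_of_rat_def q fst_conv snd_conv
  proof (rule the_equality)
    show "of_int d0 * x = of_int n0" by (rule x)
    fix y :: "'p padic_int" assume "of_int d0 * y = of_int n0"
    then have "of_int d0 * y = of_int d0 * x" using x by simp
    then show "y = x" using d0 by simp
  qed
qed

lemma exists_inverse_of_nat:
  assumes "\<not> CARD('p) dvd m"
  obtains mi where "of_nat m * mi = (1 :: 'p::prime_card padic_int)"
proof -
  have "of_nat m dvd (1 :: 'p padic_int)" using assms
    by (intro padic_unit) (simp add: p_dvd_of_nat_iff)
  then show ?thesis using that by (metis dvdE)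
qed

definition unit_frac :: "nat \<Rightarrow> 'p::prime_card padic_int" where
  "unit_frac r = (THE z. (pp - 1) * z = of_nat r)"

lemma unit_frac: "(pp - 1) * unit_frac r = (of_nat r :: 'p::prime_card padic_int)"
proof -
  have "\<not> CARD('p) dvd (CARD('p) - 1)" using nontriv[where 'a='p] by (auto dest: dvd_imp_le)
  then obtain mi where mi: "of_nat (CARD('p) - 1) * mi = (1 :: 'p padic_int)"
    by (rule exists_inverse_of_nat)
  have n: "of_nat (CARD('p) - 1) = (pp - 1 :: 'p padic_int)"
    using nontriv[where 'a='p] by (simp add: of_nat_diff)
  have *: "(pp - 1) * (mi * of_nat r) = (of_nat r :: 'p padic_int)"
    using mi unfolding n mult.assoc[symmetric] by simp
  show ?thesis
    unfolding unit_frac_def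
  proof (rule theI)
    show "(pp - 1) * (mi * of_nat r) = (of_nat r :: 'p padic_int)" by (rule *)
    fix z :: "'p padic_int" assume "(pp - 1) * z = of_nat r"
    then have "(pp - 1) * z = (pp - 1) * (mi * of_nat r)" unfolding * .
    then show "z = mi * of_nat r" using p_minus_1_neq_0[where 'p='p]
      by (simp only: mult_cancel_left) blast
  qed
qed

lemma Gamma_rat_unit_frac:
  "(Gamma_rat (of_nat r / (of_nat CARD('p) - 1)) :: 'p::prime_card padic)
    = to_padic (morita_Gamma (unit_frac r))"
proof -
  have "int CARD('p) - 1 \<noteq> 0" using nontriv[where 'a='p] by simp
  moreover have "of_int (int CARD('p) - 1) * unit_frac r = (of_int (int r) :: 'p padic_int)"
    using unit_frac[of r, where 'p='p] by simp
  ultimately have "padic_int_of_rat (of_int (int r) / of_int (int CARD('p) - 1))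
    = (unit_frac r :: 'p padic_int)"
    by (rule padic_int_of_rat_eqI)
  then show ?thesis unfolding Gamma_rat_def by simp
qed

lemma Gamma_rat_0: "odd CARD('p) \<Longrightarrow> (Gamma_rat 0 :: 'p::prime_card padic) = 1"
  using padic_int_of_rat_eqI[of 1 "0 :: 'p padic_int" 0]
  by (simp add: Gamma_rat_def morita_Gamma_0 to_padic_1)

lemma Gamma_rat_neq_0: "odd CARD('p) \<Longrightarrow> (Gamma_rat q :: 'p::prime_card padic) \<noteq> 0"
  by (simp add: Gamma_rat_def to_padic_eq_0_iff morita_Gamma_neq_0)

lemma Gamma_rat_multiplication:
  assumes "odd CARD('p)" "\<not> CARD('p) dvd m" "r < CARD('p)"
  shows "(\<Prod>h<m. Gamma_rat ((of_nat r / (of_nat CARD('p) - 1) + of_nat h) / of_nat m))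
    = teich_padic (of_nat m) ^ r * Gamma_rat (of_nat r / (of_nat CARD('p) - 1))
      * (\<Prod>h<m. Gamma_rat (of_nat h / of_nat m) :: 'p::prime_card padic)"
proof -
  let ?N = "int CARD('p) - 1"
  obtain mi where mi: "of_nat m * mi = (1 :: 'p padic_int)" using exists_inverse_of_nat[OF assms(2)]
    by blast
  have m0: "m \<noteq> 0" using assms(2) by (intro notI) simp
  have N0: "?N \<noteq> 0" using nontriv[where 'a='p] by simp
  then have N0': "(of_int ?N :: rat) \<noteq> 0" using of_int_eq_0_iff by blast
  have 1: "padic_int_of_rat ((of_nat r / (of_nat CARD('p) - 1) + of_nat h) / of_nat m)
      = ((unit_frac r + of_nat h) * mi :: 'p padic_int)" for h
  proof -
    have "of_int (?N * int m) * ((unit_frac r + of_nat h) * mi)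
        = (of_nat m * mi) * ((pp - 1) * unit_frac r + of_nat h * (pp - 1) :: 'p padic_int)"
      by (simp add: algebra_simps)
    also have "\<dots> = of_int (int r + int h * ?N)" unfolding mi unit_frac by simp
    finally have "padic_int_of_rat (of_int (int r + int h * ?N) / of_int (?N * int m))
        = ((unit_frac r + of_nat h) * mi :: 'p padic_int)"
      using N0 m0 by (intro padic_int_of_rat_eqI) simp_all
    moreover have "(of_int (int r + int h * ?N) / of_int (?N * int m) :: rat)
        = (of_nat r / of_int ?N + of_nat h) / of_nat m"
      unfolding of_int_add of_int_mult using N0' m0 by (simp add: add_divide_distrib)
    ultimately show ?thesis by simp
  qed
  have 2: "padic_int_of_rat (of_nat h / of_nat m) = (of_nat h * mi :: 'p padic_int)" for h
  proof -
    have "of_int (int m) * (of_nat h * mi) = of_nat h * (of_nat m * mi)" by (simp add: mult_ac)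
    then have "of_int (int m) * (of_nat h * mi) = (of_int (int h) :: 'p padic_int)" unfolding mi
      by simp
    from padic_int_of_rat_eqI[OF _ this] m0 show ?thesis by simp
  qed
  have "(\<Prod>h<m. morita_Gamma ((unit_frac r + of_nat h) * mi))
      = teichmuller (of_nat m) ^ r * morita_Gamma (unit_frac r) * (\<Prod>h<m. morita_Gamma (of_nat h * mi :: 'p padic_int))"
    by (rule morita_Gamma_multiplication[OF assms(1) mi unit_frac assms(3)])
  from arg_cong[OF this, of to_padic] show ?thesis
    unfolding Gamma_rat_unit_frac unfolding Gamma_rat_def 1 2 to_padic_simps .
qed

section \<open>Duplication, triplication and the quadratic character\<close>

lemma two_three_not_dvd:
  assumes "CARD('p::prime_card) > 3"
  shows "\<not> CARD('p) dvd 2" "\<not> CARD('p) dvd 3"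
  using assms by (auto dest: dvd_imp_le)

lemma odd_card:
  assumes "CARD('p::prime_card) > 3"
  shows "odd CARD('p)"
  using prime_odd_nat[OF prime_card[where 'a='p]] assms by simp

lemma Gamma_rat_double:
  assumes "CARD('p) > 3" "r < CARD('p)" and z: "z = of_nat r / (of_nat CARD('p) - 1)"
  shows "Gamma_rat (z / 2) * Gamma_rat ((z + 1) / 2)
    = teich_padic 2 ^ r * Gamma_rat z * (Gamma_rat (1 / 2) :: 'p::prime_card padic)"
  using Gamma_rat_multiplication[OF odd_card[OF assms(1)] two_three_not_dvd(1)[OF assms(1)] assms(2)]
  unfolding z[symmetric]
    by (simp add: numeral_2_eq_2 lessThan_Suc Gamma_rat_0[OF odd_card[OF assms(1)]] del: mult_fract) (simp add: mult_ac)

lemma Gamma_rat_triple: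
  assumes "CARD('p) > 3" "r < CARD('p)" and z: "z = of_nat r / (of_nat CARD('p) - 1)"
  shows "Gamma_rat (z / 3) * Gamma_rat ((z + 1) / 3) * Gamma_rat ((z + 2) / 3)
    = teich_padic 3 ^ r * Gamma_rat z * (Gamma_rat (1 / 3) * Gamma_rat (2 / 3) :: 'p::prime_card padic)"
  using Gamma_rat_multiplication[OF odd_card[OF assms(1)] two_three_not_dvd(2)[OF assms(1)] assms(2)]
  unfolding z[symmetric]
    by (simp add: numeral_3_eq_3 lessThan_Suc Gamma_rat_0[OF odd_card[OF assms(1)]]) (simp add: mult_ac)

text \<open>Both sides are 1 or \<open>- 1\<close> and agree modulo \<open>p\<close> by Euler's
  criterion; \<open>p > 2\<close> separates the two values.\<close>

lemma teich_padic_half_power: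
  assumes "CARD('p) > 3" "a \<noteq> (0 :: 'p::prime_card mod_ring)"
  shows "teich_padic a ^ ((CARD('p) - 1) div 2) = of_int (quad_char a)"
proof -
  let ?p = "CARD('p)" and ?h = "(CARD('p) - 1) div 2" and ?k = "to_int_mod_ring a"
  have odd: "odd ?p" by (rule odd_card[OF assms(1)])
  have nd: "\<not> int ?p dvd ?k"
    using assms(2) of_int_mod_ring_eq_0_iff[of ?k, where 'p='p] by simp
  then have q: "quad_char a = 1 \<or> quad_char a = - 1"
    unfolding quad_char_def Legendre_def by (simp add: cong_0_iff)
  have "?h + ?h = ?p - 1" using odd by (elim oddE) simp
  then have "teichmuller a ^ ?h * teichmuller a ^ ?h = teichmuller a ^ (?p - 1)"
    by (simp only: power_add[symmetric])
  also have "\<dots> = 1" by (rule teich_pow_card_minus_1[OF assms(2)])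
  finally have t: "teichmuller a ^ ?h = 1 \<or> teichmuller a ^ ?h = - 1"
    by (simp add: square_eq_1_iff)
  have "[Legendre ?k (int ?p) = ?k ^ ?h] (mod int ?p)"
    using euler_criterion[OF prime_card[where 'a='p], of ?k] assms(1) by simp
  then have "pcong 1 (of_int (quad_char a)) (of_int (?k ^ ?h) :: 'p padic_int)"
    unfolding pcong_of_int_iff quad_char_def power_one_right .
  moreover have "pcong 1 (teichmuller a ^ ?h) (of_int (?k ^ ?h))"
    using pcong_power[OF teich_cong[of a], of ?h] by simp
  ultimately have c: "pcong 1 (teichmuller a ^ ?h) (of_int (quad_char a))"
    using pcong_sym pcong_trans by blast
  have n2: "\<not> pcong 1 (1 :: 'p padic_int) (- 1)" "\<not> pcong 1 (- 1 :: 'p padic_int) 1"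
  proof -
    have "\<not> pcong 1 (of_int 1 :: 'p padic_int) (of_int (- 1))"
      unfolding pcong_of_int_iff using assms(1) by (auto simp: cong_iff_dvd_diff dest!: zdvd_imp_le)
    then show "\<not> pcong 1 (1 :: 'p padic_int) (- 1)" by simp
    then show "\<not> pcong 1 (- 1 :: 'p padic_int) 1" using pcong_sym by blast
  qed
  have "teichmuller a ^ ?h = of_int (quad_char a)"
    using t q c n2 by (elim disjE) (simp_all del: One_nat_def)
  from arg_cong[OF this, of to_padic] show ?thesis unfolding to_padic_simps .
qed

section \<open>The function of McCarthy as a root count\<close>

text \<open>The coefficient at \<open>x = j / (p - 1)\<close> for lower parameters 0 and 1/2,
  simplified by \<open>Gamma_p 0 = 1\<close> and by the vanishing floor of \<open>x\<close>.\<close>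

definition G_coeff :: "rat \<Rightarrow> rat \<Rightarrow> rat \<Rightarrow> 'p::prime_card padic" where
  "G_coeff a b x = (- of_nat CARD('p)) powi (- \<lfloor>a - x\<rfloor> - \<lfloor>b - x\<rfloor> - \<lfloor>1 / 2 + x\<rfloor>)
     * (Gamma_rat (frac (a - x)) * Gamma_rat (frac (b - x)) * (Gamma_rat x * Gamma_rat (frac (x - 1 / 2))))
     / (Gamma_rat a * Gamma_rat b * Gamma_rat (1 / 2))"

lemma frac_half: "frac (- (1 / 2) :: rat) = 1 / 2"
proof -
  have "\<lfloor>- (1 / 2) :: rat\<rfloor> = - 1" by (simp only: floor_eq_iff) simp
  then show ?thesis unfolding frac_def by simp
qed

lemma mccarthy_G_eq:
  assumes p: "CARD('p) > 3" and ab: "0 \<le> a" "a < 1" "0 \<le> b" "b < 1"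
  shows "mccarthy_G [a, b] [0, 1 / 2] (t :: 'p::prime_card mod_ring)
    = (- 1) / of_nat (CARD('p) - 1)
      * (\<Sum>j<CARD('p) - 1. inv_teichmuller_power j t * G_coeff a b (of_nat j / (of_nat CARD('p) - 1)))"
proof -
  let ?P = "- of_nat CARD('p) :: 'p padic"
  have fr: "frac a = a" "frac b = b" using ab by (simp_all add: frac_eq)
  have iv: "{0..CARD('p) - 2} = {..<CARD('p) - 1}" using p by auto
  have "(- 1) ^ (j * 2) * inv_teichmuller_power j t *
      (\<Prod>k<2. let c = [a, b] ! k; d = [0, 1 / 2] ! k; x = of_nat j / (of_nat CARD('p) - 1) in
          ?P powi (- \<lfloor>frac c - x\<rfloor> - \<lfloor>frac (- d) + x\<rfloor>) *
          (Gamma_rat (frac (c - x)) / Gamma_rat (frac c)) *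
          (Gamma_rat (frac (- d + x)) / Gamma_rat (frac (- d))))
    = inv_teichmuller_power j t * G_coeff a b (of_nat j / (of_nat CARD('p) - 1))"
    if j: "j < CARD('p) - 1" for j
  proof -
    define x where "x = (of_nat j / (of_nat CARD('p) - 1) :: rat)"
    have "(of_nat j :: rat) < of_nat (CARD('p) - 1)" using j by (simp only: of_nat_less_iff)
    then have x: "0 \<le> x" "x < 1" using p by (simp_all add: x_def of_nat_diff)
    have fx: "\<lfloor>x\<rfloor> = 0" "frac x = x" using x by (simp_all add: frac_eq floor_eq_iff)
    have pw: "?P powi (- \<lfloor>a - x\<rfloor>) * ?P powi (- \<lfloor>b - x\<rfloor> - \<lfloor>1 / 2 + x\<rfloor>)
        = ?P powi (- \<lfloor>a - x\<rfloor> - \<lfloor>b - x\<rfloor> - \<lfloor>1 / 2 + x\<rfloor>)"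
      using power_int_add[of ?P "- \<lfloor>a - x\<rfloor>" "- \<lfloor>b - x\<rfloor> - \<lfloor>1 / 2 + x\<rfloor>"] by (simp add: algebra_simps)
    have G0: "Gamma_rat 0 = (1 :: 'p padic)" by (rule Gamma_rat_0[OF odd_card[OF p]])
    have m: "- (1 / 2) + x = x - 1 / 2" by simp
    have sgn: "(- 1 :: 'p padic) ^ (j * 2) = 1" by simp
    have two: "(\<Prod>k<2. f k) = f 0 * f (1 :: nat)" for f :: "nat \<Rightarrow> 'p padic"
      by (simp add: numeral_2_eq_2)
    have f0: "frac (0 :: rat) = 0" by simp
    have nth: "[c, d] ! 0 = c" "[c, d] ! 1 = d" for c d :: rat by simp_all
    have alg:
      "u * (g1 / ga) * (gx / 1) * (v * (g2 / gb) * (gh / gc))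
      = (u * v) * (g1 * g2 * (gx * gh)) / (ga * gb * gc)"
      for u v g1 ga gx g2 gb gh gc :: "'p padic" by (simp add: divide_inverse mult_ac)
    show ?thesis
      unfolding x_def[symmetric] two sgn nth Let_def fr minus_zero f0 add_0 fx frac_half m G0 diff_zero
        alg pw G_coeff_def mult_1 ..
  qed
  note * = this
  have len: "length [a, b] = 2" by simp
  show ?thesis
    unfolding mccarthy_G_def Let_def[of "CARD('p)"] iv len Let_def[of "2 :: nat"]
  proof (rule arg_cong2[where f="(*)", OF refl sum.cong[OF refl]])
    fix j assume "j \<in> {..<CARD('p) - 1}"
    then show "(- 1) ^ (j * 2) * inv_teichmuller_power j t *
      (\<Prod>k<2. let c = [a, b] ! k; d = [0, 1 / 2] ! k; x = of_nat j / (of_nat CARD('p) - 1) in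
          ?P powi (- \<lfloor>frac c - x\<rfloor> - \<lfloor>frac (- d) + x\<rfloor>) *
          (Gamma_rat (frac (c - x)) / Gamma_rat (frac c)) *
          (Gamma_rat (frac (- d + x)) / Gamma_rat (frac (- d))))
      = inv_teichmuller_power j t * G_coeff a b (of_nat j / (of_nat CARD('p) - 1))"
      by (intro *) simp
  qed
qed

lemma teich_pow_multiple:
  "(x :: 'p::prime_card mod_ring) \<noteq> 0 \<Longrightarrow> teichmuller x ^ ((CARD('p) - 1) * k) = 1"
  unfolding power_mult using teich_pow_card_minus_1[of x] by (simp del: One_nat_def)

text \<open>Up to the factor \<open>p - 1\<close>, these are the multiplicative Fourier coefficients
  of the number of solutions of \<open>y^2 (1 - y) = s\<close>.\<close>

definition cubic_sum :: "nat \<Rightarrow> 'p::prime_card padic_int" where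
  "cubic_sum j = (\<Sum>y\<in>UNIV - {0, 1 :: 'p mod_ring}. teichmuller (1 / (y ^ 2 * (1 - y))) ^ j)"

text \<open>The involution \<open>x = y / (y - 1)\<close> turns \<open>1 / (y^2 (1 - y))\<close>
  into \<open>(1 - x)^3 / x^2\<close>, hence the exponents \<open>(-2j, -j)\<close> into
  \<open>(-2j, 3j)\<close>. In this form Gross-Koblitz has the gamma values for the classes of
  \<open>2j\<close> and \<open>-3j\<close> in the numerator, where duplication and triplication
  produce them.\<close>

lemma cubic_sum_eq_jacobi_sum:
  assumes a: "a < CARD('p) - 1" "a + (CARD('p) - 1) * k = 2 * j"
    and c: "c < CARD('p) - 1" "c + 3 * j = (CARD('p) - 1) * l"
  shows "cubic_sum j = (jacobi_sum (CARD('p) - 1 - a) (CARD('p) - 1 - c) :: 'p::prime_card padic_int)"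
proof -
  let ?n = "CARD('p) - 1" and ?V = "UNIV - {0, 1 :: 'p mod_ring}"
  show ?thesis
    unfolding cubic_sum_def jacobi_sum_def
  proof (rule sum.reindex_bij_witness[of _ "\<lambda>x. x / (x - 1)" "\<lambda>x. x / (x - 1)"])
    fix y assume "y \<in> ?V"
    then have y: "y \<noteq> 0" "y - 1 \<noteq> 0" by auto
    define x where "x = y / (y - 1)"
    have x0: "x \<noteq> 0" using y by (simp add: x_def)
    have x1: "1 - x = 1 / (1 - y)" using y by (simp add: x_def divide_simps)
    have x1': "1 - x \<noteq> 0" using y unfolding x1 by simp
    show "x / (x - 1) = y"
    proof -
      have "x - 1 = 1 / (y - 1)" using x1 y by (simp add: x_def divide_simps)
      then show ?thesis using y by (simp add: x_def)
    qed
    show "x \<in> ?V" using x0 x1' by auto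
    have "1 / (y ^ 2 * (1 - y)) * x ^ 2 = (1 - x) ^ 3"
      unfolding x1 using y
        by (simp add: x_def power_divide divide_simps power2_eq_square power3_eq_cube) (simp add: algebra_simps)
    then have "teichmuller (1 / (y ^ 2 * (1 - y))) ^ j * teichmuller x ^ (2 * j)
      = teichmuller (1 - x) ^ (3 * j)"
      by (simp only: power_mult teich_power[symmetric] teich_mult[symmetric] power_mult_distrib[symmetric])
    moreover have "teichmuller (1 - x) ^ (3 * j) = teichmuller (1 - x) ^ (?n - c)"
    proof -
      have "teichmuller (1 - x) ^ c * teichmuller (1 - x) ^ (3 * j) = 1"
        unfolding power_add[symmetric] c(2) by (rule teich_pow_multiple[OF x1'])
      moreover have "teichmuller (1 - x) ^ c * teichmuller (1 - x) ^ (?n - c) = 1"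
        unfolding power_add[symmetric] using c(1) teich_pow_card_minus_1[OF x1'] by simp
      ultimately show ?thesis using x1' by (metis mult_cancel_left power_eq_0_iff teich_eq_0_iff)
    qed
    moreover have "teichmuller x ^ (?n - a) * teichmuller x ^ (2 * j) = 1"
    proof -
      have "?n - a + 2 * j = ?n * Suc k" using a by simp
      then show ?thesis unfolding power_add[symmetric] by (simp only: teich_pow_multiple[OF x0])
    qed
    ultimately have "(teichmuller x ^ (?n - a) * teichmuller (1 - x) ^ (?n - c)) * teichmuller x ^ (2 * j)
        = teichmuller (1 / (y ^ 2 * (1 - y))) ^ j * teichmuller x ^ (2 * j)"
      by (simp add: mult_ac del: One_nat_def)
    then show "teichmuller x ^ (?n - a) * teichmuller (1 - x) ^ (?n - c)
      = teichmuller (1 / (y ^ 2 * (1 - y))) ^ j"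
      using x0 by simp
  next
    fix y assume "y \<in> ?V"
    then have y: "y \<noteq> 0" "y - 1 \<noteq> 0" by auto
    have x1: "y / (y - 1) - 1 = 1 / (y - 1)" using y by (simp add: divide_simps)
    show "y / (y - 1) / (y / (y - 1) - 1) = y" unfolding x1 using y by simp
    have "y / (y - 1) - 1 \<noteq> 0" unfolding x1 using y by simp
    then show "y / (y - 1) \<in> ?V" using y by auto
  qed
qed

lemma of_nat_mod_ring_neq_0:
  assumes "CARD('p) > 3"
  shows "(2 :: 'p::prime_card mod_ring) \<noteq> 0" "(3 :: 'p mod_ring) \<noteq> 0"
    "(4 :: 'p mod_ring) \<noteq> 0" "(27 :: 'p mod_ring) \<noteq> 0"
proof -
  show 2: "(2 :: 'p mod_ring) \<noteq> 0" and 3: "(3 :: 'p mod_ring) \<noteq> 0"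
    using two_three_not_dvd[OF assms] of_nat_mod_ring_eq_0_iff[of 2, where 'p='p]
      of_nat_mod_ring_eq_0_iff[of 3, where 'p='p] by simp_all
  have e: "(4 :: 'p mod_ring) = 2 * 2" "(27 :: 'p mod_ring) = 3 * (3 * 3)" by simp_all
  show "(4 :: 'p mod_ring) \<noteq> 0" "(27 :: 'p mod_ring) \<noteq> 0"
    unfolding e mult_eq_0_iff using 2 3 by blast+
qed

text \<open>Origin of the constant 4/27: duplication at the class of \<open>2j\<close> contributes
  \<open>\<omega>(2)^(2j)\<close>, triplication at the class of \<open>-3j\<close> contributes
  \<open>\<omega>(3)^(-3j)\<close>.\<close>

lemma teich_three_two:
  assumes p: "CARD('p) > 3" and a: "a + (CARD('p) - 1) * k = 2 * j" and c:
    "c + 3 * j = (CARD('p) - 1) * l"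
  shows "teichmuller 3 ^ c * teichmuller 2 ^ a
    = teichmuller (4 / 27 :: 'p::prime_card mod_ring) ^ j"
proof -
  note nz = of_nat_mod_ring_neq_0[OF p]
  have "teichmuller 3 ^ c * teichmuller (27 :: 'p mod_ring) ^ j = 1"
  proof -
    have "teichmuller (27 :: 'p mod_ring) ^ j = teichmuller 3 ^ (3 * j)"
      by (simp add: power_mult flip: teich_power)
    then show ?thesis using teich_pow_multiple[OF nz(2), of l]
      by (simp only: power_add[symmetric] c)
  qed
  moreover have "teichmuller (4 :: 'p mod_ring) ^ j = teichmuller 2 ^ a"
  proof -
    have "teichmuller (4 :: 'p mod_ring) ^ j = teichmuller 2 ^ (2 * j)"
      by (simp add: power_mult flip: teich_power)
    also have "\<dots> = teichmuller 2 ^ a"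
      unfolding a[symmetric] power_add teich_pow_multiple[OF nz(1)] by simp
    finally show ?thesis .
  qed
  moreover have "teichmuller (4 / 27 :: 'p mod_ring) ^ j * teichmuller 27 ^ j = teichmuller 4 ^ j"
    by (simp only: power_mult_distrib[symmetric] teich_mult[symmetric]
        nonzero_eq_divide_eq[THEN iffD1, OF nz(4) refl])
  ultimately have "(teichmuller 3 ^ c * teichmuller 2 ^ a) * teichmuller (27 :: 'p mod_ring) ^ j
      = teichmuller (4 / 27) ^ j * teichmuller 27 ^ j"
    by (simp add: mult_ac)
  then show ?thesis using nz(4) by simp
qed

text \<open>The part common to all positions of \<open>x\<close>. Multiplying by
  \<open>Gamma_p (1 - x)\<close> completes the triple for the triplication formula and is at the
  same time the denominator in Gross-Koblitz; it is cancelled at the end. The carry \<open>e\<close>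
  is the exponent of \<open>- p\<close> on both sides.\<close>

lemma G_coeff_third_aux:
  fixes j a c e :: nat
  defines "N \<equiv> (of_nat CARD('p) - 1 :: rat)"
  assumes p: "CARD('p) > 3" and j: "0 < j" "j < CARD('p) - 1" and x: "x = of_nat j / N"
    and a: "a < CARD('p) - 1" "a + (CARD('p) - 1) * k = 2 * j" and za: "za = of_nat a / N"
    and c: "c < CARD('p) - 1" "c + 3 * j = (CARD('p) - 1) * l" and zc: "zc = of_nat c / N"
    and e: "a + c = (CARD('p) - 1 - j) + (CARD('p) - 1) * e" "e \<le> 1"
    and fl: "- \<lfloor>1 / 3 - x\<rfloor> - \<lfloor>2 / 3 - x\<rfloor> - \<lfloor>1 / 2 + x\<rfloor> = int e"
    and three: "Gamma_rat (frac (1 / 3 - x)) * Gamma_rat (frac (2 / 3 - x)) * Gamma_rat (1 - x)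
      = (Gamma_rat (zc / 3) * Gamma_rat ((zc + 1) / 3) * Gamma_rat ((zc + 2) / 3) :: 'p::prime_card padic)"
    and two:
      "Gamma_rat x * Gamma_rat (frac (x - 1 / 2))
      = (Gamma_rat (za / 2) * Gamma_rat ((za + 1) / 2) :: 'p padic)"
  shows "G_coeff (1 / 3) (2 / 3) x
    = - (to_padic (teichmuller (4 / 27 :: 'p mod_ring) ^ j * cubic_sum j))"
proof -
  let ?p = "CARD('p)" and ?P = "- of_nat CARD('p) :: 'p padic"
  note odd = odd_card[OF p]
  have pm: "of_nat (?p - 1) = N" unfolding N_def using p by (simp add: of_nat_diff)
  have N0: "N \<noteq> 0" unfolding pm[symmetric] using p by simp
  have x': "1 - x = of_nat (?p - 1 - j) / N"
  proof -
    have "of_nat (?p - 1 - j) = N - of_nat j" unfolding pm[symmetric] using j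
      by (simp add: of_nat_diff)
    then show ?thesis unfolding x using N0 by (simp add: diff_divide_distrib)
  qed
  have G: "Gamma_rat za = to_padic (morita_Gamma (unit_frac a :: 'p padic_int))"
    "Gamma_rat zc = to_padic (morita_Gamma (unit_frac c :: 'p padic_int))"
    "Gamma_rat (1 - x) = to_padic (morita_Gamma (unit_frac (?p - 1 - j) :: 'p padic_int))"
    unfolding za zc x' N_def Gamma_rat_unit_frac by simp_all
  have "0 < ?p - 1 - j" "?p - 1 - j < ?p - 1" using j by auto
  from arg_cong[OF jacobi_sum_eq_Gamma_general[OF odd a(1) c(1) this e unit_frac unit_frac unit_frac], of to_padic]
  have J: "to_padic (jacobi_sum (?p - 1 - a) (?p - 1 - c)) * Gamma_rat (1 - x)
      = - (?P ^ e * Gamma_rat za * Gamma_rat zc)"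
    unfolding G to_padic_simps .
  have ap: "a < ?p" "c < ?p" using a c by auto
  have two':
    "Gamma_rat x * Gamma_rat (frac (x - 1 / 2))
    = teich_padic 2 ^ a * Gamma_rat za * (Gamma_rat (1 / 2) :: 'p padic)"
    unfolding two by (rule Gamma_rat_double[OF p ap(1) za[unfolded N_def]])
  have three': "Gamma_rat (frac (1 / 3 - x)) * Gamma_rat (frac (2 / 3 - x)) * Gamma_rat (1 - x)
      = teich_padic 3 ^ c * Gamma_rat zc * (Gamma_rat (1 / 3) * Gamma_rat (2 / 3) :: 'p padic)"
    unfolding three by (rule Gamma_rat_triple[OF p ap(2) zc[unfolded N_def]])
  define g where "g = (Gamma_rat (1 / 3) * Gamma_rat (2 / 3) * Gamma_rat (1 / 2) :: 'p padic)"
  have g0: "g \<noteq> 0" by (simp add: g_def Gamma_rat_neq_0[OF odd])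
  have G: "G_coeff (1 / 3) (2 / 3) x = ?P ^ e
     * (Gamma_rat (frac (1 / 3 - x)) * Gamma_rat (frac (2 / 3 - x)) * (Gamma_rat x * Gamma_rat (frac (x - 1 / 2)))) / g"
    unfolding G_coeff_def fl g_def by simp
  have "u = E * (m1 * m2 * X) / g \<Longrightarrow> u * D = E * ((m1 * m2 * D) * X) / g" for u E m1 m2 X D ::
    "'p padic"
    by (simp add: divide_inverse mult_ac)
  from this[OF G] have "G_coeff (1 / 3) (2 / 3) x * Gamma_rat (1 - x) = ?P ^ e
     * ((Gamma_rat (frac (1 / 3 - x)) * Gamma_rat (frac (2 / 3 - x)) * Gamma_rat (1 - x))
       * (Gamma_rat x * Gamma_rat (frac (x - 1 / 2)))) / g" .
  also have "\<dots> = (teich_padic 3 ^ c * teich_padic 2 ^ a) * (?P ^ e * Gamma_rat za * Gamma_rat zc)"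
  proof -
    have "E * ((t3 * c * (g1 * g2)) * (t2 * a * g3)) / (g1 * g2 * g3) = (t3 * t2) * (E * a * c)"
      if "g1 * g2 * g3 \<noteq> 0" for E t3 c g1 g2 t2 a g3 :: "'p padic"
      using that by (simp add: field_simps)
    from this[OF g0[unfolded g_def]] show ?thesis unfolding two' three' g_def .
  qed
  also have "\<dots> = - (to_padic ((teichmuller 3 ^ c * teichmuller 2 ^ a) * jacobi_sum (?p - 1 - a) (?p - 1 - c))) * Gamma_rat (1 - x)"
  proof -
    have "J * D = - w \<Longrightarrow> k * w = - (k * J) * D" for J D w k :: "'p padic"
      by (simp add: mult.assoc)
    from this[OF J] show ?thesis unfolding to_padic_simps .
  qed
  finally show ?thesis
    unfolding teich_three_two[OF p a(2) c(2)] cubic_sum_eq_jacobi_sum[OF a c, symmetric]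
    using Gamma_rat_neq_0[OF odd] by (simp only: mult_cancel_right) blast
qed

text \<open>The floors, the fractional parts and the reduced residues of \<open>2j\<close> and
  \<open>-3j\<close> change where \<open>x\<close> crosses 1/3, 1/2 and 2/3, whence four cases. The
  carry \<open>e\<close> is 0, 1, 0, 1 in turn.\<close>

lemma G_coeff_third:
  assumes p: "CARD('p) > 3" and j: "0 < j" "j < CARD('p) - 1"
  shows "G_coeff (1 / 3) (2 / 3) (of_nat j / (of_nat CARD('p) - 1))
    = - (to_padic (teichmuller (4 / 27 :: 'p::prime_card mod_ring) ^ j * cubic_sum j))"
proof -
  let ?n = "CARD('p) - 1"
  define N where "N = (of_nat CARD('p) - 1 :: rat)"
  define x where "x = of_nat j / N"
  have pm: "N = of_nat ?n" unfolding N_def using p by (simp add: of_nat_diff)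
  have N0: "N > 0" unfolding pm using p by simp
  have Nx: "of_nat j = N * x" using N0 by (simp add: x_def)
  have x0: "0 < x" "x < 1" using j N0 unfolding x_def pm by simp_all
  have fr: "frac y = z" if "y - z = of_int k" "0 \<le> z" "z < 1" for y z :: rat and k
    using that by (simp add: frac_unique_iff)
  have fl: "\<lfloor>y\<rfloor> = k" if "of_int k \<le> y" "y < of_int k + 1" for y :: rat and k
    using that by (simp add: floor_eq_iff)
  note aux = G_coeff_third_aux[OF p j x_def[unfolded N_def]]
  have even: "even ?n" using odd_card[OF p] by simp
  show ?thesis
    unfolding N_def[symmetric] x_def[symmetric]
  proof -
    consider "3 * j \<le> ?n" | "?n < 3 * j" "2 * j < ?n" | "?n \<le> 2 * j" "3 * j
      \<le> 2 * ?n" | "2 * ?n < 3 * j"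
      by linarith
    then show "G_coeff (1 / 3) (2 / 3) x
      = - (to_padic (teichmuller (4 / 27 :: 'p mod_ring) ^ j * cubic_sum j))"
    proof cases
      case 1
      then have "(of_nat (3 * j) :: rat) \<le> of_nat ?n" by (simp only: of_nat_le_iff)
      then have "3 * (N * x) \<le> N" unfolding Nx[symmetric] unfolding pm of_nat_mult of_nat_numeral .
      then have x: "x \<le> 1 / 3" using N0 by (simp add: field_simps)
      have a: "of_nat (2 * j) / N = 2 * x" by (simp add: x_def)
      have "of_nat (?n - 3 * j) = N - 3 * (N * x)" using 1 unfolding Nx[symmetric] unfolding pm
        by (subst of_nat_diff) simp_all
      then have c: "of_nat (?n - 3 * j) / N = 1 - 3 * x" using N0 by (simp add: diff_divide_distrib)
      have f: "\<lfloor>1 / 3 - x\<rfloor> = 0" "\<lfloor>2 / 3 - x\<rfloor> = 0" "\<lfloor>1 / 2 + x\<rfloor> = 0" using x x0 by (auto intro!: fl)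
      have g:
        "frac (1 / 3 - x) = 1 / 3 - x" "frac (2 / 3 - x) = 2 / 3 - x" "frac (x - 1 / 2) = x + 1 / 2"
        using x x0 by (auto intro: fr[of _ _ 0] fr[of _ _ "- 1"])
      have h:
        "(1 - 3 * x) / 3 = 1 / 3 - x" "(1 - 3 * x + 1) / 3 = 2 / 3 - x" "(1 - 3 * x + 2) / 3
        = 1 - x"
        "(2 * x) / 2 = x" "(2 * x + 1) / 2 = x + 1 / 2" by (simp_all add: field_simps)
      show ?thesis
        by (rule aux[where a="2 * j" and k=0 and za="2 * x" and c="?n - 3 * j" and l=1 and zc="1 - 3 * x" and e=0])
          (simp_all only: N_def[symmetric] a c f g h, use 1 j in \<open>simp_all add: mult_ac\<close>)
    next
      case 2
      then have "(of_nat ?n :: rat) < of_nat (3 * j)" "(of_nat (2 * j) :: rat) < of_nat ?n"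
        by (simp_all only: of_nat_less_iff)
      then have "N < 3 * (N * x)" "2 * (N * x) < N" unfolding Nx[symmetric]
        unfolding pm of_nat_mult of_nat_numeral .
      then have x: "1 / 3 < x" "x < 1 / 2" using N0 by (simp_all add: field_simps)
      have a: "of_nat (2 * j) / N = 2 * x" by (simp add: x_def)
      have "of_nat (2 * ?n - 3 * j) = 2 * N - 3 * (N * x)" using 2 unfolding Nx[symmetric]
        unfolding pm by (subst of_nat_diff) simp_all
      then have c: "of_nat (2 * ?n - 3 * j) / N = 2 - 3 * x" using N0
        by (simp add: diff_divide_distrib)
      have f: "\<lfloor>1 / 3 - x\<rfloor> = - 1" "\<lfloor>2 / 3 - x\<rfloor> = 0" "\<lfloor>1 / 2 + x\<rfloor> = 0" using x x0
        by (auto intro!: fl)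
      have g:
        "frac (1 / 3 - x) = 4 / 3 - x" "frac (2 / 3 - x) = 2 / 3 - x" "frac (x - 1 / 2) = x + 1 / 2"
        using x x0 by (auto intro: fr[of _ _ 0] fr[of _ _ "- 1"])
      have h:
        "(2 - 3 * x) / 3 = 2 / 3 - x" "(2 - 3 * x + 1) / 3 = 1 - x" "(2 - 3 * x + 2) / 3
        = 4 / 3 - x"
        "(2 * x) / 2 = x" "(2 * x + 1) / 2 = x + 1 / 2" by (simp_all add: field_simps)
      show ?thesis
        by (rule aux[where a="2 * j" and k=0 and za="2 * x" and c="2 * ?n - 3 * j" and l=2 and zc="2 - 3 * x" and e=1])
          (simp_all only: N_def[symmetric] a c f g h, use 2 j in \<open>simp_all add: mult_ac\<close>)
    next
      case 3
      then have "(of_nat ?n :: rat) \<le> of_nat (2 * j)" "(of_nat (3 * j) :: rat) \<le> of_nat (2 * ?n)"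
        by (simp_all only: of_nat_le_iff)
      then have "N \<le> 2 * (N * x)" "3 * (N * x) \<le> 2 * N" unfolding Nx[symmetric]
        unfolding pm of_nat_mult of_nat_numeral .
      then have x: "1 / 2 \<le> x" "x \<le> 2 / 3" using N0 by (simp_all add: field_simps)
      have "of_nat (2 * j - ?n) = 2 * (N * x) - N" using 3 unfolding Nx[symmetric] unfolding pm
        by (subst of_nat_diff) simp_all
      then have a: "of_nat (2 * j - ?n) / N = 2 * x - 1" using N0 by (simp add: diff_divide_distrib)
      have "of_nat (2 * ?n - 3 * j) = 2 * N - 3 * (N * x)" using 3 unfolding Nx[symmetric]
        unfolding pm by (subst of_nat_diff) simp_all
      then have c: "of_nat (2 * ?n - 3 * j) / N = 2 - 3 * x" using N0
        by (simp add: diff_divide_distrib)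
      have f: "\<lfloor>1 / 3 - x\<rfloor> = - 1" "\<lfloor>2 / 3 - x\<rfloor> = 0" "\<lfloor>1 / 2 + x\<rfloor> = 1" using x x0
        by (auto intro!: fl)
      have g:
        "frac (1 / 3 - x) = 4 / 3 - x" "frac (2 / 3 - x) = 2 / 3 - x" "frac (x - 1 / 2) = x - 1 / 2"
        using x x0 by (auto intro: fr[of _ _ 0] fr[of _ _ "- 1"])
      have h:
        "(2 - 3 * x) / 3 = 2 / 3 - x" "(2 - 3 * x + 1) / 3 = 1 - x" "(2 - 3 * x + 2) / 3
        = 4 / 3 - x"
        "(2 * x - 1) / 2 = x - 1 / 2" "(2 * x - 1 + 1) / 2 = x" by (simp_all add: field_simps)
      show ?thesis
        by (rule aux[where a="2 * j - ?n" and k=1 and za="2 * x - 1" and c="2 * ?n - 3 * j" and l=2 and zc="2 - 3 * x" and e=0])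
          (simp_all only: N_def[symmetric] a c f g h, use 3 j in \<open>simp_all add: mult_ac\<close>)
    next
      case 4
      then have "(of_nat (2 * ?n) :: rat) < of_nat (3 * j)" by (simp only: of_nat_less_iff)
      then have "2 * N < 3 * (N * x)" unfolding Nx[symmetric]
        unfolding pm of_nat_mult of_nat_numeral .
      then have x: "2 / 3 < x" using N0 by (simp add: field_simps)
      have "of_nat (2 * j - ?n) = 2 * (N * x) - N" using 4 unfolding Nx[symmetric] unfolding pm
        by (subst of_nat_diff) simp_all
      then have a: "of_nat (2 * j - ?n) / N = 2 * x - 1" using N0 by (simp add: diff_divide_distrib)
      have "of_nat (3 * ?n - 3 * j) = 3 * N - 3 * (N * x)" using j unfolding Nx[symmetric]
        unfolding pm by (subst of_nat_diff) simp_all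
      then have c: "of_nat (3 * ?n - 3 * j) / N = 3 - 3 * x" using N0
        by (simp add: diff_divide_distrib)
      have f: "\<lfloor>1 / 3 - x\<rfloor> = - 1" "\<lfloor>2 / 3 - x\<rfloor> = - 1" "\<lfloor>1 / 2 + x\<rfloor> = 1" using x x0
        by (auto intro!: fl)
      have g:
        "frac (1 / 3 - x) = 4 / 3 - x" "frac (2 / 3 - x) = 5 / 3 - x" "frac (x - 1 / 2) = x - 1 / 2"
        using x x0 by (auto intro: fr[of _ _ 0] fr[of _ _ "- 1"])
      have h:
        "(3 - 3 * x) / 3 = 1 - x" "(3 - 3 * x + 1) / 3 = 4 / 3 - x" "(3 - 3 * x + 2) / 3
        = 5 / 3 - x"
        "(2 * x - 1) / 2 = x - 1 / 2" "(2 * x - 1 + 1) / 2 = x" by (simp_all add: field_simps)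
      show ?thesis
        by (rule aux[where a="2 * j - ?n" and k=1 and za="2 * x - 1" and c="3 * ?n - 3 * j" and l=3 and zc="3 - 3 * x" and e=1])
          (simp_all only: N_def[symmetric] a c f g h, use 4 j in \<open>simp_all add: mult_ac\<close>)
    qed
  qed
qed

lemma G_coeff_third_0:
  assumes "CARD('p) > 3"
  shows "G_coeff (1 / 3) (2 / 3) 0 = (1 :: 'p::prime_card padic)"
proof -
  note odd = odd_card[OF assms]
  have fl: "\<lfloor>1 / 3 :: rat\<rfloor> = 0" "\<lfloor>2 / 3 :: rat\<rfloor> = 0" "\<lfloor>1 / 2 :: rat\<rfloor> = 0"
    by (simp_all add: floor_eq_iff)
  have fr: "frac (1 / 3 :: rat) = 1 / 3" "frac (2 / 3 :: rat) = 2 / 3" by (simp_all add: frac_eq)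
  have "(g1 * g2 * (1 * g3)) / (g1 * g2 * g3) = 1" if "g1 \<noteq> 0" "g2 \<noteq> 0" "g3 \<noteq> 0" for g1 g2 g3 ::
    "'p padic"
    using that by simp
  from this[OF Gamma_rat_neq_0[OF odd] Gamma_rat_neq_0[OF odd] Gamma_rat_neq_0[OF odd], of "1 / 3" "2 / 3" "1 / 2"]
  show ?thesis
    unfolding G_coeff_def diff_zero add_0_right fl fr Gamma_rat_0[OF odd] diff_0 frac_half
    by simp
qed

lemma sum_teich_power_j:
  fixes s :: "'p::prime_card mod_ring"
  assumes "s \<noteq> 0"
  shows "(\<Sum>j<CARD('p) - 1. teichmuller s ^ j) = (if s = 1 then of_nat (CARD('p) - 1) else 0)"
proof (cases "s = 1")
  case False
  then have "teichmuller s \<noteq> 1" using teich_eq_iff[of s 1] by simp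
  from sum_power_roots[OF teich_pow_card_minus_1[OF assms] this] show ?thesis using False by simp
qed simp

text \<open>Orthogonality of characters; \<open>y = 0\<close> and \<open>y = 1\<close> are not
  counted because \<open>s\<close> is nonzero.\<close>

lemma count_cubic_roots:
  fixes s :: "'p::prime_card mod_ring"
  assumes "s \<noteq> 0"
  shows "of_nat (CARD('p) - 1) * of_nat (card {y. y ^ 2 * (1 - y) = s})
    = (\<Sum>j<CARD('p) - 1. teichmuller s ^ j * cubic_sum j)"
proof -
  let ?V = "UNIV - {0, 1 :: 'p mod_ring}" and ?n = "CARD('p) - 1"
  have "(\<Sum>j<?n. teichmuller s ^ j * cubic_sum j)
      = (\<Sum>y\<in>?V. \<Sum>j<?n. teichmuller (s / (y ^ 2 * (1 - y))) ^ j)"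
    unfolding cubic_sum_def sum_distrib_left
    by (subst sum.swap) (simp add: power_mult_distrib[symmetric] teich_mult[symmetric])
  also have "\<dots> = (\<Sum>y\<in>?V. if y ^ 2 * (1 - y) = s then of_nat ?n else 0)"
  proof (rule sum.cong[OF refl])
    fix y assume y: "y \<in> ?V"
    then have nz: "y ^ 2 * (1 - y) \<noteq> 0" by simp
    have "s / (y ^ 2 * (1 - y)) \<noteq> 0" using assms nz by simp
    from sum_teich_power_j[OF this]
    show "(\<Sum>j<?n. teichmuller (s / (y ^ 2 * (1 - y))) ^ j)
      = (if y ^ 2 * (1 - y) = s then of_nat ?n else 0)"
      using nz by (auto simp: divide_eq_1_iff)
  qed
  also have "\<dots> = (\<Sum>y\<in>{y. y ^ 2 * (1 - y) = s}. of_nat ?n)"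
    using assms by (intro sum.mono_neutral_cong_right) auto
  finally show ?thesis by (simp add: mult.commute del: One_nat_def)
qed

lemma inv_teichmuller_power_eq:
  assumes "t \<noteq> 0"
  shows "inv_teichmuller_power j (t :: 'p::prime_card mod_ring)
    = to_padic (teichmuller (1 / t) ^ j)"
proof -
  have "teichmuller t * teichmuller (1 / t) = 1" using assms by (simp flip: teich_mult)
  from arg_cong[OF this, of to_padic] have "teich_padic t * teich_padic (1 / t) = 1"
    unfolding to_padic_simps .
  then have "inverse (teich_padic t) = teich_padic (1 / t)" by (rule inverse_unique)
  then show ?thesis unfolding inv_teichmuller_power_def to_padic_power using assms
    by (simp only: if_False)
qed

theorem G2_eq_card:
  assumes p: "CARD('p) > 3" and t: "t \<noteq> (0 :: 'p::prime_card mod_ring)"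
  shows "G2 t = of_nat (card {y. y ^ 2 * (1 - y) = 4 / (27 * t)}) - 1"
proof -
  let ?n = "CARD('p) - 1" and ?s = "4 / (27 * t)"
  let ?C = "card {y. y ^ 2 * (1 - y) = 4 / (27 * t)}"
  let ?f = "\<lambda>j. inv_teichmuller_power j t * G_coeff (1 / 3) (2 / 3) (of_nat j / (of_nat CARD('p) - 1))"
  let ?g = "\<lambda>j. teichmuller ?s ^ j * cubic_sum j :: 'p padic_int"
  have s0: "?s \<noteq> 0" using t of_nat_mod_ring_neq_0[OF p] by simp
  obtain m where m: "?n = Suc m" using p by (cases ?n) auto
  have f: "?f (Suc j) = - to_padic (?g (Suc j))" if "j < m" for j
  proof -
    have st: "teichmuller (1 / t) ^ k * teichmuller (4 / 27) ^ k = teichmuller ?s ^ k" for k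
      by (simp flip: power_mult_distrib teich_mult) (simp add: mult.commute)
    have "G_coeff (1 / 3) (2 / 3) (of_nat (Suc j) / (of_nat CARD('p) - 1))
        = - (to_padic (teichmuller (4 / 27 :: 'p mod_ring) ^ Suc j * cubic_sum (Suc j)))"
      using that m by (intro G_coeff_third p) simp_all
    then show ?thesis
      unfolding inv_teichmuller_power_eq[OF t] st[symmetric] to_padic_mult
      by (simp only: mult_minus_right mult.assoc)
  qed
  \<comment> \<open>At \<open>j = 0\<close> the coefficient is 1 instead of minus this value
    \<open>p - 2\<close>; the discrepancy \<open>p - 1\<close> produces the \<open>- 1\<close> in
    the statement.\<close>
  have c0: "cubic_sum 0 = (of_nat ?n - 1 :: 'p padic_int)"
  proof -
    have "card (UNIV - {0, 1 :: 'p mod_ring}) = CARD('p) - 2" by (simp add: card_Diff_subset)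
    then show ?thesis unfolding cubic_sum_def using p by (simp add: of_nat_diff)
  qed
  have "(\<Sum>j<?n. ?f j) = ?f 0 + (\<Sum>j<m. ?f (Suc j))"
    unfolding m by (rule sum.lessThan_Suc_shift)
  also have "?f 0 = 1" using G_coeff_third_0[OF p] t by (simp add: inv_teichmuller_power_def)
  also have "(\<Sum>j<m. ?f (Suc j)) = - to_padic (\<Sum>j<m. ?g (Suc j))"
    unfolding to_padic_sum sum_negf[symmetric] by (rule sum.cong[OF refl]) (rule f, simp)
  also have "(\<Sum>j<m. ?g (Suc j)) = of_nat ?n * of_nat ?C - (of_nat ?n - 1)"
  proof -
    have "(\<Sum>j<?n. ?g j) = ?g 0 + (\<Sum>j<m. ?g (Suc j))"
      unfolding m by (rule sum.lessThan_Suc_shift)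
    then show ?thesis unfolding count_cubic_roots[OF s0, symmetric] by (simp add: c0)
  qed
  finally have "(\<Sum>j<?n. ?f j) = of_nat ?n * (1 - of_nat ?C)"
    unfolding to_padic_simps by (simp add: algebra_simps)
  moreover have "(of_nat ?n :: 'p padic) \<noteq> 0" unfolding m by (simp del: of_nat_Suc)
  moreover have "(- 1) / n * (n * (1 - c)) = c - 1" if "n \<noteq> 0" for n c :: "'p padic"
    using that by (simp add: field_simps)
  ultimately show ?thesis
    unfolding G2_def using mccarthy_G_eq[OF p, of "1 / 3" "2 / 3" t] by simp
qed

section \<open>The quadratic twist\<close>

lemma Gamma_rat_sixths:
  assumes p: "CARD('p) > 3"
  shows "Gamma_rat (1 / 6) * Gamma_rat (5 / 6)
    = of_int (quad_char (3 :: 'p::prime_card mod_ring)) * (Gamma_rat (1 / 3) * Gamma_rat (2 / 3) :: 'p padic)"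
proof -
  let ?h = "(CARD('p) - 1) div 2"
  have odd: "odd CARD('p)" by (rule odd_card[OF p])
  then have "CARD('p) = 2 * ?h + 1" by (elim oddE) simp
  then have "(of_nat CARD('p) :: rat) = 2 * of_nat ?h + 1"
    by (metis of_nat_1 of_nat_add of_nat_mult of_nat_numeral)
  moreover have "(of_nat CARD('p) - 1 :: rat) \<noteq> 0" using p by simp
  ultimately have z: "1 / 2 = of_nat ?h / (of_nat CARD('p) - 1 :: rat)" by (simp add: field_simps)
  have "?h < CARD('p)" using p by simp
  \<comment> \<open>Triplication at \<open>z = 1/2\<close> has the arguments 1/6, 1/2, 5/6, and its
    constant is \<open>\<omega>(3)^((p-1)/2)\<close>, the quadratic character of 3.\<close>
  from Gamma_rat_triple[OF p this z]
  have "Gamma_rat (1 / 6) * Gamma_rat (1 / 2) * Gamma_rat (5 / 6)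
      = of_int (quad_char (3 :: 'p mod_ring)) * Gamma_rat (1 / 2) * (Gamma_rat (1 / 3) * Gamma_rat (2 / 3) :: 'p padic)"
    unfolding teich_padic_half_power[OF p of_nat_mod_ring_neq_0(2)[OF p]] by simp
  moreover have "a * g * b = q * g * c \<Longrightarrow> g \<noteq> 0 \<Longrightarrow> a * b = q * c" for a b g q c :: "'p padic"
    by (simp add: mult_ac)
  ultimately show ?thesis using Gamma_rat_neq_0[OF odd] by blast
qed

text \<open>A shift of \<open>x\<close> by 1/2 carries \<open>{1/6, 5/6} - x\<close> to
  \<open>{2/3, 1/3} - x'\<close> modulo 1 and exchanges \<open>x\<close> with the fractional part of
  \<open>x - 1/2\<close>; the changes of the floors cancel. Only the normalising gamma values
  differ, by \<open>Gamma_rat_sixths\<close>.\<close>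

lemma G_coeff_sixth:
  assumes p: "CARD('p) > 3" and x:
    "0 \<le> x" "x < 1" "0 \<le> x'" "x' < 1" "x' = x + 1 / 2 \<or> x' = x - 1 / 2"
  shows "of_int (quad_char (3 :: 'p::prime_card mod_ring)) * G_coeff (1 / 6) (5 / 6) x
    = (G_coeff (1 / 3) (2 / 3) x' :: 'p padic)"
proof -
  have odd: "odd CARD('p)" by (rule odd_card[OF p])
  have shift:
    "\<lfloor>y + 1\<rfloor> = \<lfloor>y\<rfloor> + 1" "frac (y + 1) = frac y" "\<lfloor>y - 1\<rfloor> = \<lfloor>y\<rfloor> - 1" "frac (y - 1) = frac y"
    for y :: rat by (simp_all add: frac_def)
  let ?E = "\<lambda>a b x. - \<lfloor>a - x\<rfloor> - \<lfloor>b - x\<rfloor> - \<lfloor>1 / 2 + x :: rat\<rfloor>"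
  let ?X = "\<lambda>a b x. Gamma_rat (frac (a - x)) * Gamma_rat (frac (b - x)) * (Gamma_rat x * Gamma_rat (frac (x - 1 / 2))) :: 'p padic"
  have "?E (1 / 6) (5 / 6) x = ?E (1 / 3) (2 / 3) x' \<and> ?X (1 / 6) (5 / 6) x = ?X (1 / 3) (2 / 3) x'"
    using x(5)
  proof
    assume e: "x' = x + 1 / 2"
    then have "\<lfloor>1 / 2 + x'\<rfloor> = 1" "\<lfloor>1 / 2 + x\<rfloor> = 0" using x by (simp_all add: floor_eq_iff)
    moreover have s: "1 / 6 - x = 2 / 3 - x'" "5 / 6 - x = (1 / 3 - x') + 1" using e by simp_all
    have "\<lfloor>5 / 6 - x\<rfloor> = \<lfloor>1 / 3 - x'\<rfloor> + 1" "frac (5 / 6 - x) = frac (1 / 3 - x')"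
      unfolding s(2) shift by (rule refl)+
    moreover have "frac (x' - 1 / 2) = x" "frac (x - 1 / 2) = x'"
    proof -
      show "frac (x' - 1 / 2) = x" using e x by (simp add: frac_eq)
      have "x - 1 / 2 = x' - 1" using e by simp
      then show "frac (x - 1 / 2) = x'" using x by (simp add: frac_unique_iff)
    qed
    ultimately show ?thesis unfolding s(1) by (simp add: mult_ac)
  next
    assume e: "x' = x - 1 / 2"
    then have "\<lfloor>1 / 2 + x'\<rfloor> = 0" "\<lfloor>1 / 2 + x\<rfloor> = 1" using x by (simp_all add: floor_eq_iff)
    moreover have s: "5 / 6 - x = 1 / 3 - x'" "1 / 6 - x = (2 / 3 - x') - 1" using e by simp_all
    have "\<lfloor>1 / 6 - x\<rfloor> = \<lfloor>2 / 3 - x'\<rfloor> - 1" "frac (1 / 6 - x) = frac (2 / 3 - x')"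
      unfolding s(2) shift by (rule refl)+
    moreover have "frac (x' - 1 / 2) = x" "frac (x - 1 / 2) = x'"
    proof -
      show "frac (x - 1 / 2) = x'" using e x by (simp add: frac_eq)
      have "x' - 1 / 2 = x - 1" using e by simp
      then show "frac (x' - 1 / 2) = x" using x by (simp add: frac_unique_iff)
    qed
    ultimately show ?thesis unfolding s(1) by (simp add: mult_ac)
  qed
  then have E: "?E (1 / 6) (5 / 6) x = ?E (1 / 3) (2 / 3) x'" and X:
    "?X (1 / 6) (5 / 6) x = ?X (1 / 3) (2 / 3) x'"
    by blast+
  have alg: "q * (P * X / (q * g * h)) = P * X / (g * h)" if "q \<noteq> 0" for q P X g h :: "'p padic"
    using that by (simp add: field_simps)
  have "of_int (quad_char (3 :: 'p mod_ring)) \<noteq> (0 :: 'p padic)"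
    using Gamma_rat_sixths[OF p] Gamma_rat_neq_0[OF odd] by (metis mult_eq_0_iff)
  from alg[OF this] show ?thesis
    unfolding G_coeff_def E X Gamma_rat_sixths[OF p] by blast
qed

lemma sum_lessThan_add:
  fixes f :: "nat \<Rightarrow> 'a::comm_monoid_add"
  shows "(\<Sum>j<m + k. f j) = (\<Sum>j<m. f j) + (\<Sum>j<k. f (m + j))"
  by (induction k) (simp_all add: add.assoc)

theorem G2_tilde_eq:
  assumes p: "CARD('p) > 3" and t: "t \<noteq> (0 :: 'p::prime_card mod_ring)"
  shows "G2_tilde t = of_int (quad_char (3 * t)) * G2 t"
proof -
  define h where "h = (CARD('p) - 1) div 2"
  define N where "N = (of_nat CARD('p) - 1 :: rat)"
  define w where "w = teich_padic (1 / t)"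
  define q where "q = (of_int (quad_char (3 :: 'p mod_ring)) :: 'p padic)"
  define S
    where "S = (\<lambda>a b. \<Sum>j<CARD('p) - 1. inv_teichmuller_power j t * G_coeff a b (of_nat j / N))"
  let ?G = "\<lambda>j. G_coeff (1 / 3) (2 / 3) (of_nat j / N) :: 'p padic"
  let ?H = "\<lambda>j. G_coeff (1 / 6) (5 / 6) (of_nat j / N) :: 'p padic"
  note half_power = teich_padic_half_power[OF p, folded h_def]
  note three = of_nat_mod_ring_neq_0(2)[OF p]
  have odd: "odd CARD('p)" by (rule odd_card[OF p])
  then have hh: "CARD('p) - 1 = h + h" unfolding h_def by (elim oddE) simp
  have "N = of_nat (CARD('p) - 1)" unfolding N_def using p by (simp add: of_nat_diff)
  then have "N = of_nat (h + h)" unfolding hh .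
  then have N: "N = 2 * of_nat h" by simp
  have h0: "h > 0" using p hh by linarith
  have half: "of_nat h / N = 1 / 2" unfolding N using h0 by simp
  have inv: "inv_teichmuller_power j t = w ^ j" for j
    unfolding inv_teichmuller_power_eq[OF t] w_def to_padic_power ..
  have sq: "teich_padic a ^ h * teich_padic a ^ h = 1" if "a \<noteq> 0" for a :: "'p mod_ring"
    unfolding power_add[symmetric] hh[symmetric]
    by (simp only: to_padic_power[symmetric] teich_pow_card_minus_1[OF that] to_padic_1)
  have qq: "q * q = 1" using sq[OF three] unfolding q_def half_power[OF three] .
  have ww: "w ^ h * w ^ h = 1" using sq[of "1 / t"] t by (simp add: w_def)
  have tw: "teich_padic t ^ h = w ^ h"
  proof -
    have "teichmuller t * teichmuller (1 / t) = 1" using t by (simp flip: teich_mult)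
    from arg_cong[OF this, of to_padic] have "teich_padic t * w = 1"
      unfolding w_def to_padic_simps .
    then have "teich_padic t ^ h * w ^ h = 1"
      by (simp only: power_mult_distrib[symmetric] power_one)
    then have "teich_padic t ^ h * (w ^ h * w ^ h) = w ^ h"
      by (simp only: mult.assoc[symmetric] mult_1)
    then show ?thesis unfolding ww by simp
  qed
  have "3 * t \<noteq> 0" using three t by simp
  from half_power[OF this]
  have qt: "of_int (quad_char (3 * t)) = q * w ^ h"
    unfolding teich_mult to_padic_mult power_mult_distrib half_power[OF three] tw q_def
      by (rule sym)
  have bd: "0 \<le> of_nat j / N" "of_nat j / N < 1 / 2" if "j < h" for j
  proof -
    have "(of_nat j :: rat) < of_nat h" using that by (simp only: of_nat_less_iff)
    then show "0 \<le> of_nat j / N" "of_nat j / N < 1 / 2"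
      unfolding N using h0 by (simp_all add: field_simps del: of_nat_less_iff)
  qed
  have sh: "of_nat (h + j) / N = of_nat j / N + 1 / 2" for j
    unfolding of_nat_add add_divide_distrib half by simp
  have key: "q * G_coeff (1 / 6) (5 / 6) y = (G_coeff (1 / 3) (2 / 3) (y + 1 / 2) :: 'p padic)"
    "q * G_coeff (1 / 6) (5 / 6) (y + 1 / 2) = (G_coeff (1 / 3) (2 / 3) y :: 'p padic)"
    if "0 \<le> y" "y < 1 / 2" for y
    unfolding q_def using that by (intro G_coeff_sixth p; simp)+
  have G1: "q * ?H j = ?G (h + j)" if "j < h" for j
    unfolding sh by (rule key(1)[OF bd[OF that]])
  have G2: "q * ?H (h + j) = ?G j" if "j < h" for j
    unfolding sh by (rule key(2)[OF bd[OF that]])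
  \<comment> \<open>The shift by \<open>h\<close> exchanges the two halves of the range of
    \<open>j\<close> and pulls out \<open>w ^ h\<close>, the quadratic character of
    \<open>t\<close>.\<close>
  have "q * S (1 / 6) (5 / 6) = (\<Sum>j<h. w ^ j * (q * ?H j)) + (\<Sum>j<h. w ^ (h + j) * (q * ?H (h + j)))"
    unfolding S_def inv hh sum_lessThan_add distrib_left sum_distrib_left
      by (simp only: mult.left_commute)
  also have "\<dots> = (\<Sum>j<h. w ^ j * ?G (h + j)) + (\<Sum>j<h. w ^ (h + j) * ?G j)"
    by (intro arg_cong2[where f="(+)"] sum.cong refl) (simp_all only: G1 G2 lessThan_iff)
  also have "\<dots> = (\<Sum>j<h. (w ^ h * w ^ h) * (w ^ j * ?G (h + j))) + (\<Sum>j<h. w ^ (h + j) * ?G j)"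
    unfolding ww by simp
  also have "\<dots> = w ^ h * S (1 / 3) (2 / 3)"
    unfolding S_def inv hh sum_lessThan_add distrib_left sum_distrib_left power_add
    by (simp only: mult_ac add.commute)
  finally have "q * (q * S (1 / 6) (5 / 6)) = q * w ^ h * S (1 / 3) (2 / 3)"
    by (simp only: mult.assoc)
  then have S: "S (1 / 6) (5 / 6) = q * w ^ h * S (1 / 3) (2 / 3)"
    unfolding mult.assoc[symmetric] qq by simp
  have "G2_tilde t = (- 1) / of_nat (CARD('p) - 1) * S (1 / 6) (5 / 6)"
    unfolding G2_tilde_def S_def N_def by (rule mccarthy_G_eq[OF p]) simp_all
  moreover have "G2 t = (- 1) / of_nat (CARD('p) - 1) * S (1 / 3) (2 / 3)"
    unfolding G2_def S_def N_def by (rule mccarthy_G_eq[OF p]) simp_all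
  ultimately show ?thesis unfolding qt S by (simp only: mult_ac)
qed

lemma cubic_roots_eq:
  assumes p: "CARD('p) > 3" and t: "t \<noteq> (0 :: 'p::prime_card mod_ring)"
  shows "{y. poly [:4 / t, 0, - 27, 27:] y = 0} = {y. y ^ 2 * (1 - y) = 4 / (27 * t)}"
proof (rule Collect_cong)
  fix y
  note nz = of_nat_mod_ring_neq_0(4)[OF p]
  have "poly [:4 / t, 0, - 27, 27:] y = 4 / t - 27 * (y ^ 2 * (1 - y))"
    by (simp add: power2_eq_square algebra_simps)
  moreover have "4 / t = 27 * (4 / (27 * t))"
    by (simp only: times_divide_eq_right mult_divide_mult_cancel_left[OF nz])
  ultimately have eq: "poly [:4 / t, 0, - 27, 27:] y = 27 * (4 / (27 * t) - y ^ 2 * (1 - y))"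
    by (simp only: right_diff_distrib)
  have "27 * (a - b) = 0 \<longleftrightarrow> b = a" for a b :: "'p mod_ring" using nz by auto
  then show "poly [:4 / t, 0, - 27, 27:] y = 0 \<longleftrightarrow> y ^ 2 * (1 - y) = 4 / (27 * t)"
    unfolding eq .
qed

theorem theorem1p8:
  fixes t :: "'p::prime_card mod_ring"
    and f g :: "'p mod_ring poly"
    and r1 r2 :: nat
  assumes "CARD('p) > 3"
    and "t \<noteq> 0" and "t \<noteq> 1"
    and "f = [:4 / t, 0, -27, 27:]"
    and "g = [:4 / (1 - t), 0, -27, 27:]"
    and "r1 = card {y. poly f y = 0}"
    and "r2 = card {y. poly g y = 0}"
  shows "G2 t = G2 (1 - t) + G2_tilde (1 - t) + (of_nat r1 - of_nat r2)
           + (1 - of_nat r2) * of_int (quad_char (3 * (1 - t)))"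
proof -
  have t1: "1 - t \<noteq> 0" using assms(3) by simp
  have r1: "G2 t = of_nat r1 - 1"
    unfolding G2_eq_card[OF assms(1,2)] assms(6,4) cubic_roots_eq[OF assms(1,2)] ..
  have r2: "G2 (1 - t) = of_nat r2 - 1"
    unfolding G2_eq_card[OF assms(1) t1] assms(7,5) cubic_roots_eq[OF assms(1) t1] ..
  show ?thesis unfolding G2_tilde_eq[OF assms(1) t1] r1 r2 by (simp add: algebra_simps)
qed

end
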